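(* Let $\mathbb{R}^n=E_0\oplus E_1\oplus\cdots\oplus E_k$ be a fixed orthogonal decomposition of Euclidean space $(\mathbb{R}^n,|\cdot|)$. Let $\mu=\exp(-U(x))\,dx$ and $\nu=\exp(-(U(x)+V(x)))\,dx$ be two Borel probability measures on $\mathbb{R}^n$. Assume that $U\in C^{3,\alpha}_{loc}(\mathbb{R}^n)$ for some $\alpha>0$, that $U$ is convex, and that $$U(x)=Q(\mathrm{Proj}_{E_0}x)+\sum_{i=1}^k\rho_i(|\mathrm{Proj}_{E_i}x|),\qquad \rho_i'''\le 0\ \text{ on }\mathbb{R}_+\ \text{ for all } i=1,\ldots,k,$$ where $Q:E_0\to\mathbb{R}$ is a quadratic function $Q(y)=\langle Ay,y\rangle+\langle b,y\rangle+c$ with $A$ positive-definite. Assume that $V:\mathbb{R}^n\to\mathbb{R}$ is convex and invariant under $O(E_1,\ldots,E_k)$. Then $P^U_t$ preserves the log-concavity of $\exp(-V)$: the function $-\log P^U_t(\exp(-V))$ is convex for all $t\ge0$.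
   Context: $\mathbb{R}_+=[0,\infty)$; the $\rho_i$ are real-valued functions on $\mathbb{R}_+$; $\mathrm{Proj}_E$ is orthogonal projection onto $E$. The subspace $E_0$ may be trivial, and $k$ may be $0$. $O(E_1,\ldots,E_k):=1\times O(E_1)\times\cdots\times O(E_k)\subset O(n)$ (identity on $E_0$, orthogonal transformations on each $E_i$, $i\ge1$). Let $L=\Delta-\langle\nabla\,\cdot\,,\nabla U\rangle$. The diffusion semi-group $P^U_t=\exp(tL)$ is defined on smooth bounded functions $f$ as the unique bounded solution of $\frac{d}{dt}P^U_t(f)=L(P^U_t(f))$, $P^U_0(f)=f$; it satisfies $\|P^U_t f\|_{L_p(\mu)}\le\|f\|_{L_p(\mu)}$ for all $p\in[1,\infty]$ and is extended to the spaces $L_p(\mu)$, in particular to $L_1(\mu)\ni\exp(-V)$; elements of $L_1(\mu)$ are as usual identified up to a.e. equality. *)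

theory Defs
  imports "HOL-Analysis.Analysis" "HOL-Probability.Probability"
begin

section \<open>Regularity classes\<close>

definition partial_deriv :: "'a::euclidean_space \<Rightarrow> ('a \<Rightarrow> real) \<Rightarrow> 'a \<Rightarrow> real" where
  "partial_deriv b f x = frechet_derivative f (at x) b"

text \<open>All iterated partial derivatives of order less than \<open>m\<close> are (everywhere) differentiable, and
  all those of order exactly \<open>m\<close> satisfy \<open>R\<close>.\<close>

fun partials_upto :: "(('a::euclidean_space \<Rightarrow> real) \<Rightarrow> bool) \<Rightarrow> nat \<Rightarrow> ('a \<Rightarrow> real) \<Rightarrow> bool" where
  "partials_upto R 0 f \<longleftrightarrow> R f"
| "partials_upto R (Suc m) f \<longleftrightarrow>
     (\<forall>x. f differentiable (at x)) \<and> (\<forall>b\<in>Basis. partials_upto R m (partial_deriv b f))"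

definition C_m :: "nat \<Rightarrow> ('a::euclidean_space \<Rightarrow> real) \<Rightarrow> bool" where
  "C_m m f \<longleftrightarrow> partials_upto (continuous_on UNIV) m f"

definition smooth_bounded :: "('a::euclidean_space \<Rightarrow> real) \<Rightarrow> bool" where
  "smooth_bounded f \<longleftrightarrow> (\<forall>m. C_m m f) \<and> bounded (range f)"

definition locally_Hoelder :: "real \<Rightarrow> ('a::euclidean_space \<Rightarrow> real) \<Rightarrow> bool" where
  "locally_Hoelder \<alpha> f \<longleftrightarrow>
     (\<forall>K. compact K \<longrightarrow> (\<exists>C. \<forall>x\<in>K. \<forall>y\<in>K. \<bar>f x - f y\<bar> \<le> C * dist x y powr \<alpha>))"

text \<open>The class $C^{m,\alpha}_{loc}$; local Hoelder continuity of the derivatives of top order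
  includes their continuity, as \<open>\<alpha> > 0\<close> in all uses.\<close>

definition C_m_alpha_loc :: "nat \<Rightarrow> real \<Rightarrow> ('a::euclidean_space \<Rightarrow> real) \<Rightarrow> bool" where
  "C_m_alpha_loc m \<alpha> f \<longleftrightarrow> partials_upto (locally_Hoelder \<alpha>) m f"

text \<open>The derivatives are taken relative to \<open>[0,\<infinity>)\<close>, hence they are one-sided at \<open>0\<close>, and the values
  of \<open>\<rho>\<close> at negative arguments play no role.\<close>

definition third_deriv_nonpos :: "(real \<Rightarrow> real) \<Rightarrow> bool" where
  "third_deriv_nonpos \<rho> \<longleftrightarrow>
     (\<exists>\<rho>1 \<rho>2 \<rho>3. \<forall>r\<in>{0..}.
        (\<rho> has_real_derivative \<rho>1 r) (at r within {0..}) \<and>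
        (\<rho>1 has_real_derivative \<rho>2 r) (at r within {0..}) \<and>
        (\<rho>2 has_real_derivative \<rho>3 r) (at r within {0..}) \<and>
        \<rho>3 r \<le> 0)"


section \<open>Orthogonal decompositions\<close>

definition orthogonal_decomposition :: "(nat \<Rightarrow> 'a::euclidean_space set) \<Rightarrow> nat \<Rightarrow> bool" where
  "orthogonal_decomposition E k \<longleftrightarrow>
     (\<forall>i\<le>k. subspace (E i)) \<and>
     (\<forall>i\<le>k. \<forall>j\<le>k. i \<noteq> j \<longrightarrow> (\<forall>x\<in>E i. \<forall>y\<in>E j. orthogonal x y)) \<and>
     span (\<Union>i\<le>k. E i) = UNIV"

definition Proj :: "'a::euclidean_space set \<Rightarrow> 'a \<Rightarrow> 'a" where
  "Proj S x = (THE y. y \<in> S \<and> (\<forall>z\<in>S. orthogonal (x - y) z))"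

text \<open>\<open>1 \<times> O(E 1) \<times> \<dots> \<times> O(E k)\<close>, as a group of transformations of the whole space.\<close>

definition O_group :: "(nat \<Rightarrow> 'a::euclidean_space set) \<Rightarrow> nat \<Rightarrow> ('a \<Rightarrow> 'a) set" where
  "O_group E k = {g. orthogonal_transformation g \<and> (\<forall>x\<in>E 0. g x = x) \<and>
                     (\<forall>i\<in>{1..k}. g ` E i = E i)}"

text \<open>Only the restriction of \<open>A\<close> to \<open>S\<close> matters. Symmetry is part of positive definiteness.\<close>

definition pos_def_on :: "'a::euclidean_space set \<Rightarrow> ('a \<Rightarrow> 'a) \<Rightarrow> bool" where
  "pos_def_on S A \<longleftrightarrow> linear A \<and> A ` S \<subseteq> S \<and>
     (\<forall>x\<in>S. \<forall>y\<in>S. A x \<bullet> y = x \<bullet> A y) \<and> (\<forall>y\<in>S. y \<noteq> 0 \<longrightarrow> 0 < A y \<bullet> y)"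


section \<open>The diffusion semi-group\<close>

definition exp_measure :: "('a::euclidean_space \<Rightarrow> real) \<Rightarrow> 'a measure" where
  "exp_measure U = density lborel (\<lambda>x. ennreal (exp (- U x)))"

text \<open>\<open>L f = \<Delta> f - \<langle>\<nabla> f, \<nabla> U\<rangle>\<close>\<close>

definition gen_L :: "('a::euclidean_space \<Rightarrow> real) \<Rightarrow> ('a \<Rightarrow> real) \<Rightarrow> 'a \<Rightarrow> real" where
  "gen_L U f x = (\<Sum>b\<in>Basis. partial_deriv b (partial_deriv b f) x)
               - (\<Sum>b\<in>Basis. partial_deriv b f x * partial_deriv b U x)"

text \<open>\<open>u\<close> is a bounded classical solution, of class $C^{1,2}$ on \<open>[0,\<infinity>) \<times> \<real>\<^sup>n\<close>, of
  \<open>d/dt u = L u\<close>, \<open>u(0) = f\<close>. The derivative in \<open>t\<close> is one-sided at \<open>t = 0\<close>; its joint continuity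
  follows from the equation and that of the space derivatives.\<close>

definition bounded_solution ::
    "('a::euclidean_space \<Rightarrow> real) \<Rightarrow> ('a \<Rightarrow> real) \<Rightarrow> (real \<Rightarrow> 'a \<Rightarrow> real) \<Rightarrow> bool" where
  "bounded_solution U f u \<longleftrightarrow>
     (\<exists>B. \<forall>t\<ge>0. \<forall>x. \<bar>u t x\<bar> \<le> B) \<and>
     (\<forall>t\<ge>0. C_m 2 (u t)) \<and>
     continuous_on ({0..} \<times> UNIV) (\<lambda>(t, x). u t x) \<and>
     (\<forall>b\<in>Basis. continuous_on ({0..} \<times> UNIV) (\<lambda>(t, x). partial_deriv b (u t) x)) \<and>
     (\<forall>b\<in>Basis. \<forall>b'\<in>Basis.
        continuous_on ({0..} \<times> UNIV) (\<lambda>(t, x). partial_deriv b' (partial_deriv b (u t)) x)) \<and>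
     (\<forall>t\<ge>0. \<forall>x. ((\<lambda>s. u s x) has_real_derivative gen_L U (u t) x) (at t within {0..})) \<and>
     (\<forall>x. u 0 x = f x)"

definition tendsto_L1 :: "'a measure \<Rightarrow> (nat \<Rightarrow> 'a \<Rightarrow> real) \<Rightarrow> ('a \<Rightarrow> real) \<Rightarrow> bool" where
  "tendsto_L1 M F h \<longleftrightarrow> (\<forall>m. integrable M (F m)) \<and> integrable M h \<and>
     (\<lambda>m. LINT x|M. \<bar>F m x - h x\<bar>) \<longlonglongrightarrow> 0"

text \<open>\<open>P t h\<close> is \<open>P\<^sub>t\<^sup>U(h)\<close>: on smooth bounded initial data it is the unique bounded solution of the
  diffusion equation, and on \<open>L\<^sub>1(\<mu>)\<close> it is the extension by continuity. Smooth bounded functions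
  being dense in \<open>L\<^sub>1(\<mu>)\<close>, the second clause determines \<open>P t h\<close> up to a \<open>\<mu>\<close>-null set for each integrable
  \<open>h\<close>, and leaves the choice of the representative free.\<close>

definition diffusion_semigroup ::
    "('a::euclidean_space \<Rightarrow> real) \<Rightarrow> (real \<Rightarrow> ('a \<Rightarrow> real) \<Rightarrow> 'a \<Rightarrow> real) \<Rightarrow> bool" where
  "diffusion_semigroup U P \<longleftrightarrow>
     (\<forall>f. smooth_bounded f \<longrightarrow>
        bounded_solution U f (\<lambda>t. P t f) \<and>
        (\<forall>v. bounded_solution U f v \<longrightarrow> (\<forall>t\<ge>0. v t = P t f))) \<and>
     (\<forall>t\<ge>0. \<forall>F h. (\<forall>m. smooth_bounded (F m)) \<and> tendsto_L1 (exp_measure U) F h \<longrightarrow>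
        tendsto_L1 (exp_measure U) (\<lambda>m. P t (F m)) (P t h))"

end

theory Submission
  imports Defs
begin

text \<open>The inequality \<open>sqrt (u t x * u t y) \<le> u t ((x + y) / 2)\<close> is propagated by a two-point maximum
  principle in the style of Korevaar, which uses only two space derivatives of \<open>u\<close>. At a positive
  maximum of the difference, the vector \<open>p = - \<nabla> ln u\<close> is the same at \<open>x\<close> and \<open>y\<close> (and, up to a factor,
  at the midpoint), and what remains of the equation is the sign of
  \<open>p \<bullet> (\<nabla>U x / 2 + \<nabla>U y / 2 - \<nabla>U ((x + y) / 2))\<close>. On \<open>E 0\<close> this vanishes because \<open>\<nabla>U\<close> is affine there.
  On \<open>E i\<close>, where \<open>u\<close> is radially decreasing (another two-point maximum principle), \<open>p\<close> points
  in the common direction of \<open>x\<close> and \<open>y\<close>, so that concavity of \<open>\<rho>\<^sub>i'\<close> gives the sign. The maximum is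
  attained because \<open>u\<close> vanishes at infinity, the drift growing at most linearly.

  Approximants of \<open>exp (- V)\<close> that are smooth, radially decreasing, log-concave and decaying are built
  from log-sum-exp of rotationally symmetrised tangent planes of \<open>V\<close>. In the limit,
  convexity of \<open>- ln P\<^sub>t\<close> survives since a uniform positive lower bound for the solutions makes the
  sequence of convex functions bounded above at every point.\<close>

section \<open>Derivatives along lines and the maximum principle\<close>

text \<open>Radial monotonicity has to be known before log-concavity: without it \<open>p\<close>
  need not be aligned with x and y inside \<open>E i\<close>, and concavity of
  \<open>\<rho>\<^sub>i'\<close> alone gives no sign. Its own proof rests on reflection symmetry,
  which disposes of the boundary of the set of pairs. The barrier at infinity sees the drift only
  through x \<bullet> \<nabla>U x, which needs a bound on both sides:
  \<open>\<rho>''' \<le> 0\<close> keeps \<open>\<rho>'\<close> below its tangent at 0, while the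
  lower bound comes from convexity of U, since a concave \<open>\<rho>'\<close> could fall
  arbitrarily fast. The value \<open>P t h\<close> is known only as an L1 limit, so a subsequence of
  solutions converges almost everywhere and perhaps nowhere else. The pointwise limsup of the
  functions - ln u is convex at every point and agrees with - ln (P t h) where the limit exists. It
  is finite because positivity of the solutions bounds the sequence above, and convexity together
  with a single point of convergence bounds it below.\<close>

definition grad :: "('a::euclidean_space \<Rightarrow> real) \<Rightarrow> 'a \<Rightarrow> 'a" where
  "grad f x = (\<Sum>b\<in>Basis. partial_deriv b f x *\<^sub>R b)"

text \<open>The second derivative of f at x as a quadratic form in v. Both orders of each mixed
  partial enter the sum, so this form is the second derivative of f along the line through x in
  direction v.\<close>

definition hess :: "('a::euclidean_space \<Rightarrow> real) \<Rightarrow> 'a \<Rightarrow> 'a \<Rightarrow> real" where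
  "hess f x v = (\<Sum>c\<in>Basis. \<Sum>d\<in>Basis. (v \<bullet> c) * (v \<bullet> d) * partial_deriv d (partial_deriv c f) x)"

definition lap :: "('a::euclidean_space \<Rightarrow> real) \<Rightarrow> 'a \<Rightarrow> real" where
  "lap f x = (\<Sum>b\<in>Basis. partial_deriv b (partial_deriv b f) x)"

lemma grad_inner_Basis: "b \<in> Basis \<Longrightarrow> grad f x \<bullet> b = partial_deriv b f x"
  by (simp add: grad_def)

lemma grad_inner: "grad f x \<bullet> v = (\<Sum>b\<in>Basis. (v \<bullet> b) * partial_deriv b f x)"
  by (simp add: grad_def inner_sum_left) (simp add: inner_commute mult.commute)

lemma gen_L_eq: "gen_L U f x = lap f x - grad f x \<bullet> grad U x"
  unfolding gen_L_def lap_def by (simp add: grad_inner[of f] grad_inner_Basis[THEN trans[OF inner_commute]] mult.commute grad_inner_Basis)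

lemma has_derivative_grad:
  assumes "f differentiable (at x)"
  shows "(f has_derivative (\<lambda>v. grad f x \<bullet> v)) (at x)"
proof -
  have D: "(f has_derivative frechet_derivative f (at x)) (at x)"
    using assms frechet_derivative_works by blast
  have "frechet_derivative f (at x) = (\<lambda>v. grad f x \<bullet> v)"
  proof
    fix v
    interpret linear "frechet_derivative f (at x)"
      using D has_derivative_linear by blast
    have "frechet_derivative f (at x) v = frechet_derivative f (at x) (\<Sum>b\<in>Basis. (v \<bullet> b) *\<^sub>R b)"
      by (simp add: euclidean_representation)
    also have "\<dots> = (\<Sum>b\<in>Basis. (v \<bullet> b) * partial_deriv b f x)"
      by (simp add: sum scale partial_deriv_def)
    also have "\<dots> = grad f x \<bullet> v"
      by (simp add: grad_inner)
    finally show "frechet_derivative f (at x) v = grad f x \<bullet> v" .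
  qed
  then show ?thesis using D by simp
qed

lemma partial_deriv_unique:
  assumes "(f has_derivative f') (at x)"
  shows "partial_deriv b f x = f' b"
  using frechet_derivative_at[OF assms] by (simp add: partial_deriv_def)

lemma DERIV_line:
  assumes "f differentiable (at (x + s *\<^sub>R v))"
  shows "((\<lambda>s. f (x + s *\<^sub>R v)) has_real_derivative grad f (x + s *\<^sub>R v) \<bullet> v) (at s)"
proof -
  have "((\<lambda>s. x + s *\<^sub>R v) has_derivative (\<lambda>h. h *\<^sub>R v)) (at s)"
    by (auto intro!: derivative_eq_intros)
  from has_derivative_compose[OF this has_derivative_grad[OF assms]]
  show ?thesis unfolding has_field_derivative_def by (simp add: mult.commute[of _ "grad f (x + s *\<^sub>R v) \<bullet> v"])
qed

lemma DERIV_line_grad: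
  assumes "\<And>c. c \<in> Basis \<Longrightarrow> partial_deriv c f differentiable (at (x + s *\<^sub>R v))"
  shows "((\<lambda>s. grad f (x + s *\<^sub>R v) \<bullet> v) has_real_derivative hess f (x + s *\<^sub>R v) v) (at s)"
proof -
  have eq: "(\<lambda>s. grad f (x + s *\<^sub>R v) \<bullet> v) = (\<lambda>s. \<Sum>c\<in>Basis. (v \<bullet> c) * partial_deriv c f (x + s *\<^sub>R v))"
    by (simp add: grad_inner)
  have h: "hess f (x + s *\<^sub>R v) v = (\<Sum>c\<in>Basis. (v \<bullet> c) * (grad (partial_deriv c f) (x + s *\<^sub>R v) \<bullet> v))"
    unfolding hess_def
    by (simp add: grad_inner sum_distrib_left mult_ac)
  show ?thesis
    unfolding eq h
    by (intro DERIV_sum DERIV_cmult DERIV_line assms) auto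
qed

lemma hess_Basis: "b \<in> Basis \<Longrightarrow> hess f x b = partial_deriv b (partial_deriv b f) x"
proof -
  assume b: "b \<in> Basis"
  have "hess f x b = (\<Sum>c\<in>Basis. \<Sum>d\<in>Basis. if c = b then (if d = b then partial_deriv b (partial_deriv b f) x else 0) else 0)"
    unfolding hess_def using b by (intro sum.cong refl) (auto simp: inner_Basis)
  also have "\<dots> = partial_deriv b (partial_deriv b f) x"
    using b by (subst sum.swap) (simp add: if_distrib[of "\<lambda>z. sum z _"] sum.delta cong: if_cong)
  finally show ?thesis .
qed

lemma lap_eq_hess: "lap f x = (\<Sum>b\<in>Basis. hess f x b)"
  by (simp add: lap_def hess_Basis)

text \<open>The trace of a quadratic form is the same in every orthonormal basis: moving g to the
  other side of the inner product turns the sum over b into the Parseval identity for c and d. It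
  serves to compare Laplacians at two points that are reflections of each other.\<close>

lemma lap_eq_hess_orthogonal:
  fixes f :: "'a::euclidean_space \<Rightarrow> real" and g :: "'a \<Rightarrow> 'a"
  assumes g: "orthogonal_transformation g"
  shows "lap f x = (\<Sum>b\<in>Basis. hess f x (g b))"
proof -
  have "(\<Sum>b\<in>Basis. (g b \<bullet> c) * (g b \<bullet> d)) = c \<bullet> d" for c d :: 'a
  proof -
    obtain g' where g': "orthogonal_transformation g'" "\<And>y. g (g' y) = y"
      using orthogonal_transformation_inv[OF g] orthogonal_transformation_surj[OF g] by (metis surj_f_inv_f)
    have "g b \<bullet> z = b \<bullet> g' z" for b z
      using g g' by (metis orthogonal_transformation_def)
    then have "(\<Sum>b\<in>Basis. (g b \<bullet> c) * (g b \<bullet> d)) = (\<Sum>b\<in>Basis. (g' c \<bullet> b) * (g' d \<bullet> b))"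
      by (simp add: inner_commute)
    also have "\<dots> = g' c \<bullet> g' d" by (rule euclidean_inner[symmetric])
    finally show ?thesis using g'(1) by (simp add: orthogonal_transformation_def)
  qed
  note * = this
  have "(\<Sum>b\<in>Basis. hess f x (g b)) = (\<Sum>c\<in>Basis. \<Sum>b\<in>Basis. \<Sum>d\<in>Basis. (g b \<bullet> c) * (g b \<bullet> d) * partial_deriv d (partial_deriv c f) x)"
    unfolding hess_def by (rule sum.swap)
  also have "\<dots> = (\<Sum>c\<in>Basis. \<Sum>d\<in>Basis. \<Sum>b\<in>Basis. (g b \<bullet> c) * (g b \<bullet> d) * partial_deriv d (partial_deriv c f) x)"
    by (intro sum.cong refl sum.swap)
  also have "\<dots> = (\<Sum>c\<in>Basis. \<Sum>d\<in>Basis. (c \<bullet> d) * partial_deriv d (partial_deriv c f) x)"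
    by (simp add: sum_distrib_right[symmetric] *)
  also have "\<dots> = (\<Sum>c\<in>Basis. \<Sum>d\<in>Basis. if c = d then partial_deriv c (partial_deriv c f) x else 0)"
    by (intro sum.cong refl) (auto simp: inner_Basis)
  also have "\<dots> = lap f x" by (simp add: lap_def)
  finally show ?thesis ..
qed

text \<open>If D were positive, \<phi>' would be positive just to the right of 0 and the mean value
  theorem would contradict maximality. The radius d is there for functions controlled only near 0:
  square roots of positive products, or pairs of points that must stay in a given set.\<close>

lemma second_derivative_test:
  fixes \<phi> \<phi>' :: "real \<Rightarrow> real"
  assumes d: "d > 0"
    and D1: "\<And>s. \<bar>s\<bar> < d \<Longrightarrow> (\<phi> has_real_derivative \<phi>' s) (at s)"
    and D2: "(\<phi>' has_real_derivative D) (at 0)"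
    and mx: "\<And>s. \<bar>s\<bar> < d \<Longrightarrow> \<phi> s \<le> \<phi> 0"
  shows "\<phi>' 0 = 0" "D \<le> 0"
proof -
  show z: "\<phi>' 0 = 0"
    by (rule DERIV_local_max[OF D1[of 0] d]) (use d mx in auto)
  show "D \<le> 0"
  proof (rule ccontr)
    assume "\<not> D \<le> 0"
    then have "D > 0" by simp
    from DERIV_pos_inc_right[OF D2 this] obtain e where e: "e > 0" "\<And>h. h > 0 \<Longrightarrow> h < e \<Longrightarrow> \<phi>' 0 < \<phi>' (0 + h)"
      by blast
    define s where "s = min (d/2) (e/2)"
    have s: "0 < s" "s < d" "s < e" using d e by (auto simp: s_def)
    obtain y where y: "0 < y" "y < s" "\<phi> s - \<phi> 0 = (s - 0) * \<phi>' y"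
      using MVT2[of 0 s \<phi> \<phi>'] D1 s by (auto)
    have "\<phi>' y > 0" using e(2)[of y] y s z by simp
    then have "\<phi> s > \<phi> 0" using y s by (smt (verit) mult_pos_pos)
    then show False using mx[of s] s by simp
  qed
qed

lemma C2D:
  assumes "C_m 2 f"
  shows "f differentiable (at x)" "b \<in> Basis \<Longrightarrow> partial_deriv b f differentiable (at x)"
  using assms by (auto simp: C_m_def numeral_2_eq_2)

text \<open>Otherwise \<open>\<Phi> - \<epsilon> t\<close> attains a positive maximum, and \<open>\<Phi>\<close> has time derivative \<open>\<ge> \<epsilon>\<close> there.\<close>

lemma parabolic_maximum_principle:
  fixes \<Phi> :: "real \<Rightarrow> 'b::euclidean_space \<Rightarrow> real"
  assumes S: "closed S" and T: "0 \<le> T"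
    and cont: "continuous_on ({0..T} \<times> S) (\<lambda>(t, s). \<Phi> t s)"
    and init: "\<And>s. s \<in> S \<Longrightarrow> \<Phi> 0 s \<le> 0"
    and decay: "\<And>\<eta>. \<eta> > 0 \<Longrightarrow> \<exists>R. \<forall>t\<in>{0..T}. \<forall>s\<in>S. norm s > R \<longrightarrow> \<Phi> t s \<le> \<eta>"
    and crit: "\<And>t s. 0 < t \<Longrightarrow> t \<le> T \<Longrightarrow> s \<in> S \<Longrightarrow> \<Phi> t s > 0 \<Longrightarrow> (\<And>s'. s' \<in> S \<Longrightarrow> \<Phi> t s' \<le> \<Phi> t s) \<Longrightarrow>
        \<exists>d\<le>0. ((\<lambda>\<tau>. \<Phi> \<tau> s) has_real_derivative d) (at t within {0..})"
    and s: "s \<in> S"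
  shows "\<Phi> T s \<le> 0"
proof (rule ccontr)
  assume "\<not> \<Phi> T s \<le> 0"
  then have pos: "\<Phi> T s > 0" by simp
  \<comment> \<open>Small enough that the penalty on [0, T] costs less than half of the positive
    value \<Phi> T s, whereas outside the ball chosen below at most a quarter of it is
    reached.\<close>
  define \<epsilon> where "\<epsilon> = \<Phi> T s / (2 * (T + 1))"
  have \<epsilon>: "\<epsilon> > 0" using pos T by (simp add: \<epsilon>_def)
  have eT: "\<epsilon> * T < \<Phi> T s / 2"
  proof -
    have "T / (T + 1) < 1" using T by simp
    then have "\<Phi> T s / 2 * (T / (T + 1)) < \<Phi> T s / 2 * 1" using pos by (intro mult_strict_left_mono) auto
    moreover have "\<Phi> T s / 2 * (T / (T + 1)) = \<epsilon> * T" using T by (simp add: \<epsilon>_def field_simps)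
    ultimately show ?thesis by linarith
  qed
  obtain R1 where "\<forall>t\<in>{0..T}. \<forall>s'\<in>S. norm s' > R1 \<longrightarrow> \<Phi> t s' \<le> \<Phi> T s / 4"
    using decay[of "\<Phi> T s / 4"] pos by auto
  then have R1: "\<And>t s'. t \<in> {0..T} \<Longrightarrow> s' \<in> S \<Longrightarrow> norm s' > R1 \<Longrightarrow> \<Phi> t s' \<le> \<Phi> T s / 4"
    by blast
  define R where "R = max R1 (norm s)"
  define K where "K = {0..T} \<times> (S \<inter> cball 0 R)"
  have "compact K" unfolding K_def using S by (intro compact_Times closed_Int_compact) auto
  moreover have Ts: "(T, s) \<in> K" using s T by (simp add: K_def R_def)
  moreover have "continuous_on K (\<lambda>p. \<Phi> (fst p) (snd p) - \<epsilon> * fst p)"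
    by (intro continuous_intros continuous_on_subset[OF cont[unfolded case_prod_beta]]) (auto simp: K_def)
  ultimately obtain p where p: "p \<in> K" "\<And>q. q \<in> K \<Longrightarrow> \<Phi> (fst q) (snd q) - \<epsilon> * fst q \<le> \<Phi> (fst p) (snd p) - \<epsilon> * fst p"
    using continuous_attains_sup[of K "\<lambda>p. \<Phi> (fst p) (snd p) - \<epsilon> * fst p"] by blast
  obtain t1 s1 where ps: "p = (t1, s1)" by (cases p)
  have t1: "0 \<le> t1" "t1 \<le> T" and s1: "s1 \<in> S" using p(1) by (auto simp: K_def ps)
  have mxK: "\<Phi> t s' - \<epsilon> * t \<le> \<Phi> t1 s1 - \<epsilon> * t1" if "(t, s') \<in> K" for t s'
    using p(2)[OF that] by (simp add: ps)
  have big: "\<Phi> t1 s1 - \<epsilon> * t1 > \<Phi> T s / 2" using mxK[OF Ts] eT by simp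
  have mx: "\<Phi> t s' - \<epsilon> * t \<le> \<Phi> t1 s1 - \<epsilon> * t1" if "t \<in> {0..T}" "s' \<in> S" for t s'
  proof (cases "norm s' > R")
    case True
    then have "\<Phi> t s' \<le> \<Phi> T s / 4" using R1 that by (simp add: R_def)
    moreover have "\<epsilon> * t \<ge> 0" using \<epsilon> that by simp
    ultimately show ?thesis using big pos by linarith
  next
    case False
    then show ?thesis using mxK that by (simp add: K_def)
  qed
  have P1: "\<Phi> t1 s1 > 0" using big pos \<epsilon> t1 by (smt (verit) mult_nonneg_nonneg half_gt_zero)
  have "t1 \<noteq> 0" using init[OF s1] P1 by auto
  then have t1': "t1 > 0" using t1 by simp
  have "\<Phi> t1 s' \<le> \<Phi> t1 s1" if "s' \<in> S" for s'
    using mx[of t1 s'] that t1 by simp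
  from crit[OF t1' t1(2) s1 P1 this] obtain d where d: "d \<le> 0"
    "((\<lambda>\<tau>. \<Phi> \<tau> s1) has_real_derivative d) (at t1 within {0..})" by blast
  have "at t1 within {0..} = at t1" using t1' by (intro at_within_interior) auto
  with d have "((\<lambda>\<tau>. \<Phi> \<tau> s1) has_real_derivative d) (at t1)" by simp
  then have D: "((\<lambda>\<tau>. \<Phi> \<tau> s1 - \<epsilon> * \<tau>) has_real_derivative d - \<epsilon>) (at t1)"
    by (auto intro!: derivative_eq_intros)
  have "d - \<epsilon> < 0" using d \<epsilon> by simp
  \<comment> \<open>Only earlier times are compared, so the argument also covers a maximum at the
    final time T.\<close>
  from DERIV_neg_dec_left[OF D this] obtain e where e: "e > 0"
    "\<And>h. 0 < h \<Longrightarrow> h < e \<Longrightarrow> \<Phi> t1 s1 - \<epsilon> * t1 < \<Phi> (t1 - h) s1 - \<epsilon> * (t1 - h)" by auto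
  define h where "h = min (e/2) t1"
  have "0 < h" "h < e" "t1 - h \<in> {0..T}" using e t1 t1' by (auto simp: h_def)
  with e(2)[of h] mx[of "t1 - h" s1] s1 show False by simp
qed

section \<open>Orthogonal decompositions and the drift\<close>

lemma Proj_eqI:
  assumes "subspace S" "y \<in> S" "\<And>z. z \<in> S \<Longrightarrow> (x - y) \<bullet> z = 0"
  shows "Proj S x = y"
  unfolding Proj_def
proof (rule the_equality)
  show "y \<in> S \<and> (\<forall>z\<in>S. orthogonal (x - y) z)" using assms by (simp add: orthogonal_def)
next
  fix y' assume y': "y' \<in> S \<and> (\<forall>z\<in>S. orthogonal (x - y') z)"
  have "y' - y \<in> S" using assms y' by (simp add: subspace_diff)
  then have "(x - y) \<bullet> (y' - y) = 0" "(x - y') \<bullet> (y' - y) = 0"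
    using assms y' by (auto simp: orthogonal_def)
  then have "(y' - y) \<bullet> (y' - y) = 0" by (simp add: inner_diff_left)
  then show "y' = y" by simp
qed

lemma Proj_works:
  fixes S :: "'a::euclidean_space set"
  assumes "subspace S"
  shows "Proj S x \<in> S" "z \<in> S \<Longrightarrow> Proj S x \<bullet> z = x \<bullet> z"
proof -
  obtain y z where yz: "y \<in> span S" "\<And>w. w \<in> span S \<Longrightarrow> orthogonal z w" "x = y + z"
    using orthogonal_subspace_decomp_exists[of S x] by metis
  have S: "span S = S" using assms by (simp add: span_eq_iff)
  have "Proj S x = y" using yz S assms by (intro Proj_eqI) (auto simp: orthogonal_def)
  then show "Proj S x \<in> S" "z \<in> S \<Longrightarrow> Proj S x \<bullet> z = x \<bullet> z" for z
    using yz S by (auto simp: orthogonal_def inner_add_left)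
qed

lemma linear_Proj:
  fixes S :: "'a::euclidean_space set"
  assumes "subspace S"
  shows "linear (Proj S)"
proof (rule linearI)
  show "Proj S (x + y) = Proj S x + Proj S y" for x y
    using assms by (intro Proj_eqI) (auto simp: Proj_works subspace_add inner_add_left inner_diff_left)
  show "Proj S (r *\<^sub>R x) = r *\<^sub>R Proj S x" for r x
    using assms by (intro Proj_eqI) (auto simp: Proj_works subspace_scale inner_diff_left)
qed

lemma norm_Proj_le:
  fixes S :: "'a::euclidean_space set"
  assumes "subspace S"
  shows "norm (Proj S x) \<le> norm x"
proof -
  have "norm (Proj S x) * norm (Proj S x) = x \<bullet> Proj S x"
    using Proj_works[OF assms] by (metis power2_eq_square power2_norm_eq_inner)
  also have "\<dots> \<le> norm x * norm (Proj S x)" by (rule norm_cauchy_schwarz)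
  finally show ?thesis by (cases "Proj S x = 0") auto
qed

text \<open>The Householder reflection in the hyperplane orthogonal to w. For w = 0 the division by
  zero yields the identity, so no case has to be excluded. Reflections along vectors of a block
  represent the orthogonal group of that block in what follows.\<close>

definition refl_along :: "'a::real_inner \<Rightarrow> 'a \<Rightarrow> 'a" where
  "refl_along w x = x - (2 * (x \<bullet> w) / (w \<bullet> w)) *\<^sub>R w"

lemma orthogonal_transformation_refl_along: "orthogonal_transformation (refl_along w)"
  unfolding orthogonal_transformation_def
proof (intro conjI allI)
  show "linear (refl_along w)"
    by (rule linearI) (auto simp: refl_along_def algebra_simps inner_add_left add_divide_distrib)
  show "refl_along w x \<bullet> refl_along w y = x \<bullet> y" for x y
    by (cases "w = 0") (auto simp: refl_along_def algebra_simps inner_commute field_simps)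
qed

lemma refl_along_invol: "refl_along w (refl_along w x) = x"
  by (cases "w = 0") (auto simp: refl_along_def algebra_simps)

text \<open>For equal norms the square of |x - y| is 2 x \<bullet> (x - y), so the coefficient in
  the reflection is exactly 1. Hence one reflection moves a vector to any other vector of the same
  length.\<close>

lemma refl_along_diff:
  assumes "norm x = norm y"
  shows "refl_along (x - y) x = y"
proof (cases "x = y")
  case False
  have "x \<bullet> x = y \<bullet> y" using assms by (metis power2_norm_eq_inner)
  then have "(x - y) \<bullet> (x - y) = 2 * (x \<bullet> (x - y))" by (simp add: inner_diff_left inner_diff_right inner_commute)
  moreover have "(x - y) \<bullet> (x - y) \<noteq> 0" using False by simp
  ultimately show ?thesis by (simp add: refl_along_def)
qed (simp add: refl_along_def)

section \<open>Algebra of the block projections\<close>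

locale orth_decomp =
  fixes E :: "nat \<Rightarrow> 'a::euclidean_space set" and k :: nat
  assumes decomp: "orthogonal_decomposition E k"
begin

abbreviation "\<pi> i x \<equiv> Proj (E i) x"

lemma subsp: "i \<le> k \<Longrightarrow> subspace (E i)"
  using decomp by (simp add: orthogonal_decomposition_def)

lemma E_orth: "i \<le> k \<Longrightarrow> j \<le> k \<Longrightarrow> i \<noteq> j \<Longrightarrow> x \<in> E i \<Longrightarrow> y \<in> E j \<Longrightarrow> x \<bullet> y = 0"
  using decomp by (simp add: orthogonal_decomposition_def orthogonal_def)

lemma proj_in: "i \<le> k \<Longrightarrow> \<pi> i x \<in> E i"
  using Proj_works subsp by blast

lemma proj_inner: "i \<le> k \<Longrightarrow> z \<in> E i \<Longrightarrow> \<pi> i x \<bullet> z = x \<bullet> z"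
  using Proj_works subsp by blast

lemma linear_proj: "i \<le> k \<Longrightarrow> linear (Proj (E i))"
  using linear_Proj subsp by blast

lemma proj_add: "i \<le> k \<Longrightarrow> \<pi> i (x + y) = \<pi> i x + \<pi> i y"
  and proj_diff: "i \<le> k \<Longrightarrow> \<pi> i (x - y) = \<pi> i x - \<pi> i y"
  and proj_scale: "i \<le> k \<Longrightarrow> \<pi> i (r *\<^sub>R x) = r *\<^sub>R \<pi> i x"
  using linear_proj by (auto simp: linear_add linear_diff linear_scale)

lemma proj_id: "i \<le> k \<Longrightarrow> x \<in> E i \<Longrightarrow> \<pi> i x = x"
  using subsp by (intro Proj_eqI) auto

lemma proj_orth: "i \<le> k \<Longrightarrow> (\<And>z. z \<in> E i \<Longrightarrow> x \<bullet> z = 0) \<Longrightarrow> \<pi> i x = 0"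
  using subsp by (intro Proj_eqI) (auto simp: subspace_0)

lemma proj_other: "i \<le> k \<Longrightarrow> j \<le> k \<Longrightarrow> i \<noteq> j \<Longrightarrow> x \<in> E j \<Longrightarrow> \<pi> i x = 0"
  using E_orth[of j i] by (intro proj_orth) auto

lemma norm_proj_le: "i \<le> k \<Longrightarrow> norm (\<pi> i x) \<le> norm x"
  using norm_Proj_le subsp by blast

text \<open>The remainder is orthogonal to every block, hence to their span, hence to
  itself.\<close>

lemma sum_proj: "(\<Sum>i\<le>k. \<pi> i x) = x"
proof -
  define r where "r = x - (\<Sum>i\<le>k. \<pi> i x)"
  have "r \<bullet> z = 0" if "z \<in> E j" "j \<le> k" for z j
  proof -
    have "(\<Sum>i\<le>k. \<pi> i x \<bullet> z) = (\<Sum>i\<le>k. if i = j then x \<bullet> z else 0)"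
      using that by (intro sum.cong) (auto simp: proj_inner intro!: E_orth[OF _ _ _ proj_in])
    also have "\<dots> = x \<bullet> z" using that by simp
    finally show ?thesis by (simp add: r_def inner_diff_left inner_sum_left)
  qed
  then have "orthogonal r z" if "z \<in> (\<Union>i\<le>k. E i)" for z
    using that by (auto simp: orthogonal_def)
  then have "orthogonal r r"
    using orthogonal_to_span[of r "\<Union>i\<le>k. E i" r] decomp
    by (simp add: orthogonal_decomposition_def)
  then show ?thesis by (simp add: orthogonal_self r_def)
qed

lemma inner_proj: "x \<bullet> y = (\<Sum>i\<le>k. \<pi> i x \<bullet> \<pi> i y)"
proof -
  have "x \<bullet> y = (\<Sum>i\<le>k. x \<bullet> \<pi> i y)"
    by (subst (1) sum_proj[of y, symmetric]) (simp add: inner_sum_right)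
  also have "\<dots> = (\<Sum>i\<le>k. \<pi> i x \<bullet> \<pi> i y)"
    by (intro sum.cong) (auto simp: proj_inner proj_in)
  finally show ?thesis .
qed

lemma norm_proj: "(norm x)\<^sup>2 = (\<Sum>i\<le>k. (norm (\<pi> i x))\<^sup>2)"
  by (simp add: power2_norm_eq_inner inner_proj[symmetric])

lemma proj_refl_other:
  assumes "i \<le> k" "w \<in> E i" "j \<le> k" "j \<noteq> i"
  shows "\<pi> j (refl_along w x) = \<pi> j x"
  using assms by (simp add: refl_along_def proj_diff proj_scale proj_other)

lemma proj_refl_same:
  assumes "i \<le> k" "w \<in> E i"
  shows "\<pi> i (refl_along w x) = refl_along w (\<pi> i x)"
  using assms by (simp add: refl_along_def proj_diff proj_scale proj_id proj_inner)

lemma norm_proj_refl: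
  assumes "i \<le> k" "w \<in> E i" "j \<le> k"
  shows "norm (\<pi> j (refl_along w x)) = norm (\<pi> j x)"
  using assms orthogonal_transformation_refl_along[of w]
  by (cases "j = i") (auto simp: proj_refl_other proj_refl_same orthogonal_transformation)

text \<open>\<open>p\<close> is, in each block \<open>E i\<close> with \<open>i \<ge> 1\<close>, a nonnegative multiple of \<open>\<pi> i x\<close>.\<close>

definition radial_at :: "'a \<Rightarrow> 'a \<Rightarrow> bool" where
  "radial_at p x \<longleftrightarrow> (\<forall>i\<in>{1..k}. \<forall>v\<in>E i. 0 \<le> v \<bullet> x \<longrightarrow> 0 \<le> p \<bullet> v)"

text \<open>Testing with both signs of the part \<open>w\<close> of \<pi> i p orthogonal to \<pi> i
  x shows that it vanishes; testing with \<pi> i x gives the sign of the multiple. Writing \<pi> i x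
  as a multiple of \<pi> i p, and not conversely, lets one vector p serve as common direction for
  several points x.\<close>

lemma radial_atD:
  assumes "radial_at p x" "i \<in> {1..k}" "\<pi> i p \<noteq> 0"
  obtains m where "m > 0" "\<pi> i x = m *\<^sub>R \<pi> i p"
proof -
  have i: "i \<le> k" using assms by auto
  define l where "l = (\<pi> i p \<bullet> \<pi> i x) / (\<pi> i x \<bullet> \<pi> i x)"
  define w where "w = \<pi> i p - l *\<^sub>R \<pi> i x"
  have wE: "w \<in> E i" "- w \<in> E i"
    using subsp[OF i] proj_in[OF i] by (auto simp: w_def subspace_diff subspace_scale subspace_neg)
  have "w \<bullet> \<pi> i x = 0" by (cases "\<pi> i x = 0") (auto simp: w_def l_def inner_diff_left)
  then have wx: "w \<bullet> x = 0" using proj_inner[OF i wE(1), of x] by (simp add: inner_commute)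
  have "0 \<le> p \<bullet> w" "0 \<le> p \<bullet> (- w)"
    using assms(1,2) wE wx unfolding radial_at_def by (auto simp del: inner_minus_right)
  then have "p \<bullet> w = 0" by simp
  then have "\<pi> i p \<bullet> w = 0" using proj_inner[OF i wE(1)] by simp
  then have "w \<bullet> w = 0" using \<open>w \<bullet> \<pi> i x = 0\<close>
    by (simp add: w_def inner_diff_left inner_diff_right inner_commute)
  then have eq: "\<pi> i p = l *\<^sub>R \<pi> i x" by (simp add: w_def)
  then have nz: "l \<noteq> 0" "\<pi> i x \<noteq> 0" using assms(3) by auto
  have "\<pi> i x \<bullet> x = \<pi> i x \<bullet> \<pi> i x" using proj_inner[OF i proj_in[OF i], of x x] by (simp add: inner_commute)
  then have "0 \<le> p \<bullet> \<pi> i x" using assms(1,2) proj_in[OF i] unfolding radial_at_def by auto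
  also have "p \<bullet> \<pi> i x = l * (\<pi> i x \<bullet> \<pi> i x)" using proj_inner[OF i proj_in[OF i], of p x] eq by simp
  finally have "l > 0" using nz by (simp add: zero_le_mult_iff) (smt (verit) inner_gt_zero_iff)
  then show ?thesis using that[of "1/l"] eq nz by simp
qed

end

text \<open>By the mean value theorem \<rho>2 is decreasing, hence \<rho>1 is midpoint concave.
  Differentiability of \<rho> is kept only for r > 0: it is needed only in blocks where \<pi> i p,
  and therefore \<pi> i x, does not vanish.\<close>

lemma third_deriv_nonposD:
  assumes "third_deriv_nonpos \<rho>"
  obtains \<rho>1 M where "\<And>r. r > 0 \<Longrightarrow> (\<rho> has_real_derivative \<rho>1 r) (at r)"
    "\<And>r s. 0 \<le> r \<Longrightarrow> 0 \<le> s \<Longrightarrow> \<rho>1 r / 2 + \<rho>1 s / 2 \<le> \<rho>1 ((r + s) / 2)"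
    "0 \<le> M" "\<And>r. 0 \<le> r \<Longrightarrow> \<rho>1 r \<le> M * (1 + r)"
proof -
  obtain \<rho>1 \<rho>2 \<rho>3 where D1: "\<And>r. 0 \<le> r \<Longrightarrow> (\<rho> has_real_derivative \<rho>1 r) (at r within {0..})"
    and D2: "\<And>r. 0 \<le> r \<Longrightarrow> (\<rho>1 has_real_derivative \<rho>2 r) (at r within {0..})"
    and D3: "\<And>r. 0 \<le> r \<Longrightarrow> (\<rho>2 has_real_derivative \<rho>3 r) (at r within {0..})"
    and neg: "\<And>r. 0 \<le> r \<Longrightarrow> \<rho>3 r \<le> 0"
    using assms unfolding third_deriv_nonpos_def by (metis atLeast_iff)
  have mvt: "\<exists>z\<in>{x<..<y}. f y - f x = (y - x) * f' z"
    if "0 \<le> x" "x < y" "\<And>r. 0 \<le> r \<Longrightarrow> (f has_real_derivative f' r) (at r within {0..})" for f f' :: "real \<Rightarrow> real" and x y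
  proof -
    have "\<exists>z\<in>{x<..<y}. f y - f x = (*) (f' z) (y - x)"
    proof (rule mvt_simple[OF that(2)])
      fix r assume "x \<le> r" "r \<le> y"
      then have "(f has_real_derivative f' r) (at r within {x..y})"
        using that by (intro has_field_derivative_subset[OF that(3)]) auto
      then show "(f has_derivative (*) (f' r)) (at r within {x..y})"
        by (simp add: has_field_derivative_def)
    qed
    then show ?thesis by (simp add: mult.commute)
  qed
  have anti: "\<rho>2 y \<le> \<rho>2 x" if xy: "0 \<le> x" "x \<le> y" for x y
  proof (cases "x < y")
    case True
    then obtain z where "z \<in> {x<..<y}" "\<rho>2 y - \<rho>2 x = (y - x) * \<rho>3 z" using mvt[OF xy(1) True D3] by auto
    moreover have "(y - x) * \<rho>3 z \<le> 0" using calculation that neg[of z] by (intro mult_nonneg_nonpos) auto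
    ultimately show ?thesis by simp
  qed (use that in auto)
  have conc: "\<rho>1 r / 2 + \<rho>1 s / 2 \<le> \<rho>1 ((r + s) / 2)" if rs: "0 \<le> r" "r < s" for r s
  proof -
    define m where "m = (r + s) / 2"
    have m: "r < m" "m < s" "m - r = (s - r) / 2" "s - m = (s - r) / 2" using that by (auto simp: m_def field_simps)
    obtain z where z: "z \<in> {r<..<m}" "\<rho>1 m - \<rho>1 r = (m - r) * \<rho>2 z" using mvt[OF rs(1) m(1) D2] by auto
    obtain z' where z': "z' \<in> {m<..<s}" "\<rho>1 s - \<rho>1 m = (s - m) * \<rho>2 z'" using mvt[OF _ m(2) D2] m rs by auto
    have "\<rho>2 z' \<le> \<rho>2 z" using z z' that by (intro anti) auto
    then have "(s - r) / 2 * \<rho>2 z' \<le> (s - r) / 2 * \<rho>2 z" using that by (intro mult_left_mono) auto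
    then have "\<rho>1 s - \<rho>1 m \<le> \<rho>1 m - \<rho>1 r" using z(2) z'(2) unfolding m(3,4) by linarith
    then show ?thesis by (simp add: m_def[symmetric])
  qed
  show ?thesis
  \<comment> \<open>The linear bound is the tangent of \<rho>1 at 0; absolute values make the
    constant nonnegative.\<close>
  proof (rule that[of \<rho>1 "\<bar>\<rho>1 0\<bar> + \<bar>\<rho>2 0\<bar>"])
    show "(\<rho> has_real_derivative \<rho>1 r) (at r)" if "r > 0" for r
    proof -
      have "at r within {0..} = at r" using that by (intro at_within_interior) auto
      then show ?thesis using D1[of r] that by simp
    qed
    show "\<rho>1 r / 2 + \<rho>1 s / 2 \<le> \<rho>1 ((r + s) / 2)" if "0 \<le> r" "0 \<le> s" for r s
      using conc[of r s] conc[of s r] that by (cases r s rule: linorder_cases) (auto simp: add.commute)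
    show "\<rho>1 r \<le> (\<bar>\<rho>1 0\<bar> + \<bar>\<rho>2 0\<bar>) * (1 + r)" if r0: "0 \<le> r" for r
    proof -
      have "\<rho>1 r \<le> \<rho>1 0 + \<bar>\<rho>2 0\<bar> * r"
      proof (cases "r = 0")
        case False
        then obtain z where z: "z \<in> {0<..<r}" "\<rho>1 r - \<rho>1 0 = (r - 0) * \<rho>2 z" using mvt[OF order_refl _ D2, of r] r0 by auto
        have "\<rho>2 z \<le> \<bar>\<rho>2 0\<bar>" using anti[of 0 z] z by auto
        then have "r * \<rho>2 z \<le> r * \<bar>\<rho>2 0\<bar>" using that by (intro mult_left_mono)
        then show ?thesis using z(2) unfolding diff_0_right mult.commute[of "\<bar>\<rho>2 0\<bar>"] by linarith
      qed simp
      also have "\<dots> \<le> (\<bar>\<rho>1 0\<bar> + \<bar>\<rho>2 0\<bar>) * (1 + r)"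
        using r0 mult_nonneg_nonneg[of "\<bar>\<rho>1 0\<bar>" r] unfolding distrib_left distrib_right by linarith
      finally show ?thesis .
    qed
  qed auto
qed

lemma convex_on_above_tangent_plane:
  assumes "convex_on UNIV U" "U differentiable (at x)"
  shows "U y \<ge> U x + grad U x \<bullet> (y - x)"
proof -
  have "convex_on UNIV (\<lambda>s::real. U (x + s *\<^sub>R (y - x)))"
  proof (rule convex_onI)
    fix t r s :: real assume "0 < t" "t < 1"
    then have "U ((1 - t) *\<^sub>R (x + r *\<^sub>R (y - x)) + t *\<^sub>R (x + s *\<^sub>R (y - x)))
      \<le> (1 - t) * U (x + r *\<^sub>R (y - x)) + t * U (x + s *\<^sub>R (y - x))"
      using assms(1) by (intro convex_onD) auto
    moreover have "(1 - t) *\<^sub>R (x + r *\<^sub>R (y - x)) + t *\<^sub>R (x + s *\<^sub>R (y - x)) =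
      x + ((1 - t) *\<^sub>R r + t *\<^sub>R s) *\<^sub>R (y - x)" by (simp add: algebra_simps)
    ultimately show "U (x + ((1 - t) *\<^sub>R r + t *\<^sub>R s) *\<^sub>R (y - x))
      \<le> (1 - t) * U (x + r *\<^sub>R (y - x)) + t * U (x + s *\<^sub>R (y - x))" by simp
  qed simp
  from convex_on_imp_above_tangent[OF this, of 0 1 "grad U x \<bullet> (y - x)"]
  show ?thesis using DERIV_line[of U x 0 "y - x"] assms(2) by simp
qed

section \<open>The gradient of a block potential\<close>

locale block_potential = orth_decomp E k
  for E :: "nat \<Rightarrow> 'a::euclidean_space set" and k :: nat +
  fixes U :: "'a \<Rightarrow> real" and \<rho> :: "nat \<Rightarrow> real \<Rightarrow> real" and A :: "'a \<Rightarrow> 'a" and b :: 'a and c :: real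
  assumes U_diff: "\<And>x. U differentiable (at x)"
    and grad_U_cont: "continuous_on UNIV (grad U)"
    and U_convex: "convex_on UNIV U"
    and A_linear: "linear A"
    and A_sym: "\<And>x y. x \<in> E 0 \<Longrightarrow> y \<in> E 0 \<Longrightarrow> A x \<bullet> y = x \<bullet> A y"
    and U_eq: "\<And>x. U x = (A (\<pi> 0 x) \<bullet> \<pi> 0 x + b \<bullet> \<pi> 0 x + c) + (\<Sum>i=1..k. \<rho> i (norm (\<pi> i x)))"
    and rho: "\<And>i. i \<in> {1..k} \<Longrightarrow> third_deriv_nonpos (\<rho> i)"
begin

text \<open>One predicate for all properties of the profile, so that \<rho>1 and M can be chosen for
  all blocks at once.\<close>

definition rho_data :: "nat \<Rightarrow> (real \<Rightarrow> real) \<Rightarrow> real \<Rightarrow> bool" where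
  "rho_data i \<rho>1 M \<longleftrightarrow> (\<forall>r>0. (\<rho> i has_real_derivative \<rho>1 r) (at r)) \<and>
    (\<forall>r\<ge>0. \<forall>s\<ge>0. \<rho>1 r / 2 + \<rho>1 s / 2 \<le> \<rho>1 ((r + s) / 2)) \<and> 0 \<le> M \<and> (\<forall>r\<ge>0. \<rho>1 r \<le> M * (1 + r))"

lemma rho_data_ex: obtains \<rho>1 M where "\<And>i. i \<in> {1..k} \<Longrightarrow> rho_data i (\<rho>1 i) (M i)"
proof -
  have "\<forall>i\<in>{1..k}. \<exists>p. rho_data i (fst p) (snd p)"
  proof
    fix i assume "i \<in> {1..k}"
    from third_deriv_nonposD[OF rho[OF this]] obtain \<rho>1 M where "rho_data i \<rho>1 M"
      unfolding rho_data_def by metis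
    then show "\<exists>p. rho_data i (fst p) (snd p)" by (intro exI[of _ "(\<rho>1, M)"]) simp
  qed
  then have "\<exists>p. \<forall>i\<in>{1..k}. rho_data i (fst (p i)) (snd (p i))" by (rule bchoice)
  then obtain p where p: "\<forall>i\<in>{1..k}. rho_data i (fst (p i)) (snd (p i))" ..
  show thesis by (rule that[of "\<lambda>i. fst (p i)" "\<lambda>i. snd (p i)"]) (use p in blast)
qed

lemma DERIV_line_U: "((\<lambda>s. U (x + s *\<^sub>R v)) has_real_derivative grad U x \<bullet> v) (at 0)"
  using DERIV_line[of U x 0 v] U_diff by simp

text \<open>U is differentiated along the line x + s p. In a block with \<pi> i p \<noteq> 0 this
  line is radial, so the norm of the projection is the affine function (m + s) |\<pi> i p| for |s| <
  m; in the other blocks the term is constant. The norm is thus never differentiated at its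
  singularity.\<close>

lemma grad_U_radial:
  assumes r: "radial_at p x" and d: "\<And>i. i \<in> {1..k} \<Longrightarrow> rho_data i (\<rho>1 i) (M i)"
  shows "grad U x \<bullet> p = 2 * (A (\<pi> 0 x) \<bullet> \<pi> 0 p) + b \<bullet> \<pi> 0 p + (\<Sum>i=1..k. \<rho>1 i (norm (\<pi> i x)) * norm (\<pi> i p))"
proof (rule DERIV_unique[OF DERIV_line_U])
  have 1: "((\<lambda>s. \<rho> i (norm (\<pi> i (x + s *\<^sub>R p)))) has_real_derivative \<rho>1 i (norm (\<pi> i x)) * norm (\<pi> i p)) (at 0)"
    if i: "i \<in> {1..k}" for i
  proof (cases "\<pi> i p = 0")
    case True
    then show ?thesis using i by (simp add: proj_add proj_scale)
  next
    case False
    obtain m where m: "m > 0" "\<pi> i x = m *\<^sub>R \<pi> i p" by (rule radial_atD[OF r i False])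
    have "((\<lambda>s. \<rho> i ((m + s) * norm (\<pi> i p))) has_real_derivative \<rho>1 i (norm (\<pi> i x)) * norm (\<pi> i p)) (at 0)"
    proof -
      have "norm (\<pi> i x) > 0" using m False by simp
      then have "(\<rho> i has_real_derivative \<rho>1 i (norm (\<pi> i x))) (at (norm (\<pi> i x)))"
        using d[OF i] by (simp add: rho_data_def)
      then have "(\<rho> i has_real_derivative \<rho>1 i (norm (\<pi> i x))) (at ((m + 0) * norm (\<pi> i p)))"
        using m by simp
      moreover have "((\<lambda>s. (m + s) * norm (\<pi> i p)) has_real_derivative norm (\<pi> i p)) (at 0)"
        by (auto intro!: derivative_eq_intros)
      ultimately show ?thesis by (rule DERIV_chain2)
    qed
    moreover have "\<rho> i ((m + s) * norm (\<pi> i p)) = \<rho> i (norm (\<pi> i (x + s *\<^sub>R p)))" if "dist s 0 < m" for s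
    proof -
      have "\<pi> i (x + s *\<^sub>R p) = (m + s) *\<^sub>R \<pi> i p" using i m by (simp add: proj_add proj_scale scaleR_add_left)
      moreover have "m + s > 0" using that by (simp add: dist_real_def)
      ultimately show ?thesis by simp
    qed
    ultimately show ?thesis by (rule has_field_derivative_transform_within[OF _ m(1) UNIV_I])
  qed
  have 2: "((\<lambda>s. A (\<pi> 0 (x + s *\<^sub>R p)) \<bullet> \<pi> 0 (x + s *\<^sub>R p) + b \<bullet> \<pi> 0 (x + s *\<^sub>R p) + c) has_real_derivative
      2 * (A (\<pi> 0 x) \<bullet> \<pi> 0 p) + b \<bullet> \<pi> 0 p) (at 0)"
  proof -
    have "(\<lambda>s. A (\<pi> 0 (x + s *\<^sub>R p)) \<bullet> \<pi> 0 (x + s *\<^sub>R p) + b \<bullet> \<pi> 0 (x + s *\<^sub>R p) + c) =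
      (\<lambda>s. A (\<pi> 0 x) \<bullet> \<pi> 0 x + s * (2 * (A (\<pi> 0 x) \<bullet> \<pi> 0 p)) + s^2 * (A (\<pi> 0 p) \<bullet> \<pi> 0 p) + (b \<bullet> \<pi> 0 x + s * (b \<bullet> \<pi> 0 p)) + c)"
      using A_sym[OF proj_in proj_in, of p x]
      by (auto simp: proj_add proj_scale linear_add[OF A_linear] linear_scale[OF A_linear] inner_add_left inner_add_right
          algebra_simps power2_eq_square inner_commute)
    then show ?thesis by (auto intro!: derivative_eq_intros)
  qed
  show "((\<lambda>s. U (x + s *\<^sub>R p)) has_real_derivative
      2 * (A (\<pi> 0 x) \<bullet> \<pi> 0 p) + b \<bullet> \<pi> 0 p + (\<Sum>i=1..k. \<rho>1 i (norm (\<pi> i x)) * norm (\<pi> i p))) (at 0)"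
    unfolding U_eq by (intro DERIV_add[OF 2] DERIV_sum 1) auto
qed

lemma grad_U_radial_midpoint:
  assumes "radial_at p x" "radial_at p y" "radial_at p ((1/2) *\<^sub>R (x + y))"
  shows "grad U x \<bullet> p / 2 + grad U y \<bullet> p / 2 \<le> grad U ((1/2) *\<^sub>R (x + y)) \<bullet> p"
proof -
  obtain \<rho>1 M where d: "\<And>i. i \<in> {1..k} \<Longrightarrow> rho_data i (\<rho>1 i) (M i)" by (rule rho_data_ex) blast
  have e: "grad U x \<bullet> p = 2 * (A (\<pi> 0 x) \<bullet> \<pi> 0 p) + b \<bullet> \<pi> 0 p + (\<Sum>i=1..k. \<rho>1 i (norm (\<pi> i x)) * norm (\<pi> i p))"
    if "radial_at p x" for x p by (rule grad_U_radial[OF that]) (rule d)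
  let ?z = "(1/2) *\<^sub>R (x + y)"
  have "(\<Sum>i=1..k. (\<rho>1 i (norm (\<pi> i x)) * norm (\<pi> i p)) / 2 + (\<rho>1 i (norm (\<pi> i y)) * norm (\<pi> i p)) / 2)
      \<le> (\<Sum>i=1..k. \<rho>1 i (norm (\<pi> i ?z)) * norm (\<pi> i p))"
  proof (rule sum_mono)
    fix i assume i: "i \<in> {1..k}"
    show "\<rho>1 i (norm (\<pi> i x)) * norm (\<pi> i p) / 2 + \<rho>1 i (norm (\<pi> i y)) * norm (\<pi> i p) / 2
      \<le> \<rho>1 i (norm (\<pi> i ?z)) * norm (\<pi> i p)"
    proof (cases "\<pi> i p = 0")
      case False
      obtain m where m: "m > 0" "\<pi> i x = m *\<^sub>R \<pi> i p" by (rule radial_atD[OF assms(1) i False])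
      obtain m' where m': "m' > 0" "\<pi> i y = m' *\<^sub>R \<pi> i p" by (rule radial_atD[OF assms(2) i False])
      have "\<pi> i ?z = ((m + m') / 2) *\<^sub>R \<pi> i p" using i m m' by (simp add: proj_add proj_scale algebra_simps add_divide_distrib)
      \<comment> \<open>Equality in the triangle inequality: both projections are positive multiples
        of \<pi> i p. Concavity of \<rho>1 can be applied only at the exact mean of the two
        radii.\<close>
      then have "norm (\<pi> i ?z) = (norm (\<pi> i x) + norm (\<pi> i y)) / 2" using m m' by (simp add: algebra_simps)
      moreover have "\<rho>1 i (norm (\<pi> i x)) / 2 + \<rho>1 i (norm (\<pi> i y)) / 2 \<le> \<rho>1 i ((norm (\<pi> i x) + norm (\<pi> i y)) / 2)"
        using d[OF i] by (simp add: rho_data_def)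
      ultimately have "(\<rho>1 i (norm (\<pi> i x)) / 2 + \<rho>1 i (norm (\<pi> i y)) / 2) * norm (\<pi> i p) \<le> \<rho>1 i (norm (\<pi> i ?z)) * norm (\<pi> i p)"
        by (intro mult_right_mono) (auto simp only: norm_ge_zero)
      then show ?thesis by (simp add: algebra_simps)
    qed simp
  qed
  moreover have "A (\<pi> 0 ?z) \<bullet> \<pi> 0 p = (A (\<pi> 0 x) \<bullet> \<pi> 0 p) / 2 + (A (\<pi> 0 y) \<bullet> \<pi> 0 p) / 2"
    by (simp add: proj_add proj_scale linear_add[OF A_linear] linear_scale[OF A_linear] inner_add_left algebra_simps)
  ultimately show ?thesis
    unfolding e[OF assms(1)] e[OF assms(2)] e[OF assms(3)]
    by (simp add: sum.distrib sum_divide_distrib[symmetric] field_simps)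
qed

text \<open>From above, the radial formula with p = x and the linear bound on \<rho>1. From below,
  monotonicity of the gradient of a convex function between 0 and x.\<close>

lemma drift_growth: obtains C where "C \<ge> 0" "\<And>x. \<bar>grad U x \<bullet> x\<bar> \<le> C * (1 + x \<bullet> x)"
proof -
  obtain \<rho>1 M where d: "\<And>i. i \<in> {1..k} \<Longrightarrow> rho_data i (\<rho>1 i) (M i)" by (rule rho_data_ex) blast
  have e: "grad U x \<bullet> p = 2 * (A (\<pi> 0 x) \<bullet> \<pi> 0 p) + b \<bullet> \<pi> 0 p + (\<Sum>i=1..k. \<rho>1 i (norm (\<pi> i x)) * norm (\<pi> i p))"
    if "radial_at p x" for x p by (rule grad_U_radial[OF that]) (rule d)
  obtain B where B: "B > 0" "\<And>x. norm (A x) \<le> B * norm x"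
    using linear_bounded_pos[OF A_linear] by blast
  have n1: "norm x \<le> 1 + x \<bullet> x" for x :: 'a
    using sum_squares_ge_zero[of "norm x - 1" 0] power2_norm_eq_inner[of x]
    by (simp add: power2_eq_square algebra_simps) (smt (verit) norm_ge_zero mult_nonneg_nonneg sum_squares_ge_zero)
  \<comment> \<open>One summand per term of the radial formula, and the last for the lower bound.
    The factor of M i comes from (1 + r) r \<le> 2 (1 + r r).\<close>
  define C where "C = 2 * B + norm b + (\<Sum>i=1..k. 2 * M i) + norm (grad U 0)"
  have M0: "M i \<ge> 0" if "i \<in> {1..k}" for i using d[OF that] by (simp add: rho_data_def)
  have up: "grad U x \<bullet> x \<le> C * (1 + x \<bullet> x)" for x
  proof -
    have r: "radial_at x x" by (simp add: radial_at_def inner_commute)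
    have a: "A (\<pi> 0 x) \<bullet> \<pi> 0 x \<le> B * (1 + x \<bullet> x)"
    proof -
      have "A (\<pi> 0 x) \<bullet> \<pi> 0 x \<le> norm (A (\<pi> 0 x)) * norm (\<pi> 0 x)" by (rule norm_cauchy_schwarz)
      also have "\<dots> \<le> B * norm (\<pi> 0 x) * norm (\<pi> 0 x)" using B by (intro mult_right_mono) auto
      also have "\<dots> \<le> B * norm x * norm x" using B norm_proj_le[of 0 x] by (intro mult_mono) auto
      also have "\<dots> = B * (x \<bullet> x)" using power2_norm_eq_inner[of x] by (simp add: power2_eq_square)
      also have "\<dots> \<le> B * (1 + x \<bullet> x)" using B by simp
      finally show ?thesis .
    qed
    have b: "b \<bullet> \<pi> 0 x \<le> norm b * (1 + x \<bullet> x)"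
    proof -
      have "b \<bullet> \<pi> 0 x \<le> norm b * norm (\<pi> 0 x)" by (rule norm_cauchy_schwarz)
      also have "\<dots> \<le> norm b * (1 + x \<bullet> x)" using n1[of x] norm_proj_le[of 0 x] by (intro mult_left_mono) auto
      finally show ?thesis .
    qed
    have s: "(\<Sum>i=1..k. \<rho>1 i (norm (\<pi> i x)) * norm (\<pi> i x)) \<le> (\<Sum>i=1..k. 2 * M i * (1 + x \<bullet> x))"
    proof (rule sum_mono)
      fix i assume i: "i \<in> {1..k}"
      let ?r = "norm (\<pi> i x)"
      have r: "?r \<le> norm x" using i by (simp add: norm_proj_le)
      have "\<rho>1 i ?r * ?r \<le> M i * (1 + ?r) * ?r" using d[OF i] by (intro mult_right_mono) (auto simp: rho_data_def)
      also have "\<dots> \<le> M i * ((1 + norm x) * norm x)" unfolding mult.assoc using r M0[OF i] by (intro mult_left_mono mult_mono) auto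
      also have "\<dots> \<le> M i * (2 * (1 + x \<bullet> x))"
        using M0[OF i] n1[of x] power2_norm_eq_inner[of x] by (intro mult_left_mono) (auto simp: algebra_simps power2_eq_square)
      finally show "\<rho>1 i ?r * ?r \<le> 2 * M i * (1 + x \<bullet> x)" by (simp add: mult_ac)
    qed
    have "grad U x \<bullet> x \<le> (2 * B + norm b + (\<Sum>i=1..k. 2 * M i)) * (1 + x \<bullet> x)"
      unfolding e[OF r] using a b s by (simp add: sum_distrib_right distrib_right)
    also have "\<dots> \<le> C * (1 + x \<bullet> x)" by (intro mult_right_mono) (auto simp: C_def)
    finally show ?thesis .
  qed
  have lo: "grad U x \<bullet> x \<ge> - (C * (1 + x \<bullet> x))" for x
  proof -
    have "U 0 \<ge> U x + grad U x \<bullet> (0 - x)" "U x \<ge> U 0 + grad U 0 \<bullet> (x - 0)"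
      using convex_on_above_tangent_plane[OF U_convex U_diff] by blast+
    then have "grad U x \<bullet> x \<ge> grad U 0 \<bullet> x" by simp
    moreover have "grad U 0 \<bullet> x \<ge> - (norm (grad U 0) * norm x)" using Cauchy_Schwarz_ineq2[of "grad U 0" x] by simp
    moreover have "norm (grad U 0) * norm x \<le> C * (1 + x \<bullet> x)"
      using n1[of x] B(1) sum_nonneg[of "{1..k}" "\<lambda>i. 2 * M i"] M0 by (intro mult_mono) (auto simp: C_def)
    ultimately show ?thesis by simp
  qed
  show ?thesis
  proof (rule that[of C])
    show "C \<ge> 0" using B(1) sum_nonneg[of "{1..k}" "\<lambda>i. 2 * M i"] M0 by (auto simp: C_def)
    show "\<bar>grad U x \<bullet> x\<bar> \<le> C * (1 + x \<bullet> x)" for x using up[of x] lo[of x] by simp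
  qed
qed

lemma U_refl: "i \<in> {1..k} \<Longrightarrow> w \<in> E i \<Longrightarrow> U (refl_along w x) = U x"
  unfolding U_eq by (intro arg_cong2[where f = "(+)"] sum.cong) (auto simp: norm_proj_refl proj_refl_other[of i w 0])

lemma grad_U_refl:
  assumes "i \<in> {1..k}" "w \<in> E i"
  shows "grad U (refl_along w x) \<bullet> refl_along w v = grad U x \<bullet> v"
proof (rule DERIV_unique[OF DERIV_line_U])
  have lin: "linear (refl_along w)"
    using orthogonal_transformation_refl_along orthogonal_transformation_linear by blast
  have "U (refl_along w x + s *\<^sub>R refl_along w v) = U (x + s *\<^sub>R v)" for s
    using U_refl[OF assms, of "x + s *\<^sub>R v"] by (simp add: linear_add[OF lin] linear_scale[OF lin])
  then show "((\<lambda>s. U (refl_along w x + s *\<^sub>R refl_along w v)) has_real_derivative grad U x \<bullet> v) (at 0)"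
    using DERIV_line_U by simp
qed

text \<open>A displacement along p leaves the component in \<open>E i\<close> alone, and all other
  components of x and y coincide. Therefore the difference of U along the two parallel lines is
  constant.\<close>

lemma grad_U_diff:
  assumes "i \<in> {1..k}" "x - y \<in> E i" "\<And>v. v \<in> E i \<Longrightarrow> p \<bullet> v = 0"
  shows "grad U x \<bullet> p = grad U y \<bullet> p"
proof -
  have pi: "\<pi> i p = 0" using assms by (intro proj_orth) auto
  have pj: "\<pi> j x = \<pi> j y" if "j \<le> k" "j \<noteq> i" for j
  proof -
    have "\<pi> j (x - y) = 0" using that assms by (intro proj_other[of j i]) auto
    then show ?thesis using that by (simp add: proj_diff)
  qed
  have "U (x + s *\<^sub>R p) - U (y + s *\<^sub>R p) = \<rho> i (norm (\<pi> i x)) - \<rho> i (norm (\<pi> i y))" for s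
  proof -
    have "(\<Sum>j=1..k. \<rho> j (norm (\<pi> j (x + s *\<^sub>R p))) - \<rho> j (norm (\<pi> j (y + s *\<^sub>R p)))) =
        (\<Sum>j=1..k. if j = i then \<rho> i (norm (\<pi> i x)) - \<rho> i (norm (\<pi> i y)) else 0)"
      using assms by (intro sum.cong refl) (auto simp: proj_add proj_scale pi pj)
    also have "\<dots> = \<rho> i (norm (\<pi> i x)) - \<rho> i (norm (\<pi> i y))" using assms by simp
    finally show ?thesis using assms pj[of 0] by (simp add: U_eq sum_subtractf proj_add proj_scale)
  qed
  then have "(\<lambda>s. U (x + s *\<^sub>R p) - U (y + s *\<^sub>R p)) = (\<lambda>s. \<rho> i (norm (\<pi> i x)) - \<rho> i (norm (\<pi> i y)))" by auto
  then have "((\<lambda>s. U (x + s *\<^sub>R p) - U (y + s *\<^sub>R p)) has_real_derivative 0) (at 0)" by simp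
  moreover have "((\<lambda>s. U (x + s *\<^sub>R p) - U (y + s *\<^sub>R p)) has_real_derivative grad U x \<bullet> p - grad U y \<bullet> p) (at 0)"
    by (intro DERIV_diff DERIV_line_U)
  ultimately show ?thesis using DERIV_unique by fastforce
qed

end

section \<open>Bounds for solutions\<close>

lemma at_within_atLeast: "0 < t \<Longrightarrow> at t within {0..} = at (t::real)"
  by (intro at_within_interior) auto

lemma DERIV_nonpos_right:
  fixes \<phi> :: "real \<Rightarrow> real"
  assumes "(\<phi> has_real_derivative D) (at 0)" "\<And>s. 0 < s \<Longrightarrow> \<phi> s \<le> \<phi> 0"
  shows "D \<le> 0"
proof (rule ccontr)
  assume "\<not> D \<le> 0"
  then obtain d where d: "d > 0" "\<And>h. 0 < h \<Longrightarrow> h < d \<Longrightarrow> \<phi> 0 < \<phi> (0 + h)"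
    using DERIV_pos_inc_right[OF assms(1)] by (meson not_le)
  show False using d(2)[of "d/2"] assms(2)[of "d/2"] d(1) by simp
qed

section \<open>Elementary facts about bounded solutions\<close>

context
  fixes U :: "'a::euclidean_space \<Rightarrow> real" and f u
  assumes sol: "bounded_solution U f u"
begin

lemma sol_bound: obtains B where "B > 0" "\<And>t x. t \<ge> 0 \<Longrightarrow> \<bar>u t x\<bar> \<le> B"
proof -
  obtain B where "\<And>t x. t \<ge> 0 \<Longrightarrow> \<bar>u t x\<bar> \<le> B"
    using sol unfolding bounded_solution_def by blast
  then have "\<bar>u t x\<bar> \<le> \<bar>B\<bar> + 1" if "t \<ge> 0" for t x
    using order_trans[OF \<open>\<And>t x. t \<ge> 0 \<Longrightarrow> \<bar>u t x\<bar> \<le> B\<close>[OF that], of "\<bar>B\<bar> + 1"] by simp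
  then show ?thesis using that[of "\<bar>B\<bar> + 1"] by simp
qed

lemma sol_cont:
  assumes "continuous_on S g"
  shows "continuous_on ({0..T} \<times> S) (\<lambda>(t, s). u t (g s))"
proof -
  have c: "continuous_on ({0..} \<times> UNIV) (\<lambda>(t, x). u t x)" using sol by (simp add: bounded_solution_def)
  have "continuous_on ({0..T} \<times> S) (\<lambda>p. (fst p, g (snd p)))"
    by (intro continuous_intros continuous_on_compose2[OF assms]) auto
  then have "continuous_on ({0..T} \<times> S) (\<lambda>p. case (fst p, g (snd p)) of (t, x) \<Rightarrow> u t x)"
    by (rule continuous_on_compose2[OF c]) auto
  then show ?thesis by (simp add: case_prod_beta)
qed

lemma sol_init: "u 0 x = f x"
  using sol by (simp add: bounded_solution_def)

lemma sol_time: "t > 0 \<Longrightarrow> ((\<lambda>s. u s x) has_real_derivative lap (u t) x - grad (u t) x \<bullet> grad U x) (at t)"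
  using sol unfolding bounded_solution_def gen_L_eq by (metis at_within_atLeast less_imp_le)

lemma sol_C2: "t \<ge> 0 \<Longrightarrow> C_m 2 (u t)"
  using sol by (simp add: bounded_solution_def)

lemma sol_line: "t \<ge> 0 \<Longrightarrow> ((\<lambda>s. u t (x + s *\<^sub>R v)) has_real_derivative grad (u t) (x + s *\<^sub>R v) \<bullet> v) (at s)"
  by (intro DERIV_line C2D(1) sol_C2)

lemma sol_line2: "t \<ge> 0 \<Longrightarrow> ((\<lambda>s. grad (u t) (x + s *\<^sub>R v) \<bullet> v) has_real_derivative hess (u t) x v) (at 0)"
  using DERIV_line_grad[of "u t" x 0 v] C2D(2)[OF sol_C2] by simp

end

text \<open>Only an upper bound; together with nonnegativity it says that u tends to 0 at infinity,
  uniformly on bounded time intervals. This is what confines the maxima to compact sets.\<close>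

definition vanishing :: "(real \<Rightarrow> 'a::real_normed_vector \<Rightarrow> real) \<Rightarrow> bool" where
  "vanishing u \<longleftrightarrow> (\<forall>T \<eta>. 0 < \<eta> \<longrightarrow> (\<exists>R. \<forall>t\<in>{0..T}. \<forall>x. norm x > R \<longrightarrow> u t x \<le> \<eta>))"

lemma le_of_le_add_eps:
  fixes a b m :: real
  assumes "m > 0" "\<And>\<epsilon>. \<epsilon> > 0 \<Longrightarrow> a \<le> b + \<epsilon> * m"
  shows "a \<le> b"
proof (rule field_le_epsilon)
  fix e :: real assume "e > 0"
  then show "a \<le> b + e" using assms(2)[of "e / m"] assms(1) by simp
qed

context block_potential
begin

text \<open>Comparison with the supersolution \<open>exp (K t) (C / q + \<epsilon> q)\<close>, where \<open>q = 1 + |x|\<^sup>2\<close>. It is here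
  that the linear growth of the drift is needed.\<close>

lemma solution_decay:
  assumes sol: "bounded_solution U f u" and C: "0 \<le> C"
    and init: "\<And>x. \<sigma> * f x \<le> C / (1 + x \<bullet> x)"
  shows "\<exists>K\<ge>0. \<forall>t\<ge>0. \<forall>x. \<sigma> * u t x \<le> C * exp (K * t) / (1 + x \<bullet> x)"
proof -
  obtain C1 where C1: "C1 \<ge> 0" "\<And>x. \<bar>grad U x \<bullet> x\<bar> \<le> C1 * (1 + x \<bullet> x)" by (rule drift_growth) blast
  obtain B where B: "B > 0" "\<And>t x. t \<ge> 0 \<Longrightarrow> \<bar>u t x\<bar> \<le> B" using sol_bound[OF sol] by blast
  define n where "n = real DIM('a)"
  \<comment> \<open>The 8 absorbs the part 8 C |x|^2 / q^3 of the Laplacian of C / q, the 2 n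
    absorbs the Laplacian of \<epsilon> q, and 2 C1 absorbs the drift acting on either
    summand.\<close>
  define K where "K = 8 + 2 * n + 2 * C1"
  have n: "n \<ge> 0" by (simp add: n_def)
  have K: "K \<ge> 0" using C1 n by (simp add: K_def)
  define Q :: "'a \<Rightarrow> real" where "Q y = 1 + y \<bullet> y" for y
  have Q1: "Q y \<ge> 1" for y by (simp add: Q_def)
  then have Q0: "Q y > 0" for y using less_le_trans[OF zero_less_one] by blast
  have DQ: "((\<lambda>s. Q (x + s *\<^sub>R v)) has_real_derivative 2 * ((x + s *\<^sub>R v) \<bullet> v)) (at s)" for x v s
  proof -
    have "(\<lambda>s. Q (x + s *\<^sub>R v)) = (\<lambda>s. 1 + x \<bullet> x + 2 * s * (x \<bullet> v) + s^2 * (v \<bullet> v))"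
      by (auto simp: Q_def inner_add_left inner_add_right inner_commute algebra_simps power2_eq_square)
    then show ?thesis by (auto intro!: derivative_eq_intros simp: inner_add_left algebra_simps)
  qed
  have main: "\<sigma> * u T x - exp (K * T) * (C / Q x + \<epsilon> * Q x) \<le> 0" if \<epsilon>: "\<epsilon> > 0" and T: "T \<ge> 0" for \<epsilon> T x
  proof (rule parabolic_maximum_principle[where S = UNIV and \<Phi> = "\<lambda>t x. \<sigma> * u t x - exp (K * t) * (C / Q x + \<epsilon> * Q x)"])
    show "continuous_on ({0..T} \<times> UNIV) (\<lambda>(t, s). \<sigma> * u t s - exp (K * t) * (C / Q s + \<epsilon> * Q s))"
    proof -
      have "1 + y \<bullet> y \<noteq> 0" for y :: 'a using Q0[of y] by (simp add: Q_def)
      then show ?thesis unfolding case_prod_beta Q_def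
        by (intro continuous_intros sol_cont[OF sol, OF continuous_on_id, unfolded case_prod_beta]) auto
    qed
    show "\<sigma> * u 0 s - exp (K * 0) * (C / Q s + \<epsilon> * Q s) \<le> 0" for s
      using init[of s] sol_init[OF sol, of s] \<epsilon> Q0[of s] by (simp add: Q_def) (smt (verit) mult_nonneg_nonneg)
    show "\<exists>R. \<forall>t\<in>{0..T}. \<forall>s\<in>UNIV. norm s > R \<longrightarrow> \<sigma> * u t s - exp (K * t) * (C / Q s + \<epsilon> * Q s) \<le> \<eta>" if \<eta>: "\<eta> > 0" for \<eta>
    \<comment> \<open>Beyond this radius \<epsilon> Q exceeds the bound on \<sigma> u. The summand 1
      makes |s| at least 1, so that |s| is at most its square.\<close>
    proof (intro exI[of _ "\<bar>\<sigma>\<bar> * B / \<epsilon> + 1"] ballI impI)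
      fix t s assume t: "t \<in> {0..T}" and s: "norm (s::'a) > \<bar>\<sigma>\<bar> * B / \<epsilon> + 1"
      have "\<bar>\<sigma>\<bar> * B / \<epsilon> \<ge> 0" using B \<epsilon> by simp
      then have "norm s * 1 \<le> norm s * norm s" using s by (intro mult_left_mono) auto
      then have "\<bar>\<sigma>\<bar> * B / \<epsilon> \<le> Q s" using s power2_norm_eq_inner[of s] by (simp add: Q_def power2_eq_square)
      then have "\<bar>\<sigma>\<bar> * B \<le> \<epsilon> * Q s" using \<epsilon> by (simp add: field_simps)
      also have "\<dots> \<le> 1 * (C / Q s + \<epsilon> * Q s)" using C Q0[of s] by simp
      also have "\<dots> \<le> exp (K * t) * (C / Q s + \<epsilon> * Q s)"
        using K t C Q0[of s] \<epsilon> by (intro mult_right_mono) (auto intro: less_imp_le)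
      finally have "\<bar>\<sigma>\<bar> * B \<le> exp (K * t) * (C / Q s + \<epsilon> * Q s)" .
      moreover have "\<sigma> * u t s \<le> \<bar>\<sigma>\<bar> * B"
      proof -
        have "\<sigma> * u t s \<le> \<bar>\<sigma>\<bar> * \<bar>u t s\<bar>" by (metis abs_ge_self abs_mult)
        also have "\<dots> \<le> \<bar>\<sigma>\<bar> * B" using B t by (intro mult_left_mono) auto
        finally show ?thesis .
      qed
      ultimately show "\<sigma> * u t s - exp (K * t) * (C / Q s + \<epsilon> * Q s) \<le> \<eta>" using \<eta> by simp
    qed
    fix t x assume t: "0 < t" and mx: "\<And>y. y \<in> UNIV \<Longrightarrow> \<sigma> * u t y - exp (K * t) * (C / Q y + \<epsilon> * Q y)
        \<le> \<sigma> * u t x - exp (K * t) * (C / Q x + \<epsilon> * Q x)"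
    define a where "a = exp (K * t)"
    have a: "a > 0" by (simp add: a_def)
    define q where "q = Q x"
    have q: "q > 0" "q \<ge> 1" using Q0[of x] Q1[of x] by (auto simp: q_def)
    \<comment> \<open>First and second order conditions along x + s v. The right-hand sides are the
      derivatives of a (C / q + \<epsilon> q), whose gradient is 2 a (\<epsilon> - C / q^2)
      x.\<close>
    have *: "\<sigma> * (grad (u t) x \<bullet> v) = a * (\<epsilon> - C / q^2) * (2 * (x \<bullet> v))"
      "\<sigma> * hess (u t) x v \<le> a * (8 * C * (x \<bullet> v)^2 / q^3 + 2 * (\<epsilon> - C / q^2) * (v \<bullet> v))" for v
    proof -
      let ?\<phi> = "\<lambda>s. \<sigma> * u t (x + s *\<^sub>R v) - a * (C / Q (x + s *\<^sub>R v) + \<epsilon> * Q (x + s *\<^sub>R v))"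
      let ?\<phi>' = "\<lambda>s. \<sigma> * (grad (u t) (x + s *\<^sub>R v) \<bullet> v) - a * ((\<epsilon> - C / (Q (x + s *\<^sub>R v))^2) * (2 * ((x + s *\<^sub>R v) \<bullet> v)))"
      have D1: "(?\<phi> has_real_derivative ?\<phi>' s) (at s)" for s
        using t Q0[of "x + s *\<^sub>R v"]
        by (auto intro!: derivative_eq_intros sol_line[OF sol] DQ simp: power2_eq_square field_simps)
      have Di: "((\<lambda>s. (x + s *\<^sub>R v) \<bullet> v) has_real_derivative v \<bullet> v) (at 0)"
        by (auto simp: inner_add_left intro!: derivative_eq_intros)
      have DQ0: "((\<lambda>s. Q (x + s *\<^sub>R v)) has_real_derivative 2 * (x \<bullet> v)) (at 0)"
        using DQ[of x v 0] by simp
      have D2: "(?\<phi>' has_real_derivative \<sigma> * hess (u t) x v - a * (8 * C * (x \<bullet> v)^2 / q^3 + 2 * (\<epsilon> - C / q^2) * (v \<bullet> v))) (at 0)"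
        using t Q0[of x]
        by (auto intro!: derivative_eq_intros sol_line2[OF sol] DQ0 Di simp: q_def power2_eq_square power3_eq_cube field_simps)
      have m: "?\<phi> s \<le> ?\<phi> 0" for s using mx[of "x + s *\<^sub>R v"] by (simp add: a_def)
      note tst = second_derivative_test[OF zero_less_one D1 D2 m]
      from tst show "\<sigma> * (grad (u t) x \<bullet> v) = a * (\<epsilon> - C / q^2) * (2 * (x \<bullet> v))"
        "\<sigma> * hess (u t) x v \<le> a * (8 * C * (x \<bullet> v)^2 / q^3 + 2 * (\<epsilon> - C / q^2) * (v \<bullet> v))"
        by (auto simp: q_def)
    qed
    define G where "G = grad U x \<bullet> x"
    have G: "\<bar>G\<bar> \<le> C1 * q" using C1(2)[of x] by (simp add: G_def q_def Q_def)
    have g: "\<sigma> * (grad (u t) x \<bullet> grad U x) = a * (\<epsilon> - C / q^2) * (2 * G)"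
      using *(1)[of "grad U x"] by (simp add: G_def inner_commute)
    have "\<sigma> * lap (u t) x = (\<Sum>b\<in>Basis. \<sigma> * hess (u t) x b)" by (simp add: lap_eq_hess sum_distrib_left)
    also have "\<dots> \<le> (\<Sum>b\<in>Basis. a * (8 * C * (x \<bullet> b)^2 / q^3 + 2 * (\<epsilon> - C / q^2) * (b \<bullet> b)))"
      by (intro sum_mono *(2))
    also have "\<dots> = (\<Sum>b\<in>Basis. a * (8 * C / q^3) * ((x \<bullet> b) * (x \<bullet> b)) + a * 2 * (\<epsilon> - C / q^2))"
      by (intro sum.cong refl) (simp add: power2_eq_square algebra_simps)
    also have "\<dots> = a * (8 * C * (x \<bullet> x) / q^3 + 2 * n * (\<epsilon> - C / q^2))"
      unfolding sum.distrib sum_distrib_left[symmetric] euclidean_inner[symmetric]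
      by (simp add: n_def algebra_simps)
    finally have l: "\<sigma> * lap (u t) x \<le> a * (8 * C * (x \<bullet> x) / q^3 + 2 * n * (\<epsilon> - C / q^2))" .
    have key: "8 * C * (x \<bullet> x) / q^3 + 2 * n * (\<epsilon> - C / q^2) - (\<epsilon> - C / q^2) * (2 * G) \<le> K * (C / q + \<epsilon> * q)"
    proof -
      have 1: "8 * C * (x \<bullet> x) / q^3 \<le> 8 * (C / q)"
      proof -
        have "x \<bullet> x \<le> q * 1" by (simp add: q_def Q_def)
        also have "\<dots> \<le> q * q" using q by (intro mult_left_mono) auto
        finally have "8 * C * (x \<bullet> x) \<le> 8 * C * (q * q)" using C by (intro mult_left_mono) auto
        then have "8 * C * (x \<bullet> x) / q^3 \<le> 8 * C * (q * q) / q^3" using q by (intro divide_right_mono) auto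
        also have "\<dots> = 8 * (C / q)" using q by (simp add: power3_eq_cube)
        finally show ?thesis .
      qed
      have 2: "2 * n * (\<epsilon> - C / q^2) \<le> 2 * n * (\<epsilon> * q)"
      proof -
        have "\<epsilon> - C / q^2 \<le> \<epsilon> * 1" using C by simp
        also have "\<dots> \<le> \<epsilon> * q" using q \<epsilon> by (intro mult_left_mono) auto
        finally show ?thesis using n by (intro mult_left_mono) auto
      qed
      have 3: "- (\<epsilon> * (2 * G)) \<le> 2 * C1 * (\<epsilon> * q)"
      proof -
        have "\<epsilon> * (- (2 * G)) \<le> \<epsilon> * (2 * (C1 * q))" using G \<epsilon> by (intro mult_left_mono) auto
        then show ?thesis by (simp add: mult_ac)
      qed
      have 4: "C / q^2 * (2 * G) \<le> 2 * C1 * (C / q)"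
      proof -
        have "C / q^2 * (2 * G) \<le> C / q^2 * (2 * (C1 * q))" using G C by (intro mult_left_mono) auto
        also have "\<dots> = 2 * C1 * (C / q)" using q by (simp add: power2_eq_square)
        finally show ?thesis .
      qed
      have "8 * C * (x \<bullet> x) / q^3 + 2 * n * (\<epsilon> - C / q^2) - (\<epsilon> - C / q^2) * (2 * G)
        \<le> 8 * (C / q) + 2 * n * (\<epsilon> * q) + 2 * C1 * (\<epsilon> * q) + 2 * C1 * (C / q)"
        unfolding left_diff_distrib[of \<epsilon>] using 1 2 3 4 by linarith
      also have "\<dots> = (8 + 2 * C1) * (C / q) + (2 * n + 2 * C1) * (\<epsilon> * q)" by (simp add: algebra_simps)
      also have "\<dots> \<le> K * (C / q) + K * (\<epsilon> * q)"
        using n C1(1) C q \<epsilon> by (intro add_mono mult_right_mono) (auto simp: K_def)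
      finally show ?thesis by (simp add: algebra_simps)
    qed
    show "\<exists>d\<le>0. ((\<lambda>\<tau>. \<sigma> * u \<tau> x - exp (K * \<tau>) * (C / Q x + \<epsilon> * Q x)) has_real_derivative d) (at t within {0..})"
    proof (intro exI conjI)
      show "((\<lambda>\<tau>. \<sigma> * u \<tau> x - exp (K * \<tau>) * (C / Q x + \<epsilon> * Q x)) has_real_derivative
         \<sigma> * (lap (u t) x - grad (u t) x \<bullet> grad U x) - K * a * (C / q + \<epsilon> * q)) (at t within {0..})"
        unfolding at_within_atLeast[OF t]
        using t by (auto intro!: derivative_eq_intros sol_time[OF sol] simp: a_def q_def)
      have "\<sigma> * (lap (u t) x - grad (u t) x \<bullet> grad U x)
        \<le> a * (8 * C * (x \<bullet> x) / q^3 + 2 * n * (\<epsilon> - C / q^2) - (\<epsilon> - C / q^2) * (2 * G))"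
        using l unfolding right_diff_distrib[of \<sigma>] g right_diff_distrib[of a "8 * C * (x \<bullet> x) / q^3 + 2 * n * (\<epsilon> - C / q^2)"]
        by (simp add: mult.assoc)
      also have "\<dots> \<le> a * (K * (C / q + \<epsilon> * q))" using key a by (intro mult_left_mono) auto
      finally show "\<sigma> * (lap (u t) x - grad (u t) x \<bullet> grad U x) - K * a * (C / q + \<epsilon> * q) \<le> 0"
        by (simp add: mult_ac)
    qed
  qed (use T in auto)
  \<comment> \<open>With t and x fixed, \<epsilon> tends to 0 and the growing part of the barrier
    disappears.\<close>
  have "\<sigma> * u t x \<le> C * exp (K * t) / (1 + x \<bullet> x)" if t: "t \<ge> 0" for t x
  proof (rule le_of_le_add_eps)
    show "exp (K * t) * Q x > 0" using Q0 by simp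
    show "\<sigma> * u t x \<le> C * exp (K * t) / (1 + x \<bullet> x) + \<epsilon> * (exp (K * t) * Q x)" if "\<epsilon> > 0" for \<epsilon>
      using main[OF that t, of x] by (simp add: Q_def algebra_simps)
  qed
  with K show ?thesis by blast
qed

text \<open>The decay estimate with \<sigma> = -1 and C = 0.\<close>

lemma solution_nonneg:
  assumes "bounded_solution U f u" "\<And>x. 0 \<le> f x" "0 \<le> t"
  shows "0 \<le> u t x"
  using solution_decay[OF assms(1) order_refl, of "-1"] assms(2,3) by auto

lemma solution_vanishing:
  assumes sol: "bounded_solution U f u" and f: "\<And>x. f x \<le> C / (1 + x \<bullet> x)" "0 \<le> C"
  shows "vanishing u"
  unfolding vanishing_def
proof (intro allI impI)
  fix T \<eta> :: real assume \<eta>: "0 < \<eta>"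
  obtain K where K: "K \<ge> 0" "\<And>t x. t \<ge> 0 \<Longrightarrow> u t x \<le> C * exp (K * t) / (1 + x \<bullet> x)"
    using solution_decay[OF sol f(2), of 1] f(1) by auto
  let ?R = "C * exp (K * T) / \<eta> + 1"
  show "\<exists>R. \<forall>t\<in>{0..T}. \<forall>x. norm x > R \<longrightarrow> u t x \<le> \<eta>"
  proof (intro exI[of _ ?R] ballI allI impI)
    fix t and x :: 'a assume t: "t \<in> {0..T}" and x: "norm x > ?R"
    have "C * exp (K * T) / \<eta> \<ge> 0" using f(2) \<eta> by simp
    then have "norm x * 1 \<le> norm x * norm x" using x by (intro mult_left_mono) auto
    then have "C * exp (K * T) / \<eta> \<le> 1 + x \<bullet> x" using x power2_norm_eq_inner[of x] by (simp add: power2_eq_square)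
    then have "C * exp (K * T) \<le> \<eta> * (1 + x \<bullet> x)" using \<eta> by (simp add: field_simps)
    moreover have "C * exp (K * t) \<le> C * exp (K * T)" using t K(1) f(2) by (intro mult_left_mono) (auto intro: mult_left_mono)
    moreover have "1 + x \<bullet> x > 0" by (simp add: add_pos_nonneg)
    ultimately have "C * exp (K * t) / (1 + x \<bullet> x) \<le> \<eta>" by (simp add: divide_le_eq)
    then show "u t x \<le> \<eta>" using K(2)[of t x] t by auto
  qed
qed

end

section \<open>Symmetry, monotonicity and log-concavity of solutions\<close>

context orth_decomp
begin

text \<open>For equal norms the inequality holds both ways, so invariance under rotations of a block
  is included. The form with pairs of points, rather than with a radial profile, is what a two-point
  maximum principle can propagate.\<close>

definition block_antimono :: "('a \<Rightarrow> real) \<Rightarrow> bool" where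
  "block_antimono f \<longleftrightarrow>
    (\<forall>i\<in>{1..k}. \<forall>x y. x - y \<in> E i \<longrightarrow> norm (\<pi> i y) \<le> norm (\<pi> i x) \<longrightarrow> f x \<le> f y)"

lemma norm_le_block:
  assumes "i \<le> k" "x - y \<in> E i" "norm (\<pi> i y) \<le> norm (\<pi> i x)"
  shows "norm y \<le> norm x"
proof -
  have "\<pi> j y = \<pi> j x" if "j \<le> k" "j \<noteq> i" for j
    using that assms proj_other[of j i "x - y"] by (simp add: proj_diff)
  then have "(norm (\<pi> j y))\<^sup>2 \<le> (norm (\<pi> j x))\<^sup>2" if "j \<le> k" for j
    using that assms by (cases "j = i") auto
  then have "(norm y)\<^sup>2 \<le> (norm x)\<^sup>2" unfolding norm_proj[of x] norm_proj[of y] by (intro sum_mono) auto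
  then show ?thesis by (rule power2_le_imp_le) simp
qed

lemma block_antimono_refl:
  assumes f: "block_antimono f" and i: "i \<in> {1..k}" and w: "w \<in> E i"
  shows "f (refl_along w x) = f x"
proof -
  have i': "i \<le> k" using i by auto
  have "x - refl_along w x \<in> E i" "refl_along w x - x \<in> E i"
    using w subsp[OF i'] by (auto simp: refl_along_def subspace_scale subspace_neg)
  then show ?thesis using f i norm_proj_refl[OF i' w i', of x] unfolding block_antimono_def
    by (metis order_antisym order_refl)
qed

text \<open>Moving from x along v in \<open>E i\<close> with v \<bullet> x \<ge> 0 increases the
  norm of the projection, so f does not increase and its derivative along v is nonpositive.\<close>

lemma block_antimono_radial:
  assumes f: "block_antimono f" and d: "f differentiable (at x)"
  shows "radial_at (- grad f x) x"
  unfolding radial_at_def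
proof (intro ballI impI)
  fix i v assume i: "i \<in> {1..k}" and v: "v \<in> E i" "0 \<le> v \<bullet> x"
  have i': "i \<le> k" using i by auto
  have "grad f x \<bullet> v \<le> 0"
  proof (rule DERIV_nonpos_right)
    show "((\<lambda>s. f (x + s *\<^sub>R v)) has_real_derivative grad f x \<bullet> v) (at 0)"
      using DERIV_line[of f x 0 v] d by simp
    show "f (x + s *\<^sub>R v) \<le> f (x + 0 *\<^sub>R v)" if s: "0 < s" for s
    proof -
      have p: "\<pi> i (x + s *\<^sub>R v) = \<pi> i x + s *\<^sub>R v" using i' v by (simp add: proj_add proj_scale proj_id)
      have "v \<bullet> \<pi> i x \<ge> 0" using v proj_inner[OF i' v(1), of x] by (simp add: inner_commute)
      then have "\<pi> i x \<bullet> \<pi> i x \<le> (\<pi> i x + s *\<^sub>R v) \<bullet> (\<pi> i x + s *\<^sub>R v)"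
        using s by (simp add: inner_add_left inner_add_right inner_commute)
      then have "norm (\<pi> i x) \<le> norm (\<pi> i (x + s *\<^sub>R v))" unfolding p by (simp add: norm_le)
      moreover have "(x + s *\<^sub>R v) - x \<in> E i" using v subsp[OF i'] by (simp add: subspace_scale)
      ultimately show ?thesis using f i unfolding block_antimono_def by (metis add.right_neutral scaleR_zero_left)
    qed
  qed
  then show "0 \<le> - grad f x \<bullet> v" by simp
qed

lemma radial_at_scale: "radial_at p x \<Longrightarrow> 0 \<le> r \<Longrightarrow> radial_at (r *\<^sub>R p) x"
  by (simp add: radial_at_def)

end

text \<open>The square root avoids logarithms, so the condition makes sense for solutions known only
  to be nonnegative. With positivity and continuity it amounts to convexity of - ln f.\<close>

definition mid_logconcave :: "('a::real_vector \<Rightarrow> real) \<Rightarrow> bool" where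
  "mid_logconcave f \<longleftrightarrow> (\<forall>x y. sqrt (f x * f y) \<le> f ((1/2) *\<^sub>R (x + y)))"

context block_potential
begin

text \<open>The operator commutes with the reflection because U is invariant. At a maximum of the
  difference the first order conditions make the two drift terms equal; the second order conditions
  along the orthonormal basis of reflected vectors order the Laplacians.\<close>

lemma solution_refl_le:
  assumes sol: "bounded_solution U f u" and nonneg: "\<And>t x. 0 \<le> t \<Longrightarrow> 0 \<le> u t x" and van: "vanishing u"
    and i: "i \<in> {1..k}" and w: "w \<in> E i" and inv: "\<And>x. f (refl_along w x) = f x" and T: "0 \<le> T"
  shows "u T (refl_along w x) - u T x \<le> 0"
proof (rule parabolic_maximum_principle[where S = UNIV and \<Phi> = "\<lambda>t x. u t (refl_along w x) - u t x"])
  have ot: "orthogonal_transformation (refl_along w)" by (rule orthogonal_transformation_refl_along)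
  have lin: "linear (refl_along w)" using ot orthogonal_transformation_linear by blast
  have nrm: "norm (refl_along w x) = norm x" for x using ot by (simp add: orthogonal_transformation)
  show "continuous_on ({0..T} \<times> UNIV) (\<lambda>(t, s). u t (refl_along w s) - u t s)"
    using continuous_on_diff[OF sol_cont[OF sol linear_continuous_on[OF lin[unfolded linear_conv_bounded_linear], of UNIV], of T]
        sol_cont[OF sol continuous_on_id, of T UNIV]] by (simp add: case_prod_beta)
  show "u 0 (refl_along w s) - u 0 s \<le> 0" for s by (simp add: sol_init[OF sol] inv)
  show "\<exists>R. \<forall>t\<in>{0..T}. \<forall>s\<in>UNIV. norm s > R \<longrightarrow> u t (refl_along w s) - u t s \<le> \<eta>" if \<eta>: "\<eta> > 0" for \<eta>
  proof -
    obtain R where R: "\<forall>t\<in>{0..T}. \<forall>x. norm x > R \<longrightarrow> u t x \<le> \<eta>" using van \<eta> unfolding vanishing_def by blast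
    show ?thesis
    proof (intro exI[of _ R] ballI impI)
      fix t and s :: 'a assume t: "t \<in> {0..T}" and s: "norm s > R"
      have "u t (refl_along w s) \<le> \<eta>" using R t s by (simp add: nrm)
      moreover have "0 \<le> u t s" using nonneg t by simp
      ultimately show "u t (refl_along w s) - u t s \<le> \<eta>" by simp
    qed
  qed
  fix t x assume t: "0 < t" and mx: "\<And>y. y \<in> UNIV \<Longrightarrow> u t (refl_along w y) - u t y \<le> u t (refl_along w x) - u t x"
  let ?g = "refl_along w"
  have *: "grad (u t) (?g x) \<bullet> ?g v = grad (u t) x \<bullet> v" "hess (u t) (?g x) (?g v) \<le> hess (u t) x v" for v
  proof -
    let ?\<phi> = "\<lambda>s. u t (?g x + s *\<^sub>R ?g v) - u t (x + s *\<^sub>R v)"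
    let ?\<phi>' = "\<lambda>s. grad (u t) (?g x + s *\<^sub>R ?g v) \<bullet> ?g v - grad (u t) (x + s *\<^sub>R v) \<bullet> v"
    have D1: "(?\<phi> has_real_derivative ?\<phi>' s) (at s)" for s
      using t by (intro DERIV_diff sol_line[OF sol]) auto
    have D2: "(?\<phi>' has_real_derivative hess (u t) (?g x) (?g v) - hess (u t) x v) (at 0)"
      using t by (intro DERIV_diff sol_line2[OF sol]) auto
    have m: "?\<phi> s \<le> ?\<phi> 0" for s
      using mx[of "x + s *\<^sub>R v"] by (simp add: linear_add[OF lin] linear_scale[OF lin])
    from second_derivative_test[OF zero_less_one D1 D2 m]
    show "grad (u t) (?g x) \<bullet> ?g v = grad (u t) x \<bullet> v" "hess (u t) (?g x) (?g v) \<le> hess (u t) x v" by auto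
  qed
  have "grad U (?g x) = ?g (grad U x)"
  proof (rule vector_eq_ldot[THEN iffD1], intro allI)
    fix v
    have "grad U (?g x) \<bullet> ?g (?g v) = grad U x \<bullet> ?g v" by (rule grad_U_refl[OF i w])
    also have "\<dots> = ?g (grad U x) \<bullet> ?g (?g v)" using ot by (simp add: orthogonal_transformation_def)
    finally show "v \<bullet> grad U (?g x) = v \<bullet> ?g (grad U x)" by (simp add: refl_along_invol inner_commute)
  qed
  then have g: "grad (u t) (?g x) \<bullet> grad U (?g x) = grad (u t) x \<bullet> grad U x" using *(1) by simp
  have l: "lap (u t) (?g x) \<le> lap (u t) x"
    unfolding lap_eq_hess_orthogonal[OF ot, of "u t" "?g x"] lap_eq_hess[of "u t" x] by (intro sum_mono *(2))
  show "\<exists>d\<le>0. ((\<lambda>\<tau>. u \<tau> (?g x) - u \<tau> x) has_real_derivative d) (at t within {0..})"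
  proof (intro exI conjI)
    show "((\<lambda>\<tau>. u \<tau> (?g x) - u \<tau> x) has_real_derivative
       (lap (u t) (?g x) - grad (u t) (?g x) \<bullet> grad U (?g x)) - (lap (u t) x - grad (u t) x \<bullet> grad U x)) (at t within {0..})"
      unfolding at_within_atLeast[OF t] using t by (intro DERIV_diff sol_time[OF sol])
  qed (use l g in auto)
qed (use T in auto)

lemma solution_refl:
  assumes sol: "bounded_solution U f u" and nonneg: "\<And>t x. 0 \<le> t \<Longrightarrow> 0 \<le> u t x" and van: "vanishing u"
    and i: "i \<in> {1..k}" and w: "w \<in> E i" and inv: "\<And>x. f (refl_along w x) = f x" and T: "0 \<le> T"
  shows "u T (refl_along w x) = u T x"
  using solution_refl_le[OF assms, of x] solution_refl_le[OF assms, of "refl_along w x"]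
  by (simp add: refl_along_invol)

text \<open>The maximum principle for \<open>u x - u y\<close> on \<open>{(x, y). x - y \<in> E i \<and> |\<pi> i y| \<le> |\<pi> i x|}\<close>. On the boundary
  of this set the two points are reflections of each other.\<close>

lemma solution_block_antimono:
  assumes sol: "bounded_solution U f u" and nonneg: "\<And>t x. 0 \<le> t \<Longrightarrow> 0 \<le> u t x" and van: "vanishing u"
    and f: "block_antimono f" and T: "0 \<le> T"
  shows "block_antimono (u T)"
  unfolding block_antimono_def
proof (intro ballI allI impI)
  fix i x0 y0 assume i: "i \<in> {1..k}" and xy0: "x0 - y0 \<in> E i" "norm (\<pi> i y0) \<le> norm (\<pi> i x0)"
  have i': "i \<le> k" using i by auto
  define S where "S = {p. fst p - snd p \<in> E i \<and> norm (\<pi> i (snd p)) \<le> norm (\<pi> i (fst p))}"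
  have cp: "continuous_on A (\<lambda>x. \<pi> i (h x))" if "continuous_on A h" for h :: "'a \<times> 'a \<Rightarrow> 'a" and A
    using linear_proj[OF i'] that by (intro bounded_linear.continuous_on[of "Proj (E i)"]) (auto simp: linear_conv_bounded_linear)
  have "closed ({p. fst p - snd p \<in> E i} \<inter> {p. norm (\<pi> i (snd p)) \<le> norm (\<pi> i (fst p))})"
  proof (rule closed_Int)
    show "closed {p. fst p - snd p \<in> E i}"
      using closed_vimage[OF closed_subspace[OF subsp[OF i']], of "\<lambda>p. fst p - snd p"]
      by (simp add: vimage_def continuous_intros)
    show "closed {p. norm (\<pi> i (snd p)) \<le> norm (\<pi> i (fst p))}"
      by (intro closed_Collect_le continuous_intros cp)
  qed
  then have S: "closed S" by (simp add: S_def Collect_conj_eq)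
  have "u T (fst (x0, y0)) - u T (snd (x0, y0)) \<le> 0"
  proof (rule parabolic_maximum_principle[where \<Phi> = "\<lambda>t p. u t (fst p) - u t (snd p)", OF S T])
    show "(x0, y0) \<in> S" using xy0 by (simp add: S_def)
    show "continuous_on ({0..T} \<times> S) (\<lambda>(t, s). u t (fst s) - u t (snd s))"
      using continuous_on_diff[OF sol_cont[OF sol continuous_on_fst[OF continuous_on_id], of T S]
          sol_cont[OF sol continuous_on_snd[OF continuous_on_id], of T S]] by (simp add: case_prod_beta)
    show "u 0 (fst s) - u 0 (snd s) \<le> 0" if "s \<in> S" for s
      using that f i by (simp add: S_def sol_init[OF sol] block_antimono_def)
    show "\<exists>R. \<forall>t\<in>{0..T}. \<forall>s\<in>S. norm s > R \<longrightarrow> u t (fst s) - u t (snd s) \<le> \<eta>" if \<eta>: "\<eta> > 0" for \<eta>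
    proof -
      obtain R where R: "\<forall>t\<in>{0..T}. \<forall>x. norm x > R \<longrightarrow> u t x \<le> \<eta>" using van \<eta> unfolding vanishing_def by blast
      show ?thesis
      \<comment> \<open>On S the second point is no longer than the first, so a pair of norm above 2
        R has its first point beyond R. Only u at the first point must be small, since u at the
        second enters with a minus sign.\<close>
      proof (intro exI[of _ "2 * R"] ballI impI)
        fix t s assume t: "t \<in> {0..T}" and s: "s \<in> S" "norm s > 2 * R"
        have "norm (snd s) \<le> norm (fst s)" by (rule norm_le_block[OF i']) (use s in \<open>auto simp: S_def\<close>)
        moreover have "norm s \<le> norm (fst s) + norm (snd s)" using norm_Pair_le[of "fst s" "snd s"] by simp
        ultimately have "norm (fst s) > R" using s by simp
        then have "u t (fst s) \<le> \<eta>" using R t by simp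
        moreover have "0 \<le> u t (snd s)" using nonneg t by simp
        ultimately show "u t (fst s) - u t (snd s) \<le> \<eta>" by simp
      qed
    qed
    fix t s assume t: "0 < t" and s: "s \<in> S" and pos: "0 < u t (fst s) - u t (snd s)"
      and mx: "\<And>s'. s' \<in> S \<Longrightarrow> u t (fst s') - u t (snd s') \<le> u t (fst s) - u t (snd s)"
    obtain x y where xy: "s = (x, y)" by (cases s)
    have diff: "x - y \<in> E i" and le: "norm (\<pi> i y) \<le> norm (\<pi> i x)" using s by (auto simp: S_def xy)
    have "norm (\<pi> i y) \<noteq> norm (\<pi> i x)"
    proof
      assume eq: "norm (\<pi> i y) = norm (\<pi> i x)"
      have "y - x \<in> E i" using subspace_neg[OF subsp[OF i'] diff] by simp
      then have "norm x = norm y" using norm_le_block[OF i' diff] norm_le_block[OF i', of y x] eq by auto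
      then have "refl_along (x - y) x = y" by (rule refl_along_diff)
      moreover have "u t (refl_along (x - y) x) = u t x"
        by (rule solution_refl[OF sol nonneg van i diff block_antimono_refl[OF f i diff] less_imp_le[OF t]])
      ultimately show False using pos by (simp add: xy)
    qed
    then have gap: "norm (\<pi> i y) < norm (\<pi> i x)" using le by simp
    have *: "grad (u t) x \<bullet> v = grad (u t) y \<bullet> v'" "hess (u t) x v \<le> hess (u t) y v'" if vv: "v - v' \<in> E i" for v v'
    proof -
      let ?\<phi> = "\<lambda>s. u t (x + s *\<^sub>R v) - u t (y + s *\<^sub>R v')"
      let ?\<phi>' = "\<lambda>s. grad (u t) (x + s *\<^sub>R v) \<bullet> v - grad (u t) (y + s *\<^sub>R v') \<bullet> v'"
      have D1: "(?\<phi> has_real_derivative ?\<phi>' s) (at s)" for s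
        using t by (intro DERIV_diff sol_line[OF sol]) auto
      have D2: "(?\<phi>' has_real_derivative hess (u t) x v - hess (u t) y v') (at 0)"
        using t by (intro DERIV_diff sol_line2[OF sol]) auto
      \<comment> \<open>The maximum lies off the boundary of S, so for |s| < d the two norms cannot
        cross and the displaced pair stays in S. The summand 1 keeps the denominator positive when v
        = v' = 0.\<close>
      define d where "d = (norm (\<pi> i x) - norm (\<pi> i y)) / (norm v + norm v' + 1)"
      have den: "norm v + norm v' + 1 > 0" by (simp add: add_nonneg_pos)
      have d: "d > 0" using gap den by (simp add: d_def)
      have m: "?\<phi> s \<le> ?\<phi> 0" if s: "\<bar>s\<bar> < d" for s
      proof -
        have "\<bar>s\<bar> * (norm v + norm v' + 1) \<le> norm (\<pi> i x) - norm (\<pi> i y)"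
          using s den by (simp add: d_def pos_less_divide_eq)
        then have "\<bar>s\<bar> * norm v + \<bar>s\<bar> * norm v' \<le> norm (\<pi> i x) - norm (\<pi> i y)" by (simp add: algebra_simps)
        moreover have "norm (\<pi> i (x + s *\<^sub>R v)) \<ge> norm (\<pi> i x) - \<bar>s\<bar> * norm v"
        proof -
          have "norm (\<pi> i x) \<le> norm (\<pi> i (x + s *\<^sub>R v)) + norm (\<pi> i (s *\<^sub>R v))"
            using norm_triangle_sub[of "\<pi> i x" "\<pi> i (x + s *\<^sub>R v)"] i' by (simp add: proj_add norm_minus_commute)
          moreover have "norm (\<pi> i (s *\<^sub>R v)) \<le> \<bar>s\<bar> * norm v" using norm_proj_le[OF i', of "s *\<^sub>R v"] by simp
          ultimately show ?thesis by simp
        qed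
        moreover have "norm (\<pi> i (y + s *\<^sub>R v')) \<le> norm (\<pi> i y) + \<bar>s\<bar> * norm v'"
          using norm_triangle_ineq[of "\<pi> i y" "\<pi> i (s *\<^sub>R v')"] norm_proj_le[OF i', of "s *\<^sub>R v'"] i' by (simp add: proj_add)
        ultimately have "norm (\<pi> i (y + s *\<^sub>R v')) \<le> norm (\<pi> i (x + s *\<^sub>R v))" by linarith
        moreover have eq: "(x + s *\<^sub>R v) - (y + s *\<^sub>R v') = (x - y) + s *\<^sub>R (v - v')" by (simp add: algebra_simps)
        have "(x + s *\<^sub>R v) - (y + s *\<^sub>R v') \<in> E i"
          unfolding eq by (rule subspace_add[OF subsp[OF i'] diff subspace_scale[OF subsp[OF i'] vv]])
        ultimately show ?thesis using mx[of "(x + s *\<^sub>R v, y + s *\<^sub>R v')"] by (simp add: S_def xy)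
      qed
      from second_derivative_test[OF d D1 D2 m]
      show "grad (u t) x \<bullet> v = grad (u t) y \<bullet> v'" "hess (u t) x v \<le> hess (u t) y v'" by auto
    qed
    have 0: "0 \<in> E i" using subsp[OF i'] by (rule subspace_0)
    \<comment> \<open>Equal displacements v = v' give equal gradients and ordered Laplacians.
      Displacements v in \<open>E i\<close> with v' = 0 show that the common gradient is orthogonal
      to \<open>E i\<close>, so the drift terms agree although \<nabla>U x and \<nabla>U y may
      differ.\<close>
    have g: "grad (u t) x = grad (u t) y"
      by (rule vector_eq_ldot[THEN iffD1]) (use *(1)[of v v for v] 0 in \<open>auto simp: inner_commute\<close>)
    have gE: "grad (u t) x \<bullet> v = 0" if "v \<in> E i" for v using *(1)[of v 0] that by simp
    have gU: "grad U x \<bullet> grad (u t) x = grad U y \<bullet> grad (u t) x" by (rule grad_U_diff[OF i diff gE])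
    have l: "lap (u t) x \<le> lap (u t) y" unfolding lap_eq_hess using 0 by (intro sum_mono *(2)) auto
    show "\<exists>d\<le>0. ((\<lambda>\<tau>. u \<tau> (fst s) - u \<tau> (snd s)) has_real_derivative d) (at t within {0..})"
    proof (intro exI conjI)
      show "((\<lambda>\<tau>. u \<tau> (fst s) - u \<tau> (snd s)) has_real_derivative
         (lap (u t) x - grad (u t) x \<bullet> grad U x) - (lap (u t) y - grad (u t) y \<bullet> grad U y)) (at t within {0..})"
        unfolding at_within_atLeast[OF t] xy fst_conv snd_conv using t by (intro DERIV_diff sol_time[OF sol])
      show "(lap (u t) x - grad (u t) x \<bullet> grad U x) - (lap (u t) y - grad (u t) y \<bullet> grad U y) \<le> 0"
        using l gU g by (simp add: inner_commute)
    qed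
  qed
  then show "u T x0 \<le> u T y0" by simp
qed

text \<open>The geometric mean is homogeneous of degree one, so at
  a critical point the equation for \<open>sqrt (u x * u y) - u z\<close> has no zero-order term; comparing the
  drift terms is where \<open>\<rho>''' \<le> 0\<close> enters.\<close>

lemma solution_mid_logconcave:
  assumes sol: "bounded_solution U f u" and nonneg: "\<And>t x. 0 \<le> t \<Longrightarrow> 0 \<le> u t x" and van: "vanishing u"
    and anti: "\<And>t. 0 \<le> t \<Longrightarrow> block_antimono (u t)"
    and f: "mid_logconcave f" and T: "0 \<le> T"
  shows "mid_logconcave (u T)"
  unfolding mid_logconcave_def
proof (intro allI)
  fix x0 y0 :: 'a
  obtain B where B: "B > 0" "\<And>t x. t \<ge> 0 \<Longrightarrow> \<bar>u t x\<bar> \<le> B" using sol_bound[OF sol] by blast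
  define mid :: "'a \<times> 'a \<Rightarrow> 'a" where "mid p = (1/2) *\<^sub>R (fst p + snd p)" for p
  have "sqrt (u T (fst (x0, y0)) * u T (snd (x0, y0))) - u T (mid (x0, y0)) \<le> 0"
  proof (rule parabolic_maximum_principle[where S = UNIV and \<Phi> = "\<lambda>t p. sqrt (u t (fst p) * u t (snd p)) - u t (mid p)"])
    show "continuous_on ({0..T} \<times> UNIV) (\<lambda>(t, p). sqrt (u t (fst p) * u t (snd p)) - u t (mid p))"
    proof -
      have "continuous_on UNIV mid" unfolding mid_def by (intro continuous_intros)
      then show ?thesis
        using continuous_on_diff[OF continuous_on_real_sqrt[OF continuous_on_mult[OF sol_cont[OF sol continuous_on_fst[OF continuous_on_id], of T UNIV]
          sol_cont[OF sol continuous_on_snd[OF continuous_on_id], of T UNIV]]] sol_cont[OF sol, of UNIV mid T]] by (simp add: case_prod_beta)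
    qed
    show "sqrt (u 0 (fst s) * u 0 (snd s)) - u 0 (mid s) \<le> 0" for s
      using f by (simp add: sol_init[OF sol] mid_logconcave_def mid_def)
    show "\<exists>R. \<forall>t\<in>{0..T}. \<forall>s\<in>UNIV. norm s > R \<longrightarrow> sqrt (u t (fst s) * u t (snd s)) - u t (mid s) \<le> \<eta>" if \<eta>: "\<eta> > 0" for \<eta>
    proof -
      \<comment> \<open>If one of the two points is far away, its factor is at most \<eta>^2 / B and
        the other at most B, so the geometric mean is at most \<eta>.\<close>
      have "\<eta>^2 / B > 0" using \<eta> B by simp
      then obtain R where R: "\<forall>t\<in>{0..T}. \<forall>x. norm x > R \<longrightarrow> u t x \<le> \<eta>^2 / B" using van unfolding vanishing_def by blast
      show ?thesis
      proof (intro exI[of _ "2 * R"] ballI impI)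
        fix t and s :: "'a \<times> 'a" assume t: "t \<in> {0..T}" and s: "norm s > 2 * R"
        have t0: "t \<ge> 0" using t by simp
        have ub: "0 \<le> u t x" "u t x \<le> B" for x using nonneg[OF t0, of x] B(2)[OF t0, of x] by auto
        have "norm s \<le> norm (fst s) + norm (snd s)" using norm_Pair_le[of "fst s" "snd s"] by simp
        then have "norm (fst s) > R \<or> norm (snd s) > R" using s by linarith
        then have "u t (fst s) * u t (snd s) \<le> \<eta>^2"
        proof
          assume "norm (fst s) > R"
          then have "u t (fst s) \<le> \<eta>^2 / B" using R t by blast
          then have "u t (fst s) * u t (snd s) \<le> \<eta>^2 / B * B" using ub \<eta> B(1) by (intro mult_mono) auto
          then show ?thesis using B by simp
        next
          assume "norm (snd s) > R"
          then have "u t (snd s) \<le> \<eta>^2 / B" using R t by blast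
          then have "u t (fst s) * u t (snd s) \<le> B * (\<eta>^2 / B)" using ub B(1) by (intro mult_mono) auto
          then show ?thesis using B by simp
        qed
        then have "sqrt (u t (fst s) * u t (snd s)) \<le> \<eta>" using \<eta> by (intro real_le_lsqrt) auto
        then show "sqrt (u t (fst s) * u t (snd s)) - u t (mid s) \<le> \<eta>" using ub[of "mid s"] by simp
      qed
    qed
    fix t s assume t: "0 < t" and pos: "0 < sqrt (u t (fst s) * u t (snd s)) - u t (mid s)"
      and mx: "\<And>s'. s' \<in> UNIV \<Longrightarrow> sqrt (u t (fst s') * u t (snd s')) - u t (mid s') \<le> sqrt (u t (fst s) * u t (snd s)) - u t (mid s)"
    obtain x y where xy: "s = (x, y)" by (cases s)
    have t0: "t \<ge> 0" using t by simp
    define z where "z = mid (x, y)"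
    define \<alpha> \<beta> g where "\<alpha> = u t x" and "\<beta> = u t y" and "g = sqrt (\<alpha> * \<beta>)"
    have "g > 0" using pos nonneg[OF t0, of z] unfolding xy z_def g_def \<alpha>_def \<beta>_def fst_conv snd_conv by linarith
    then have g: "g > 0" "g * g = \<alpha> * \<beta>" and "\<alpha> * \<beta> > 0"
      by (auto simp: g_def real_sqrt_gt_0_iff)
    then have \<alpha>\<beta>: "\<alpha> > 0" "\<beta> > 0" using nonneg[OF t0, of x] nonneg[OF t0, of y]
      by (auto simp: \<alpha>_def \<beta>_def zero_less_mult_iff)
    \<comment> \<open>The points x and y move independently along v and v', the midpoint along their
      mean. Setting v' = 0 or v = 0 determines the gradients at all three points; setting v = v'
      compares the Hessians.\<close>
    have *: "(grad (u t) x \<bullet> v * \<beta> + \<alpha> * (grad (u t) y \<bullet> v')) / (2 * g) = grad (u t) z \<bullet> mid (v, v')"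
      "(hess (u t) x v * \<beta> + 2 * (grad (u t) x \<bullet> v) * (grad (u t) y \<bullet> v') + \<alpha> * hess (u t) y v') / (2 * g)
         - (grad (u t) x \<bullet> v * \<beta> + \<alpha> * (grad (u t) y \<bullet> v'))^2 / (4 * g^3) - hess (u t) z (mid (v, v')) \<le> 0" for v v'
    proof -
      let ?a = "\<lambda>s. u t (x + s *\<^sub>R v)" and ?b = "\<lambda>s. u t (y + s *\<^sub>R v')" and ?c = "\<lambda>s. u t (z + s *\<^sub>R mid (v, v'))"
      let ?a' = "\<lambda>s. grad (u t) (x + s *\<^sub>R v) \<bullet> v" and ?b' = "\<lambda>s. grad (u t) (y + s *\<^sub>R v') \<bullet> v'"
        and ?c' = "\<lambda>s. grad (u t) (z + s *\<^sub>R mid (v, v')) \<bullet> mid (v, v')"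
      let ?\<phi> = "\<lambda>s. sqrt (?a s * ?b s) - ?c s"
      let ?\<phi>' = "\<lambda>s. (?a' s * ?b s + ?a s * ?b' s) / (2 * sqrt (?a s * ?b s)) - ?c' s"
      have Da: "(?a has_real_derivative ?a' s) (at s)" and Db: "(?b has_real_derivative ?b' s) (at s)"
        and Dc: "(?c has_real_derivative ?c' s) (at s)" for s
        using t0 by (intro sol_line[OF sol]; simp)+
      have Da': "(?a' has_real_derivative hess (u t) x v) (at 0)" and Db': "(?b' has_real_derivative hess (u t) y v') (at 0)"
        and Dc': "(?c' has_real_derivative hess (u t) z (mid (v, v'))) (at 0)"
        using t0 by (intro sol_line2[OF sol]; simp)+
      have "isCont (\<lambda>s. min (?a s) (?b s)) 0" by (intro continuous_min DERIV_isCont[OF Da] DERIV_isCont[OF Db])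
      moreover have "0 < min (?a 0) (?b 0)" using \<alpha>\<beta> by (simp add: \<alpha>_def \<beta>_def)
      ultimately have "\<forall>\<^sub>F s in nhds 0. 0 < min (?a s) (?b s)"
        by (intro order_tendstoD(1)[of "\<lambda>s. min (?a s) (?b s)" "min (?a 0) (?b 0)"]) (auto simp: isCont_def tendsto_nhds_iff continuous_at)
      then obtain d where d: "d > 0" "\<And>s. \<bar>s\<bar> < d \<Longrightarrow> ?a s > 0 \<and> ?b s > 0"
        unfolding eventually_nhds_metric by (auto simp: dist_real_def)
      have D1: "(?\<phi> has_real_derivative ?\<phi>' s) (at s)" if "\<bar>s\<bar> < d" for s
      proof -
        have "?a s * ?b s > 0" using d(2)[OF that] by simp
        from DERIV_chain2[OF DERIV_real_sqrt[OF this] DERIV_mult[OF Da Db]]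
        have "((\<lambda>s. sqrt (?a s * ?b s)) has_real_derivative (?a' s * ?b s + ?a s * ?b' s) / (2 * sqrt (?a s * ?b s))) (at s)"
          by (simp add: field_simps)
        then show ?thesis by (intro DERIV_diff Dc)
      qed
      have D2: "(?\<phi>' has_real_derivative
         (hess (u t) x v * \<beta> + 2 * (grad (u t) x \<bullet> v) * (grad (u t) y \<bullet> v') + \<alpha> * hess (u t) y v') / (2 * g)
         - (grad (u t) x \<bullet> v * \<beta> + \<alpha> * (grad (u t) y \<bullet> v'))^2 / (4 * g^3) - hess (u t) z (mid (v, v'))) (at 0)"
      proof (intro DERIV_diff[OF _ Dc'])
        have N: "((\<lambda>s. ?a' s * ?b s + ?a s * ?b' s) has_real_derivative
            hess (u t) x v * \<beta> + 2 * (grad (u t) x \<bullet> v) * (grad (u t) y \<bullet> v') + \<alpha> * hess (u t) y v') (at 0)"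
          by (rule DERIV_cong[OF DERIV_add[OF DERIV_mult[OF Da' Db] DERIV_mult[OF Da Db']]]) (simp add: \<alpha>_def \<beta>_def)
        have "?a 0 * ?b 0 > 0" using \<alpha>\<beta> by (simp add: \<alpha>_def \<beta>_def)
        from DERIV_chain2[OF DERIV_real_sqrt[OF this] DERIV_mult[OF Da Db]]
        have "((\<lambda>s. sqrt (?a s * ?b s)) has_real_derivative (grad (u t) x \<bullet> v * \<beta> + \<alpha> * (grad (u t) y \<bullet> v')) / (2 * g)) (at 0)"
          by (simp add: \<alpha>_def \<beta>_def g_def field_simps)
        then have M: "((\<lambda>s. 2 * sqrt (?a s * ?b s)) has_real_derivative (grad (u t) x \<bullet> v * \<beta> + \<alpha> * (grad (u t) y \<bullet> v')) / g) (at 0)"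
          by (rule DERIV_cong[OF DERIV_cmult]) (simp only: times_divide_eq_right mult_divide_mult_cancel_left_if, simp)
        have g0: "2 * sqrt (?a 0 * ?b 0) = 2 * g" by (simp add: g_def \<alpha>_def \<beta>_def)
        then have ne: "2 * sqrt (?a 0 * ?b 0) \<noteq> 0" using g(1) by simp
        have f0: "?a' 0 * ?b 0 + ?a 0 * ?b' 0 = grad (u t) x \<bullet> v * \<beta> + \<alpha> * (grad (u t) y \<bullet> v')"
          by (simp add: \<alpha>_def \<beta>_def)
        have fr: "(N' * (2 * g) - N0 * (N0 / g)) / (2 * g * (2 * g)) = N' / (2 * g) - N0^2 / (4 * g^3)" for N' N0 :: real
          using g(1) by (simp add: field_simps power2_eq_square power3_eq_cube)
        show "((\<lambda>s. (?a' s * ?b s + ?a s * ?b' s) / (2 * sqrt (?a s * ?b s))) has_real_derivative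
          (hess (u t) x v * \<beta> + 2 * (grad (u t) x \<bullet> v) * (grad (u t) y \<bullet> v') + \<alpha> * hess (u t) y v') / (2 * g)
         - (grad (u t) x \<bullet> v * \<beta> + \<alpha> * (grad (u t) y \<bullet> v'))^2 / (4 * g^3)) (at 0)"
          by (rule DERIV_cong[OF DERIV_divide[OF N M ne]]) (simp only: g0 f0 fr)
      qed
      have m: "?\<phi> s \<le> ?\<phi> 0" for s
      proof -
        have "mid (x + s *\<^sub>R v, y + s *\<^sub>R v') = z + s *\<^sub>R mid (v, v')" by (simp add: mid_def z_def algebra_simps)
        then show ?thesis using mx[of "(x + s *\<^sub>R v, y + s *\<^sub>R v')"] by (simp add: xy z_def)
      qed
      from second_derivative_test[OF d(1) D1 D2 m]
      show "(grad (u t) x \<bullet> v * \<beta> + \<alpha> * (grad (u t) y \<bullet> v')) / (2 * g) = grad (u t) z \<bullet> mid (v, v')"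
        "(hess (u t) x v * \<beta> + 2 * (grad (u t) x \<bullet> v) * (grad (u t) y \<bullet> v') + \<alpha> * hess (u t) y v') / (2 * g)
         - (grad (u t) x \<bullet> v * \<beta> + \<alpha> * (grad (u t) y \<bullet> v'))^2 / (4 * g^3) - hess (u t) z (mid (v, v')) \<le> 0"
        by (auto simp: \<alpha>_def \<beta>_def g_def)
    qed
    define p where "p = (1 / \<alpha>) *\<^sub>R (- grad (u t) x)"
    have gx: "grad (u t) x = - (\<alpha> *\<^sub>R p)" using \<alpha>\<beta> by (simp add: p_def)
    have gz: "grad (u t) z = - (g *\<^sub>R p)"
    proof (rule vector_eq_ldot[THEN iffD1], intro allI)
      fix v
      have "(grad (u t) x \<bullet> v * \<beta>) / (2 * g) = (grad (u t) z \<bullet> v) / 2" using *(1)[of v 0] by (simp add: mid_def)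
      then have "grad (u t) z \<bullet> v = - (\<alpha> * \<beta> * (p \<bullet> v) / g)" using g(1) by (simp add: gx field_simps)
      also have "\<dots> = - g * (p \<bullet> v)" using g by (simp add: field_simps flip: g(2))
      finally show "v \<bullet> grad (u t) z = v \<bullet> - (g *\<^sub>R p)" by (simp add: inner_commute)
    qed
    have gy: "grad (u t) y = - (\<beta> *\<^sub>R p)"
    proof (rule vector_eq_ldot[THEN iffD1], intro allI)
      fix v
      have "(\<alpha> * (grad (u t) y \<bullet> v)) / (2 * g) = (grad (u t) z \<bullet> v) / 2" using *(1)[of 0 v] by (simp add: mid_def)
      then have "\<alpha> * (grad (u t) y \<bullet> v) = - (g * g * (p \<bullet> v))" using g(1) by (simp add: gz field_simps)
      then have "\<alpha> * (grad (u t) y \<bullet> v) = \<alpha> * - (\<beta> * (p \<bullet> v))" by (simp add: g(2))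
      then have "grad (u t) y \<bullet> v = - (\<beta> * (p \<bullet> v))" using \<alpha>\<beta> by (simp only: mult_cancel_left) auto
      then show "v \<bullet> grad (u t) y = v \<bullet> - (\<beta> *\<^sub>R p)" by (simp add: inner_commute)
    qed
    \<comment> \<open>The cross term of the product and the term from the second derivative of the
      square root both equal g (p \<bullet> v)^2 and cancel; no gradient term survives.\<close>
    have h: "(hess (u t) x v * \<beta> + \<alpha> * hess (u t) y v) / (2 * g) \<le> hess (u t) z v" for v
    proof -
      have "mid (v, v) = v" by (simp add: mid_def flip: scaleR_2)
      then have "(hess (u t) x v * \<beta> + 2 * (grad (u t) x \<bullet> v) * (grad (u t) y \<bullet> v) + \<alpha> * hess (u t) y v) / (2 * g)
         - (grad (u t) x \<bullet> v * \<beta> + \<alpha> * (grad (u t) y \<bullet> v))^2 / (4 * g^3) - hess (u t) z v \<le> 0"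
        using *(2)[of v v] by simp
      moreover have "2 * (grad (u t) x \<bullet> v) * (grad (u t) y \<bullet> v) = 2 * (g * g) * (p \<bullet> v)^2"
        by (simp add: gx gy g(2) power2_eq_square)
      moreover have "grad (u t) x \<bullet> v * \<beta> + \<alpha> * (grad (u t) y \<bullet> v) = - 2 * (g * g) * (p \<bullet> v)"
        by (simp add: gx gy g(2))
      ultimately have "(hess (u t) x v * \<beta> + 2 * (g * g) * (p \<bullet> v)^2 + \<alpha> * hess (u t) y v) / (2 * g)
         - (- 2 * (g * g) * (p \<bullet> v))^2 / (4 * g^3) - hess (u t) z v \<le> 0" by simp
      moreover have "(- 2 * (g * g) * (p \<bullet> v))^2 / (4 * g^3) = g * (p \<bullet> v)^2"
        using g(1) by (simp add: power2_eq_square power3_eq_cube)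
      moreover have "(hess (u t) x v * \<beta> + 2 * (g * g) * (p \<bullet> v)^2 + \<alpha> * hess (u t) y v) / (2 * g)
        = (hess (u t) x v * \<beta> + \<alpha> * hess (u t) y v) / (2 * g) + g * (p \<bullet> v)^2"
        using g(1) by (simp add: field_simps)
      ultimately show ?thesis by simp
    qed
    have l: "(lap (u t) x * \<beta> + \<alpha> * lap (u t) y) / (2 * g) \<le> lap (u t) z"
    proof -
      have "(lap (u t) x * \<beta> + \<alpha> * lap (u t) y) / (2 * g) = (\<Sum>b\<in>Basis. (hess (u t) x b * \<beta> + \<alpha> * hess (u t) y b) / (2 * g))"
        unfolding lap_eq_hess sum_distrib_left sum_distrib_right sum.distrib[symmetric] sum_divide_distrib ..
      also have "\<dots> \<le> lap (u t) z" unfolding lap_eq_hess by (intro sum_mono h)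
      finally show ?thesis .
    qed
    have dif: "u t differentiable (at w)" for w using C2D(1)[OF sol_C2[OF sol t0]] .
    \<comment> \<open>The gradients at x, y and z are negative multiples of the same p, so radial
      monotonicity at each of the three points applies to this one vector.\<close>
    have rx: "radial_at p x" unfolding p_def using \<alpha>\<beta> by (intro radial_at_scale block_antimono_radial anti t0 dif) auto
    have "p = (1 / \<beta>) *\<^sub>R (- grad (u t) y)" using \<alpha>\<beta> by (simp add: gy)
    then have ry: "radial_at p y" using \<alpha>\<beta> radial_at_scale[OF block_antimono_radial[OF anti[OF t0] dif], of "1 / \<beta>" y] by simp
    have "p = (1 / g) *\<^sub>R (- grad (u t) z)" using g by (simp add: gz)
    then have rz: "radial_at p z" using g radial_at_scale[OF block_antimono_radial[OF anti[OF t0] dif], of "1 / g" z] by simp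
    have drift: "grad U x \<bullet> p / 2 + grad U y \<bullet> p / 2 \<le> grad U z \<bullet> p"
      using grad_U_radial_midpoint[OF rx ry] rz by (simp add: z_def mid_def)
    show "\<exists>d\<le>0. ((\<lambda>\<tau>. sqrt (u \<tau> (fst s) * u \<tau> (snd s)) - u \<tau> (mid s)) has_real_derivative d) (at t within {0..})"
    proof (intro exI conjI)
      let ?ut = "\<lambda>x. lap (u t) x - grad (u t) x \<bullet> grad U x"
      have "0 < u t x * u t y" using \<alpha>\<beta> by (simp add: \<alpha>_def \<beta>_def)
      from DERIV_chain2[OF DERIV_real_sqrt[OF this] DERIV_mult[OF sol_time[OF sol t] sol_time[OF sol t]]]
      have "((\<lambda>\<tau>. sqrt (u \<tau> x * u \<tau> y)) has_real_derivative (?ut x * \<beta> + \<alpha> * ?ut y) / (2 * g)) (at t)"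
        by (simp add: \<alpha>_def \<beta>_def g_def field_simps)
      then show "((\<lambda>\<tau>. sqrt (u \<tau> (fst s) * u \<tau> (snd s)) - u \<tau> (mid s)) has_real_derivative
          (?ut x * \<beta> + \<alpha> * ?ut y) / (2 * g) - ?ut z) (at t within {0..})"
        unfolding at_within_atLeast[OF t] xy fst_conv snd_conv z_def[symmetric]
        by (intro DERIV_diff sol_time[OF sol t])
      have fld: "(X + g * g * (a + b)) / (2 * g) = X / (2 * g) + g * (a / 2 + b / 2)" for X a b :: real
        using g(1) by (simp add: field_simps)
      have "?ut x * \<beta> + \<alpha> * ?ut y = (lap (u t) x * \<beta> + \<alpha> * lap (u t) y) + (g * g) * (grad U x \<bullet> p + grad U y \<bullet> p)"
        by (simp add: gx gy g(2) algebra_simps inner_commute)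
      then have "(?ut x * \<beta> + \<alpha> * ?ut y) / (2 * g) = (lap (u t) x * \<beta> + \<alpha> * lap (u t) y) / (2 * g) + g * (grad U x \<bullet> p / 2 + grad U y \<bullet> p / 2)"
        by (simp only: fld)
      also have "\<dots> \<le> lap (u t) z + g * (grad U z \<bullet> p)"
        using l drift g(1) by (intro add_mono mult_left_mono) auto
      also have "\<dots> = ?ut z" by (simp add: gz inner_commute)
      finally show "(?ut x * \<beta> + \<alpha> * ?ut y) / (2 * g) - ?ut z \<le> 0" by simp
    qed
  qed (use T in auto)
  then show "sqrt (u T x0 * u T y0) \<le> u T ((1/2) *\<^sub>R (x0 + y0))" by (simp add: mid_def)
qed

end

section \<open>Positivity and limits\<close>

context block_potential
begin

text \<open>The subsolution is a bump \<open>exp (- \<beta> s) (r\<^sup>2 - |z - s v|\<^sup>2)\<^sub>+\<^sup>2\<close> moving with velocity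
  \<open>v = x / t\<close> from the origin to \<open>x\<close>.\<close>

lemma solution_lower_bound:
  fixes x :: 'a
  assumes \<delta>: "\<delta> > 0" and r: "r > 0" and t: "t > 0"
  obtains \<gamma> where "\<gamma> > 0"
    "\<And>f u. bounded_solution U f u \<Longrightarrow> (\<And>y. 0 \<le> f y) \<Longrightarrow> (\<And>y. norm y \<le> r \<Longrightarrow> \<delta> \<le> f y) \<Longrightarrow> \<gamma> \<le> u t x"
proof -
  define v where "v = (1 / t) *\<^sub>R x"
  define n where "n = real DIM('a)"
  \<comment> \<open>With p = (s, y), where y = z - s v, this collects the factor of q in the time
    derivative minus L applied to q^2, apart from the damping: the three terms come from the motion,
    the Laplacian and the drift.\<close>
  define h where "h p = 4 * (snd p \<bullet> v) + 4 * n - 4 * (snd p \<bullet> grad U (snd p + fst p *\<^sub>R v))" for p :: "real \<times> 'a"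
  have "continuous_on ({0..t} \<times> cball 0 r) h"
    unfolding h_def by (intro continuous_intros continuous_on_compose2[OF grad_U_cont]) auto
  then have "compact (h ` ({0..t} \<times> cball 0 r))" by (intro compact_continuous_image compact_Times) auto
  then have "bounded (h ` ({0..t} \<times> cball 0 r))" by (rule compact_imp_bounded)
  then obtain M0 where "\<forall>y\<in>h ` ({0..t} \<times> cball 0 r). norm y \<le> M0" unfolding bounded_iff ..
  then have M0: "\<bar>h p\<bar> \<le> M0" if "p \<in> {0..t} \<times> cball 0 r" for p using that by (cases p) auto
  define M where "M = \<bar>M0\<bar>"
  have M: "h p \<le> M" if "p \<in> {0..t} \<times> cball 0 r" for p using M0[OF that] by (simp add: M_def)
  \<comment> \<open>Chosen so that \<beta> Q^2 - (M + 8) Q + 8 r^2 is a perfect square. The term 8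
    r^2 remains positive at the edge Q = 0 of the bump, where the power 2 of q pays off.\<close>
  define \<beta> where "\<beta> = (M + 8)^2 / (32 * r^2)"
  \<comment> \<open>Fixed before f and u, so that one bound holds for a whole sequence of
    solutions.\<close>
  define \<gamma> where "\<gamma> = \<delta> * exp (- \<beta> * t)"
  define q where "q s z = r^2 - (z - s *\<^sub>R v) \<bullet> (z - s *\<^sub>R v)" for s and z :: 'a
  have qcont: "continuous_on A (\<lambda>p. q (fst p) (snd p))" for A unfolding q_def by (intro continuous_intros)
  have key: "- \<beta> * Q^2 + m * Q - 8 * (r^2 - Q) \<le> 0" if "Q > 0" "m \<le> M" for Q m
  proof -
    have "0 \<le> 8 * r^2 * (1 - (M + 8) * Q / (16 * r^2))^2" by simp
    also have "\<dots> = \<beta> * Q^2 - (M + 8) * Q + 8 * r^2"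
      using r by (simp add: \<beta>_def power2_eq_square field_simps)
    finally have "\<beta> * Q^2 - (M + 8) * Q + 8 * r^2 \<ge> 0" .
    moreover have "m * Q \<le> M * Q" using that by (intro mult_right_mono) auto
    ultimately show ?thesis by (simp add: algebra_simps)
  qed
  have "\<gamma> \<le> u t x"
    if sol: "bounded_solution U f u" and f0: "\<And>y. 0 \<le> f y" and f1: "\<And>y. norm y \<le> r \<Longrightarrow> \<delta> \<le> f y" for f u
  proof -
    have nonneg: "0 \<le> u s z" if "0 \<le> s" for s z by (rule solution_nonneg[OF sol f0 that])
    \<comment> \<open>The bump has height r^4 before scaling, so it starts at height \<delta>; at
      time t its centre is x and its height there is \<gamma>.\<close>
    define \<kappa>0 where "\<kappa>0 = \<delta> / r^4"
    define \<kappa> where "\<kappa> s = \<kappa>0 * exp (- \<beta> * s)" for s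
    have \<kappa>: "\<kappa> s > 0" for s using \<delta> r by (simp add: \<kappa>_def \<kappa>0_def)
    have "\<kappa> t * (max 0 (q t x))^2 - u t x \<le> 0"
    proof (rule parabolic_maximum_principle[where S = UNIV and \<Phi> = "\<lambda>s z. \<kappa> s * (max 0 (q s z))^2 - u s z"])
      show "continuous_on ({0..t} \<times> UNIV) (\<lambda>(s, z). \<kappa> s * (max 0 (q s z))^2 - u s z)"
      proof -
        have "continuous_on ({0..t} \<times> UNIV) (\<lambda>p. \<kappa> (fst p) * (max 0 (q (fst p) (snd p)))^2 - u (fst p) (snd p))"
          using sol_cont[OF sol continuous_on_id, of t UNIV] unfolding case_prod_beta \<kappa>_def
          by (intro continuous_intros continuous_on_max qcont)
        then show ?thesis by (simp add: case_prod_beta)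
      qed
      show "\<kappa> 0 * (max 0 (q 0 z))^2 - u 0 z \<le> 0" for z
      proof (cases "q 0 z > 0")
        case True
        then have "z \<bullet> z \<le> r^2" by (simp add: q_def)
        then have "(norm z)^2 \<le> r^2" by (simp add: power2_norm_eq_inner)
        then have "norm z \<le> r" using r by (simp add: power2_le_iff_abs_le)
        then have "\<delta> \<le> u 0 z" using f1 by (simp add: sol_init[OF sol])
        moreover have "(q 0 z)^2 \<le> (r^2)^2" using True by (intro power_mono) (auto simp: q_def)
        then have "\<kappa> 0 * (q 0 z)^2 \<le> \<kappa> 0 * (r^2)^2" using \<kappa>[of 0] by (intro mult_left_mono) auto
        then have "\<kappa> 0 * (q 0 z)^2 \<le> \<delta>" using r by (simp add: \<kappa>_def \<kappa>0_def flip: power_mult)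
        ultimately show ?thesis using True by simp
      qed (use f0 in \<open>simp add: sol_init[OF sol]\<close>)
      show "\<exists>R. \<forall>s\<in>{0..t}. \<forall>z\<in>UNIV. norm z > R \<longrightarrow> \<kappa> s * (max 0 (q s z))^2 - u s z \<le> \<eta>" if \<eta>: "\<eta> > 0" for \<eta>
      proof (intro exI[of _ "r + t * norm v"] ballI impI)
        fix s and z :: 'a assume s: "s \<in> {0..t}" and z: "norm z > r + t * norm v"
        have "norm z \<le> norm (z - s *\<^sub>R v) + s * norm v" using norm_triangle_sub[of z "s *\<^sub>R v"] s by simp
        moreover have "s * norm v \<le> t * norm v" using s by (intro mult_right_mono) auto
        ultimately have "r \<le> norm (z - s *\<^sub>R v)" using z by simp
        then have "r^2 \<le> (norm (z - s *\<^sub>R v))^2" using r by (intro power_mono) auto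
        then have "q s z \<le> 0" by (simp add: q_def power2_norm_eq_inner)
        then show "\<kappa> s * (max 0 (q s z))^2 - u s z \<le> \<eta>" using nonneg[of s z] s \<eta> by simp
      qed
      fix s z assume s: "0 < s" "s \<le> t" and pos: "0 < \<kappa> s * (max 0 (q s z))^2 - u s z"
        and mx: "\<And>z'. z' \<in> UNIV \<Longrightarrow> \<kappa> s * (max 0 (q s z'))^2 - u s z' \<le> \<kappa> s * (max 0 (q s z))^2 - u s z"
      define y where "y = z - s *\<^sub>R v"
      define Q where "Q = q s z"
      have Q: "Q > 0"
      proof (rule ccontr)
        assume "\<not> Q > 0"
        then have "max 0 (q s z) = 0" by (simp add: Q_def)
        then show False using pos nonneg[of s z] s by simp
      qed
      have Qy: "Q = r^2 - y \<bullet> y" by (simp add: Q_def q_def y_def)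
      then have "(norm y)^2 \<le> r^2" using Q by (simp add: power2_norm_eq_inner)
      then have yr: "norm y \<le> r" using r by (simp add: power2_le_iff_abs_le)
      have *: "grad (u s) z \<bullet> b = - 4 * \<kappa> s * Q * (y \<bullet> b)"
        "\<kappa> s * (8 * (y \<bullet> b)^2 - 4 * Q * (b \<bullet> b)) \<le> hess (u s) z b" for b
      proof -
        have Dq: "((\<lambda>\<tau>. q s (z + \<tau> *\<^sub>R b)) has_real_derivative - 2 * ((y + \<tau> *\<^sub>R b) \<bullet> b)) (at \<tau>)" for \<tau>
        proof -
          have "(\<lambda>\<tau>. q s (z + \<tau> *\<^sub>R b)) = (\<lambda>\<tau>. r^2 - y \<bullet> y - 2 * \<tau> * (y \<bullet> b) - \<tau>^2 * (b \<bullet> b))"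
          proof
            fix \<tau>
            have "z + \<tau> *\<^sub>R b - s *\<^sub>R v = y + \<tau> *\<^sub>R b" by (simp add: y_def)
            then show "q s (z + \<tau> *\<^sub>R b) = r^2 - y \<bullet> y - 2 * \<tau> * (y \<bullet> b) - \<tau>^2 * (b \<bullet> b)"
              by (simp add: q_def inner_add_left inner_add_right inner_commute algebra_simps power2_eq_square)
          qed
          then show ?thesis by (auto intro!: derivative_eq_intros simp: inner_add_left algebra_simps)
        qed
        have "isCont (\<lambda>\<tau>. q s (z + \<tau> *\<^sub>R b)) 0" by (rule DERIV_isCont[OF Dq])
        then have "\<forall>\<^sub>F \<tau> in nhds 0. 0 < q s (z + \<tau> *\<^sub>R b)"
          using Q by (intro order_tendstoD(1)[of "\<lambda>\<tau>. q s (z + \<tau> *\<^sub>R b)" "q s (z + 0 *\<^sub>R b)"]) (auto simp: isCont_def tendsto_nhds_iff Q_def)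
        then obtain d where d: "d > 0" "\<And>\<tau>. \<bar>\<tau>\<bar> < d \<Longrightarrow> 0 < q s (z + \<tau> *\<^sub>R b)"
          unfolding eventually_nhds_metric by (auto simp: dist_real_def)
        let ?\<phi> = "\<lambda>\<tau>. \<kappa> s * (q s (z + \<tau> *\<^sub>R b))^2 - u s (z + \<tau> *\<^sub>R b)"
        let ?\<phi>' = "\<lambda>\<tau>. \<kappa> s * (q s (z + \<tau> *\<^sub>R b) * (- 4 * ((y + \<tau> *\<^sub>R b) \<bullet> b))) - grad (u s) (z + \<tau> *\<^sub>R b) \<bullet> b"
        have D1: "(?\<phi> has_real_derivative ?\<phi>' \<tau>) (at \<tau>)" for \<tau>
          using s by (auto intro!: derivative_eq_intros sol_line[OF sol] Dq)
        have Di: "((\<lambda>\<tau>. (y + \<tau> *\<^sub>R b) \<bullet> b) has_real_derivative b \<bullet> b) (at 0)"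
          by (auto simp: inner_add_left intro!: derivative_eq_intros)
        have Dq0: "((\<lambda>\<tau>. q s (z + \<tau> *\<^sub>R b)) has_real_derivative - 2 * (y \<bullet> b)) (at 0)"
          using Dq[of 0] by simp
        have D2: "(?\<phi>' has_real_derivative \<kappa> s * (8 * (y \<bullet> b)^2 - 4 * Q * (b \<bullet> b)) - hess (u s) z b) (at 0)"
          using s by (auto intro!: derivative_eq_intros sol_line2[OF sol] Dq0 Di simp: Q_def power2_eq_square algebra_simps)
        have m: "?\<phi> \<tau> \<le> ?\<phi> 0" if "\<bar>\<tau>\<bar> < d" for \<tau>
          using mx[of "z + \<tau> *\<^sub>R b"] d(2)[OF that] Q by (simp add: Q_def)
        from second_derivative_test[OF d(1) D1 D2 m]
        show "grad (u s) z \<bullet> b = - 4 * \<kappa> s * Q * (y \<bullet> b)"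
          "\<kappa> s * (8 * (y \<bullet> b)^2 - 4 * Q * (b \<bullet> b)) \<le> hess (u s) z b"
          by (auto simp: Q_def algebra_simps)
      qed
      have "\<kappa> s * (8 * (y \<bullet> y) - 4 * n * Q) = (\<Sum>b\<in>Basis. \<kappa> s * 8 * ((y \<bullet> b) * (y \<bullet> b)) - \<kappa> s * 4 * Q)"
        unfolding sum_subtractf sum_distrib_left[symmetric] euclidean_inner[symmetric]
        by (simp add: n_def algebra_simps)
      also have "\<dots> = (\<Sum>b\<in>Basis. \<kappa> s * (8 * (y \<bullet> b)^2 - 4 * Q * (b \<bullet> b)))"
        by (intro sum.cong refl) (simp add: power2_eq_square algebra_simps)
      also have "\<dots> \<le> lap (u s) z" unfolding lap_eq_hess by (intro sum_mono *(2))
      finally have l: "\<kappa> s * (8 * (y \<bullet> y) - 4 * n * Q) \<le> lap (u s) z" .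
      have hy: "h (s, y) \<le> M" using s yr by (intro M) auto
      have zy: "y + s *\<^sub>R v = z" by (simp add: y_def)
      show "\<exists>d\<le>0. ((\<lambda>\<tau>. \<kappa> \<tau> * (max 0 (q \<tau> z))^2 - u \<tau> z) has_real_derivative d) (at s within {0..})"
      proof (intro exI conjI)
        have "((\<lambda>\<tau>. q \<tau> z) has_real_derivative 2 * (y \<bullet> v)) (at s)"
        proof -
          have "(\<lambda>\<tau>. q \<tau> z) = (\<lambda>\<tau>. r^2 - z \<bullet> z + 2 * \<tau> * (z \<bullet> v) - \<tau>^2 * (v \<bullet> v))"
            by (auto simp: q_def inner_diff_left inner_diff_right inner_commute algebra_simps power2_eq_square)
          then show ?thesis by (auto intro!: derivative_eq_intros simp: y_def inner_diff_left algebra_simps)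
        qed
        then have "((\<lambda>\<tau>. \<kappa> \<tau> * (q \<tau> z)^2) has_real_derivative \<kappa> s * (- \<beta> * Q^2 + 4 * Q * (y \<bullet> v))) (at s)"
          unfolding \<kappa>_def by (auto intro!: derivative_eq_intros simp: Q_def algebra_simps)
        moreover have "open {\<tau>. 0 < q \<tau> z}" unfolding q_def by (intro open_Collect_less continuous_intros)
        ultimately have "((\<lambda>\<tau>. \<kappa> \<tau> * (max 0 (q \<tau> z))^2) has_real_derivative \<kappa> s * (- \<beta> * Q^2 + 4 * Q * (y \<bullet> v))) (at s)"
          by (rule has_field_derivative_transform_within_open) (use Q in \<open>auto simp: Q_def\<close>)
        then show "((\<lambda>\<tau>. \<kappa> \<tau> * (max 0 (q \<tau> z))^2 - u \<tau> z) has_real_derivative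
            \<kappa> s * (- \<beta> * Q^2 + 4 * Q * (y \<bullet> v)) - (lap (u s) z - grad (u s) z \<bullet> grad U z)) (at s within {0..})"
          unfolding at_within_atLeast[OF s(1)] by (intro DERIV_diff sol_time[OF sol s(1)])
        have "\<kappa> s * (- \<beta> * Q^2 + 4 * Q * (y \<bullet> v)) - (lap (u s) z - grad (u s) z \<bullet> grad U z)
          \<le> \<kappa> s * (- \<beta> * Q^2 + 4 * Q * (y \<bullet> v)) - (\<kappa> s * (8 * (y \<bullet> y) - 4 * n * Q) + 4 * \<kappa> s * Q * (y \<bullet> grad U z))"
          using l *(1)[of "grad U z"] by simp
        also have "\<dots> = \<kappa> s * (- \<beta> * Q^2 + h (s, y) * Q - 8 * (r^2 - Q))"
          by (simp add: h_def zy Qy algebra_simps)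
        also have "\<dots> \<le> 0" using key[OF Q hy] \<kappa>[of s] by (intro mult_nonneg_nonpos) auto
        finally show "\<kappa> s * (- \<beta> * Q^2 + 4 * Q * (y \<bullet> v)) - (lap (u s) z - grad (u s) z \<bullet> grad U z) \<le> 0" .
      qed
    qed (use t in auto)
    moreover have "q t x = r^2" using t by (simp add: q_def v_def)
    ultimately have "\<kappa> t * (r^2)^2 \<le> u t x" by simp
    then show ?thesis using r by (simp add: \<kappa>_def \<kappa>0_def \<gamma>_def flip: power_mult)
  qed
  moreover have "\<gamma> > 0" using \<delta> by (simp add: \<gamma>_def)
  ultimately show ?thesis using that by blast
qed

end

text \<open>After subtraction of the chord, g is midpoint convex and vanishes at both ends. A
  positive maximum would be attained at a leftmost interior point; the midpoint inequality around
  that point yields a maximum further to the left.\<close>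

lemma midpoint_convex_imp_convex:
  fixes w :: "'a::real_normed_vector \<Rightarrow> real"
  assumes mid: "\<And>x y. w ((1/2) *\<^sub>R (x + y)) \<le> w x / 2 + w y / 2" and cont: "continuous_on UNIV w"
  shows "convex_on UNIV w"
proof (rule convex_onI)
  fix \<tau> :: real and x y :: 'a assume \<tau>: "0 < \<tau>" "\<tau> < 1"
  define g where "g s = w ((1 - s) *\<^sub>R x + s *\<^sub>R y) - ((1 - s) * w x + s * w y)" for s
  have gcont: "continuous_on {0..1} g" unfolding g_def by (intro continuous_intros continuous_on_compose2[OF cont]) auto
  have gmid: "g ((a + b) / 2) \<le> g a / 2 + g b / 2" for a b
  proof -
    have "(1 - (a + b) / 2) *\<^sub>R x + ((a + b) / 2) *\<^sub>R y = (1/2) *\<^sub>R (((1 - a) *\<^sub>R x + a *\<^sub>R y) + ((1 - b) *\<^sub>R x + b *\<^sub>R y))"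
      by (simp add: algebra_simps flip: scaleR_add_left)
    then have "w ((1 - (a + b) / 2) *\<^sub>R x + ((a + b) / 2) *\<^sub>R y) \<le> w ((1 - a) *\<^sub>R x + a *\<^sub>R y) / 2 + w ((1 - b) *\<^sub>R x + b *\<^sub>R y) / 2"
      using mid by simp
    then show ?thesis by (simp add: g_def field_simps)
  qed
  have ends: "g 0 = 0" "g 1 = 0" by (auto simp: g_def)
  have "g \<tau> \<le> 0"
  proof (rule ccontr)
    assume pos: "\<not> g \<tau> \<le> 0"
    obtain m where m: "m \<in> {0..1}" "\<And>s. s \<in> {0..1} \<Longrightarrow> g s \<le> g m"
      using continuous_attains_sup[OF _ _ gcont] by auto
    define Z where "Z = {s \<in> {0..1}. g s = g m}"
    have "closed Z" unfolding Z_def by (intro continuous_closed_preimage_constant[OF gcont]) auto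
    moreover have "m \<in> Z" using m by (simp add: Z_def)
    moreover have bdd: "bdd_below Z" by (auto simp: Z_def intro!: bdd_belowI[of _ 0])
    ultimately have a: "Inf Z \<in> Z" by (intro closed_contains_Inf) auto
    define a where "a = Inf Z"
    have ga: "g a = g m" "a \<in> {0..1}" using a by (auto simp: a_def Z_def)
    have "g m > 0" using pos m(2)[of \<tau>] \<tau> by auto
    then have "a \<noteq> 0" "a \<noteq> 1" using ga ends by auto
    then have a01: "0 < a" "a < 1" using ga by auto
    define d where "d = min a (1 - a)"
    have d: "d > 0" "a - d \<in> {0..1}" "a + d \<in> {0..1}" using a01 by (auto simp: d_def)
    have "g m \<le> g (a - d) / 2 + g (a + d) / 2" using gmid[of "a - d" "a + d"] ga by simp
    then have "g (a - d) = g m" using m(2)[OF d(2)] m(2)[OF d(3)] by simp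
    then have "a - d \<in> Z" using d by (simp add: Z_def)
    then have "a \<le> a - d" unfolding a_def by (intro cInf_lower bdd) (simp add: a_def)
    then show False using d by simp
  qed
  then show "w ((1 - \<tau>) *\<^sub>R x + \<tau> *\<^sub>R y) \<le> (1 - \<tau>) * w x + \<tau> * w y" by (simp add: g_def)
qed simp

text \<open>W is the pointwise limsup, convex because convexity passes to suprema of tails and to
  their decreasing limit. The sequence is bounded below at x since d is the midpoint of x and 2 d -
  x: a bound above at the reflected point and convergence at d prevent a drop to minus
  infinity.\<close>

lemma convex_limit_extension:
  fixes w :: "nat \<Rightarrow> 'a::real_normed_vector \<Rightarrow> real"
  assumes conv: "\<And>m. convex_on UNIV (w m)" and up: "\<And>x. \<exists>B. \<forall>m. w m x \<le> B"
    and d: "(\<lambda>m. w m d) \<longlonglongrightarrow> l"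
  obtains W where "convex_on UNIV W" "\<And>x l'. (\<lambda>m. w m x) \<longlonglongrightarrow> l' \<Longrightarrow> W x = l'"
proof -
  have bd: "\<exists>B. \<forall>m. \<bar>w m x\<bar> \<le> B" for x
  proof -
    obtain B where B: "\<And>m. w m x \<le> B" using up by blast
    obtain B' where B': "\<And>m. w m (2 *\<^sub>R d - x) \<le> B'" using up by blast
    have "Bseq (\<lambda>m. w m d)" using d by (intro convergent_imp_Bseq convergentI)
    then obtain L where L: "\<And>m. \<bar>w m d\<bar> \<le> L" by (auto simp: Bseq_def)
    have "w m x \<ge> - 2 * L - B'" for m
    proof -
      have "w m ((1 - 1/2) *\<^sub>R x + (1/2) *\<^sub>R (2 *\<^sub>R d - x)) \<le> (1 - 1/2) * w m x + (1/2) * w m (2 *\<^sub>R d - x)"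
        by (intro convex_onD[OF conv]) auto
      moreover have "(1 - 1/2) *\<^sub>R x + (1/2) *\<^sub>R (2 *\<^sub>R d - x) = d" by (simp add: algebra_simps)
      ultimately show ?thesis using B'[of m] L[of m] by simp
    qed
    then have "\<bar>w m x\<bar> \<le> \<bar>B\<bar> + 2 * \<bar>L\<bar> + \<bar>B'\<bar>" for m
      using B[of m] by (smt (verit))
    then show ?thesis by blast
  qed
  define S where "S x m = (SUP j\<in>{m..}. w j x)" for x m
  define W where "W x = (INF m. S x m)" for x
  have ba: "bdd_above ((\<lambda>j. w j x) ` A)" for x A
  proof -
    obtain B where "\<forall>m. \<bar>w m x\<bar> \<le> B" using bd by blast
    then show ?thesis by (intro bdd_aboveI2[where M = B]) (auto simp: abs_le_iff)
  qed
  have S_ge: "w j x \<le> S x m" if "j \<ge> m" for j x m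
    unfolding S_def using that by (intro cSUP_upper ba) auto
  have S_le: "S x m \<le> K" if "\<And>j. j \<ge> m \<Longrightarrow> w j x \<le> K" for x m K
    unfolding S_def using that by (intro cSUP_least) auto
  have bb: "bdd_below (range (S x))" for x
  proof -
    obtain B where "\<forall>m. \<bar>w m x\<bar> \<le> B" using bd by blast
    then have "- B \<le> w m x" for m by (simp add: abs_le_iff minus_le_iff)
    then have "- B \<le> S x m" for m using S_ge[of m m x] order_trans by blast
    then show ?thesis by (intro bdd_belowI2[where m = "-B"]) auto
  qed
  have W_le: "W x \<le> S x m" for x m unfolding W_def by (intro cINF_lower bb) auto
  have W_ge: "K \<le> W x" if "\<And>m. K \<le> S x m" for x K unfolding W_def using that by (intro cINF_greatest) auto
  have W_ex: "\<exists>m. \<forall>j\<ge>m. w j x < W x + e" if "e > 0" for x e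
  proof -
    have "\<exists>m. S x m < W x + e" using that bb[of x] unfolding W_def by (subst cINF_less_iff[symmetric, of "UNIV", simplified]) auto
    then show ?thesis using S_ge by (meson le_less_trans)
  qed
  have "convex_on UNIV W"
  proof (rule convex_onI)
    fix \<tau> :: real and x y :: 'a assume \<tau>: "0 < \<tau>" "\<tau> < 1"
    show "W ((1 - \<tau>) *\<^sub>R x + \<tau> *\<^sub>R y) \<le> (1 - \<tau>) * W x + \<tau> * W y"
    proof (rule field_le_epsilon)
      fix e :: real assume e: "e > 0"
      obtain m1 m2 where m: "\<forall>j\<ge>m1. w j x < W x + e" "\<forall>j\<ge>m2. w j y < W y + e" using W_ex[OF e] by blast
      have "W ((1 - \<tau>) *\<^sub>R x + \<tau> *\<^sub>R y) \<le> S ((1 - \<tau>) *\<^sub>R x + \<tau> *\<^sub>R y) (max m1 m2)" by (rule W_le)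
      also have "\<dots> \<le> (1 - \<tau>) * W x + \<tau> * W y + e"
      proof (rule S_le)
        fix j assume j: "j \<ge> max m1 m2"
        have "w j ((1 - \<tau>) *\<^sub>R x + \<tau> *\<^sub>R y) \<le> (1 - \<tau>) * w j x + \<tau> * w j y"
          using \<tau> by (intro convex_onD[OF conv]) auto
        also have "\<dots> \<le> (1 - \<tau>) * (W x + e) + \<tau> * (W y + e)"
          using m j \<tau> by (intro add_mono mult_left_mono) (auto intro: less_imp_le)
        also have "\<dots> = (1 - \<tau>) * W x + \<tau> * W y + e" by (simp add: algebra_simps)
        finally show "w j ((1 - \<tau>) *\<^sub>R x + \<tau> *\<^sub>R y) \<le> (1 - \<tau>) * W x + \<tau> * W y + e" .
      qed
      finally show "W ((1 - \<tau>) *\<^sub>R x + \<tau> *\<^sub>R y) \<le> (1 - \<tau>) * W x + \<tau> * W y + e" .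
    qed
  qed simp
  moreover have "W x = l'" if l': "(\<lambda>m. w m x) \<longlonglongrightarrow> l'" for x l'
  proof (rule antisym)
    show "W x \<le> l'"
    proof (rule field_le_epsilon)
      fix e :: real assume "e > 0"
      then obtain m where "\<forall>j\<ge>m. dist (w j x) l' < e" using l' unfolding lim_sequentially by blast
      then have "S x m \<le> l' + e" by (intro S_le) (auto simp: dist_real_def abs_less_iff intro: less_imp_le)
      then show "W x \<le> l' + e" using W_le[of x m] by simp
    qed
    show "l' \<le> W x"
    proof (rule W_ge)
      fix m
      show "l' \<le> S x m" by (rule LIMSEQ_le_const2[OF l']) (auto intro: S_ge)
    qed
  qed
  ultimately show ?thesis using that by blast
qed

section \<open>Smooth functions and tangent planes\<close>

lemma C_m_SucI:
  assumes "\<And>x. (f has_derivative f' x) (at x)" "\<And>b. b \<in> Basis \<Longrightarrow> C_m m (\<lambda>x. f' x b)"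
  shows "C_m (Suc m) f"
proof -
  have "partial_deriv b f = (\<lambda>x. f' x b)" for b
    using partial_deriv_unique[OF assms(1)] by auto
  then show ?thesis using assms by (auto simp: C_m_def differentiable_def)
qed

lemma C_m_SucD:
  assumes "C_m (Suc m) f"
  shows "(f has_derivative (\<lambda>v. grad f x \<bullet> v)) (at x)" "b \<in> Basis \<Longrightarrow> C_m m (\<lambda>x. grad f x \<bullet> b)"
  using assms by (auto simp: C_m_def grad_inner_Basis intro!: has_derivative_grad)

lemma C_m_0: "C_m 0 f \<longleftrightarrow> continuous_on UNIV f"
  by (simp add: C_m_def)

lemma C_m_Suc_imp: "C_m (Suc m) f \<Longrightarrow> C_m m f"
proof (induction m arbitrary: f)
  case 0
  then show ?case
    using C_m_SucD(1)[OF 0] by (auto simp: C_m_0 continuous_on_eq_continuous_at intro: has_derivative_continuous)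
next
  case (Suc m)
  show ?case using C_m_SucD[OF Suc.prems] Suc.IH by (intro C_m_SucI) blast+
qed

lemma C_m_const: "C_m m (\<lambda>x. c)"
proof (induction m arbitrary: c)
  case (Suc m)
  then show ?case by (intro C_m_SucI[where f' = "\<lambda>x v. 0"]) auto
qed (simp add: C_m_0)

lemma C_m_linear:
  assumes "bounded_linear f" shows "C_m m f"
proof (cases m)
  case (Suc m')
  then show ?thesis using bounded_linear_imp_has_derivative[OF assms]
    by (auto intro!: C_m_SucI C_m_const)
qed (use assms in \<open>auto simp: C_m_0 linear_continuous_on\<close>)

lemma C_m_add: "C_m m f \<Longrightarrow> C_m m g \<Longrightarrow> C_m m (\<lambda>x. f x + g x)"
proof (induction m arbitrary: f g)
  case (Suc m)
  show ?case
    by (rule C_m_SucI, rule has_derivative_add[OF C_m_SucD(1)[OF Suc.prems(1)] C_m_SucD(1)[OF Suc.prems(2)]])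
      (intro Suc.IH C_m_SucD(2)[OF Suc.prems(1)] C_m_SucD(2)[OF Suc.prems(2)])
qed (simp add: C_m_0 continuous_on_add)

lemma C_m_mult: "C_m m f \<Longrightarrow> C_m m g \<Longrightarrow> C_m m (\<lambda>x. f x * g x)"
proof (induction m arbitrary: f g)
  case (Suc m)
  show ?case
    by (rule C_m_SucI, rule has_derivative_mult[OF C_m_SucD(1)[OF Suc.prems(1)] C_m_SucD(1)[OF Suc.prems(2)]])
      (intro C_m_add Suc.IH C_m_SucD(2)[OF Suc.prems(1)] C_m_SucD(2)[OF Suc.prems(2)] C_m_Suc_imp[OF Suc.prems(1)] C_m_Suc_imp[OF Suc.prems(2)])
qed (simp add: C_m_0 continuous_on_mult)

lemma C_m_sum: "(\<And>i. i \<in> I \<Longrightarrow> C_m m (f i)) \<Longrightarrow> C_m m (\<lambda>x. \<Sum>i\<in>I. f i x)"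
  by (induction I rule: infinite_finite_induct) (auto intro: C_m_const C_m_add)

lemma C_m_exp: "C_m m f \<Longrightarrow> C_m m (\<lambda>x. exp (f x))"
proof (induction m arbitrary: f)
  case (Suc m)
  show ?case
    by (rule C_m_SucI, rule has_derivative_exp[OF C_m_SucD(1)[OF Suc.prems]])
      (intro C_m_mult Suc.IH C_m_SucD(2)[OF Suc.prems] C_m_Suc_imp[OF Suc.prems])
qed (simp add: C_m_0 continuous_on_exp)

text \<open>The derivative of a power contains the power with exponent a - 1, so the induction
  generalises over a while f stays fixed.\<close>

lemma C_m_powr:
  assumes "\<And>x. 0 < f x"
  shows "C_m m f \<Longrightarrow> C_m m (\<lambda>x. f x powr a)"
proof (induction m arbitrary: a)
  case 0
  then show ?case using assms by (auto simp: C_m_0 less_imp_neq[THEN not_sym] intro!: continuous_on_powr continuous_on_const)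
next
  case (Suc m)
  show ?case
  proof (rule C_m_SucI)
    have "((\<lambda>x. f x powr a) has_derivative (\<lambda>v. f x powr a * (0 * ln (f x) + (grad f x \<bullet> v) * a / f x))) (at x)" for x
      by (rule has_derivative_powr[OF C_m_SucD(1)[OF Suc.prems] has_derivative_const]) (use assms in auto)
    moreover have "f x powr a * (0 * ln (f x) + y * a / f x) = a * (f x powr (a - 1) * y)" for x y
      using assms[of x] by (simp add: powr_diff field_simps)
    ultimately show "((\<lambda>x. f x powr a) has_derivative (\<lambda>v. a * (f x powr (a - 1) * (grad f x \<bullet> v)))) (at x)" for x
      by simp
    show "C_m m (\<lambda>x. a * (f x powr (a - 1) * (grad f x \<bullet> b)))" if "b \<in> Basis" for b
      by (intro C_m_mult C_m_const Suc.IH C_m_Suc_imp[OF Suc.prems] C_m_SucD(2)[OF Suc.prems that])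
  qed
qed

lemma C_m_sqrt:
  assumes "\<And>x. 0 < f x" "C_m m f"
  shows "C_m m (\<lambda>x. sqrt (f x))"
  using C_m_powr[OF assms, of "1/2"] assms(1) by (simp add: powr_half_sqrt less_imp_le)

lemma C_m_norm_sq:
  fixes g :: "'a::euclidean_space \<Rightarrow> 'b::euclidean_space"
  assumes "linear g"
  shows "C_m m (\<lambda>x. (norm (g x))\<^sup>2)"
proof -
  have "(norm (g x))\<^sup>2 = (\<Sum>b\<in>Basis. (g x \<bullet> b) * (g x \<bullet> b))" for x
    unfolding power2_norm_eq_inner by (rule euclidean_inner)
  moreover have "bounded_linear (\<lambda>x. g x \<bullet> b)" for b
    using assms by (intro bounded_linear_compose[OF bounded_linear_inner_left]) (simp add: linear_conv_bounded_linear)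
  ultimately show ?thesis by (simp add: C_m_sum C_m_mult C_m_linear)
qed

text \<open>A hyperplane separates the strict epigraph from the point (x, V x). It is not vertical:
  n2 = 0 would give n1 \<bullet> n1 \<le> 0 when tested above x + n1. The slope is therefore - n1 /
  n2, and strictness is removed by letting e tend to 0.\<close>

lemma convex_subgradient:
  fixes V :: "'a::euclidean_space \<Rightarrow> real"
  assumes V: "convex_on UNIV V"
  obtains a where "\<And>y. V y \<ge> V x + a \<bullet> (y - x)"
proof -
  define S where "S = {p :: 'a \<times> real. V (fst p) < snd p}"
  have "convex S"
  proof (rule convexI)
    fix p q :: "'a \<times> real" and s t :: real assume p: "p \<in> S" "q \<in> S" and st: "0 \<le> s" "0 \<le> t" "s + t = 1"
    have "V (s *\<^sub>R fst p + t *\<^sub>R fst q) \<le> s * V (fst p) + t * V (fst q)"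
      using V st unfolding convex_on_def by auto
    also have "\<dots> < s * snd p + t * snd q"
    proof (cases "s = 0")
      case True
      then show ?thesis using p st by (simp add: S_def)
    next
      case False
      then have "s * V (fst p) < s * snd p" using p st by (intro mult_strict_left_mono) (auto simp: S_def)
      moreover have "t * V (fst q) \<le> t * snd q" using p st by (intro mult_left_mono) (auto simp: S_def)
      ultimately show ?thesis by simp
    qed
    finally show "s *\<^sub>R p + t *\<^sub>R q \<in> S" by (simp add: S_def)
  qed
  moreover have "(x, V x + 1) \<in> S" by (simp add: S_def)
  moreover have "S \<inter> {(x, V x)} = {}" by (auto simp: S_def)
  ultimately obtain n \<beta> where n: "n \<noteq> 0" "\<And>p. p \<in> S \<Longrightarrow> n \<bullet> p \<le> \<beta>" "n \<bullet> (x, V x) \<ge> \<beta>"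
    using separating_hyperplane_sets[of S "{(x, V x)}"] by force
  obtain n1 n2 where nn: "n = (n1, n2)" by (cases n)
  have ineq: "n1 \<bullet> y + n2 * s \<le> n1 \<bullet> x + n2 * V x" if "V y < s" for y s
    using n(2)[of "(y, s)"] n(3) that by (simp add: S_def nn)
  have le: "n2 \<le> 0" using ineq[of x "V x + 1"] by (simp add: algebra_simps)
  have "n2 \<noteq> 0"
  proof
    assume "n2 = 0"
    then have "n1 \<bullet> n1 \<le> 0" using ineq[of "x + n1" "V (x + n1) + 1"] by (simp add: inner_add_right)
    then have "n1 = 0" by (metis inner_ge_zero inner_eq_zero_iff order_antisym)
    then show False using n(1) \<open>n2 = 0\<close> nn by (simp add: zero_prod_def)
  qed
  with le have neg: "n2 < 0" by simp
  show ?thesis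
  proof (rule that[of "(- 1 / n2) *\<^sub>R n1"])
    fix y
    have "V x + ((- 1 / n2) *\<^sub>R n1) \<bullet> (y - x) \<le> V y + e" if "e > 0" for e
    proof -
      have "n1 \<bullet> (y - x) \<le> n2 * (V x - (V y + e))" using ineq[of y "V y + e"] that by (simp add: inner_diff_right algebra_simps)
      then have "n1 \<bullet> (y - x) / n2 \<ge> V x - (V y + e)" using neg by (simp add: field_simps)
      then show ?thesis by simp
    qed
    then show "V x + ((- 1 / n2) *\<^sub>R n1) \<bullet> (y - x) \<le> V y" by (rule field_le_epsilon)
  qed
qed

section \<open>Rotationally symmetrised affine functions\<close>

context orth_decomp
begin

lemma proj_sum_family:
  assumes "\<And>i. i \<le> k \<Longrightarrow> e i \<in> E i" "j \<le> k"
  shows "\<pi> j (\<Sum>i\<le>k. e i) = e j"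
proof -
  have "\<pi> j (\<Sum>i\<le>k. e i) = (\<Sum>i\<le>k. \<pi> j (e i))" using linear_sum[OF linear_proj[OF assms(2)]] .
  also have "\<dots> = (\<Sum>i\<le>k. if i = j then e j else 0)"
    using assms by (intro sum.cong refl) (auto simp: proj_id proj_other)
  finally show ?thesis using assms by simp
qed

lemma refl_in_O_group:
  assumes i: "i \<in> {1..k}" and w: "w \<in> E i"
  shows "refl_along w \<in> O_group E k"
proof -
  have i': "i \<le> k" using i by auto
  have fix_other: "refl_along w x = x" if "x \<in> E j" "j \<le> k" "j \<noteq> i" for x j
    using E_orth[of j i x w] that w i' by (simp add: refl_along_def)
  have "refl_along w ` E j = E j" if j: "j \<in> {1..k}" for j
  proof (cases "j = i")
    case True
    have sub: "refl_along w ` E i \<subseteq> E i"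
      using w subsp[OF i'] by (auto simp: refl_along_def intro!: subspace_diff subspace_scale)
    have "x \<in> refl_along w ` E i" if "x \<in> E i" for x
      using refl_along_invol[of w x] that sub by (metis image_eqI image_subset_iff)
    with sub True show ?thesis by blast
  next
    case False
    then show ?thesis using fix_other[of _ j] j by force
  qed
  then show ?thesis
    using fix_other[of _ 0] i orthogonal_transformation_refl_along by (auto simp: O_group_def)
qed

text \<open>The components of x are exchanged for those of y one block at a time, each by a single
  reflection between vectors of equal norm.\<close>

lemma O_invariant_block:
  assumes inv: "\<And>g x. g \<in> O_group E k \<Longrightarrow> V (g x) = V x"
    and 0: "\<pi> 0 y = \<pi> 0 x" and nrm: "\<And>i. i \<in> {1..k} \<Longrightarrow> norm (\<pi> i y) = norm (\<pi> i x)"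
  shows "V y = V x"
proof -
  \<comment> \<open>Blocks up to index j from y, the remaining ones from x. Since block 0 is the
    same for both, z 0 is x.\<close>
  define z where "z j = (\<Sum>i\<le>k. if i \<le> j then \<pi> i y else \<pi> i x)" for j
  have pz: "\<pi> i (z j) = (if i \<le> j then \<pi> i y else \<pi> i x)" if "i \<le> k" for i j
    unfolding z_def by (rule proj_sum_family) (use that proj_in in auto)
  have "V (z j) = V x" if "j \<le> k" for j using that
  proof (induction j)
    case 0
    have "z 0 = (\<Sum>i\<le>k. \<pi> i x)" unfolding z_def using assms(2) by (intro sum.cong) auto
    then show ?case by (simp add: sum_proj)
  next
    case (Suc j)
    define w where "w = \<pi> (Suc j) x - \<pi> (Suc j) y"
    have w: "w \<in> E (Suc j)" using Suc.prems subsp proj_in by (auto simp: w_def intro!: subspace_diff)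
    have eq: "refl_along w (z j) = z (Suc j)"
    proof -
      have "\<pi> i (refl_along w (z j)) = \<pi> i (z (Suc j))" if "i \<le> k" for i
      proof (cases "i = Suc j")
        case True
        have "refl_along w (\<pi> (Suc j) x) = \<pi> (Suc j) y"
          unfolding w_def using Suc.prems nrm by (intro refl_along_diff) auto
        then show ?thesis using True proj_refl_same[OF Suc.prems w] pz Suc.prems by simp
      next
        case False
        then show ?thesis using proj_refl_other[OF Suc.prems w that] pz that by (auto simp: le_Suc_eq)
      qed
      then have "(\<Sum>i\<le>k. \<pi> i (refl_along w (z j))) = (\<Sum>i\<le>k. \<pi> i (z (Suc j)))" by (intro sum.cong) auto
      then show ?thesis by (simp add: sum_proj)
    qed
    have "V (z (Suc j)) = V (z j)"
      unfolding eq[symmetric] using Suc.prems w by (intro inv refl_in_O_group) auto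
    then show ?case using Suc by simp
  qed
  then have "V (z k) = V x" by simp
  moreover have "z k = (\<Sum>i\<le>k. \<pi> i y)" unfolding z_def by (intro sum.cong) auto
  ultimately show ?thesis by (simp add: sum_proj)
qed

text \<open>Maximising the affine function \<open>x \<mapsto> v + a \<bullet> x\<close> over the orbit of \<open>x\<close> replaces each term
  \<open>a \<bullet> \<pi> i x\<close> by \<open>|\<pi> i a| |\<pi> i x|\<close>; the parameter \<open>\<delta>\<close> smoothes the norms.\<close>

definition ell :: "real \<Rightarrow> real \<Rightarrow> 'a \<Rightarrow> 'a \<Rightarrow> real" where
  "ell \<delta> v a x = v + a \<bullet> \<pi> 0 x + (\<Sum>i=1..k. sqrt (\<delta>\<^sup>2 + (norm (\<pi> i a))\<^sup>2 * (norm (\<pi> i x))\<^sup>2))"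

lemma sum_proj_split: "a \<bullet> x = a \<bullet> \<pi> 0 x + (\<Sum>i=1..k. \<pi> i a \<bullet> \<pi> i x)"
proof -
  have "a \<bullet> x = (\<Sum>i\<in>insert 0 {1..k}. \<pi> i a \<bullet> \<pi> i x)"
    unfolding inner_proj[of a x] by (intro sum.cong) auto
  also have "\<dots> = \<pi> 0 a \<bullet> \<pi> 0 x + (\<Sum>i=1..k. \<pi> i a \<bullet> \<pi> i x)" by (subst sum.insert) auto
  also have "\<pi> 0 a \<bullet> \<pi> 0 x = a \<bullet> \<pi> 0 x" by (simp add: proj_inner proj_in)
  finally show ?thesis .
qed

lemma ell_ge: "v + a \<bullet> x \<le> ell \<delta> v a x"
  unfolding ell_def sum_proj_split[of a x] add.assoc
proof (intro add_left_mono sum_mono)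
  fix i
  have "\<pi> i a \<bullet> \<pi> i x \<le> norm (\<pi> i a) * norm (\<pi> i x)" by (rule norm_cauchy_schwarz)
  also have "\<dots> = sqrt ((norm (\<pi> i a))\<^sup>2 * (norm (\<pi> i x))\<^sup>2)" by (simp add: real_sqrt_mult)
  also have "\<dots> \<le> sqrt (\<delta>\<^sup>2 + (norm (\<pi> i a))\<^sup>2 * (norm (\<pi> i x))\<^sup>2)" by simp
  finally show "\<pi> i a \<bullet> \<pi> i x \<le> sqrt (\<delta>\<^sup>2 + (norm (\<pi> i a))\<^sup>2 * (norm (\<pi> i x))\<^sup>2)" .
qed

text \<open>The affine minorant is evaluated at a point y of the orbit of x that is aligned with a
  in every block, where V has the same value as at x. Smoothing costs at most \<delta> per block
  because sqrt (\<delta>^2 + s^2) \<le> s + \<delta> for s \<ge> 0.\<close>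

lemma ell_le:
  fixes V :: "'a \<Rightarrow> real"
  assumes inv: "\<And>g x. g \<in> O_group E k \<Longrightarrow> V (g x) = V x" and sub: "\<And>y. v + a \<bullet> y \<le> V y" and \<delta>: "0 \<le> \<delta>"
  shows "ell \<delta> v a x \<le> V x + real k * \<delta>"
proof -
  define e where "e i = (if i = 0 \<or> \<pi> i a = 0 then \<pi> i x else (norm (\<pi> i x) / norm (\<pi> i a)) *\<^sub>R \<pi> i a)" for i
  have eE: "e i \<in> E i" if "i \<le> k" for i using that subsp proj_in by (auto simp: e_def intro: subspace_scale)
  define y where "y = (\<Sum>i\<le>k. e i)"
  have py: "\<pi> i y = e i" if "i \<le> k" for i unfolding y_def using that eE by (intro proj_sum_family) auto
  have "V y = V x" by (rule O_invariant_block[OF inv]) (auto simp: py e_def)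
  moreover have "a \<bullet> y = a \<bullet> \<pi> 0 x + (\<Sum>i=1..k. norm (\<pi> i a) * norm (\<pi> i x))"
  proof -
    have "\<pi> i a \<bullet> e i = norm (\<pi> i a) * norm (\<pi> i x)" if "i \<in> {1..k}" for i
      using that by (auto simp: e_def power2_norm_eq_inner[symmetric] power2_eq_square)
    then show ?thesis unfolding sum_proj_split[of a y] by (simp add: py) (simp add: e_def)
  qed
  moreover have "(\<Sum>i=1..k. sqrt (\<delta>\<^sup>2 + (norm (\<pi> i a))\<^sup>2 * (norm (\<pi> i x))\<^sup>2)) \<le> (\<Sum>i=1..k. norm (\<pi> i a) * norm (\<pi> i x) + \<delta>)"
  proof (rule sum_mono)
    fix i
    have "sqrt (\<delta>\<^sup>2 + (norm (\<pi> i a))\<^sup>2 * (norm (\<pi> i x))\<^sup>2) \<le> sqrt (\<delta>\<^sup>2) + sqrt ((norm (\<pi> i a))\<^sup>2 * (norm (\<pi> i x))\<^sup>2)"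
      by (rule sqrt_add_le_add_sqrt) auto
    then show "sqrt (\<delta>\<^sup>2 + (norm (\<pi> i a))\<^sup>2 * (norm (\<pi> i x))\<^sup>2) \<le> norm (\<pi> i a) * norm (\<pi> i x) + \<delta>"
      using \<delta> by (simp add: real_sqrt_mult)
  qed
  ultimately show ?thesis using sub[of y] by (simp add: ell_def sum.distrib)
qed

lemma C_m_ell: "\<delta> > 0 \<Longrightarrow> C_m m (ell \<delta> v a)"
  unfolding ell_def
proof (intro C_m_add C_m_const C_m_sum C_m_sqrt C_m_mult C_m_norm_sq C_m_linear)
  show "bounded_linear (\<lambda>x. a \<bullet> \<pi> 0 x)"
    using linear_proj[of 0] by (intro bounded_linear_compose[OF bounded_linear_inner_right]) (simp add: linear_conv_bounded_linear)
qed (auto intro: linear_proj add_pos_nonneg)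

text \<open>Each square root is the Euclidean length of the plane vector with entries \<delta> and
  |\<pi> i a| |\<pi> i x|, so convexity is the triangle inequality.\<close>

lemma ell_midpoint: "ell \<delta> v a ((1/2) *\<^sub>R (x + y)) \<le> ell \<delta> v a x / 2 + ell \<delta> v a y / 2"
proof -
  have "(\<Sum>i=1..k. sqrt (\<delta>\<^sup>2 + (norm (\<pi> i a))\<^sup>2 * (norm (\<pi> i ((1/2) *\<^sub>R (x + y))))\<^sup>2))
    \<le> (\<Sum>i=1..k. sqrt (\<delta>\<^sup>2 + (norm (\<pi> i a))\<^sup>2 * (norm (\<pi> i x))\<^sup>2) / 2 + sqrt (\<delta>\<^sup>2 + (norm (\<pi> i a))\<^sup>2 * (norm (\<pi> i y))\<^sup>2) / 2)"
  proof (rule sum_mono)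
    fix i assume "i \<in> {1..k}"
    then have i: "i \<le> k" by simp
    let ?c = "norm (\<pi> i a)" and ?r = "norm (\<pi> i x)" and ?s = "norm (\<pi> i y)"
    have half: "sqrt ((\<delta>/2)\<^sup>2 + (?c * t / 2)\<^sup>2) = sqrt (\<delta>\<^sup>2 + ?c\<^sup>2 * t\<^sup>2) / 2" for t
    proof -
      have "(\<delta>/2)\<^sup>2 + (?c * t / 2)\<^sup>2 = (\<delta>\<^sup>2 + ?c\<^sup>2 * t\<^sup>2) / 4" by (simp add: power_divide power_mult_distrib add_divide_distrib)
      then have "sqrt ((\<delta>/2)\<^sup>2 + (?c * t / 2)\<^sup>2) = sqrt (\<delta>\<^sup>2 + ?c\<^sup>2 * t\<^sup>2) / sqrt 4" by (simp only: real_sqrt_divide)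
      then show ?thesis by simp
    qed
    have "norm (\<pi> i ((1/2) *\<^sub>R (x + y))) \<le> (?r + ?s) / 2"
      using i norm_triangle_ineq[of "\<pi> i x" "\<pi> i y"] by (simp add: proj_scale proj_add del: scaleR_add_right)
    then have "(?c * norm (\<pi> i ((1/2) *\<^sub>R (x + y))))\<^sup>2 \<le> (?c * ((?r + ?s) / 2))\<^sup>2"
      by (intro power_mono mult_left_mono) auto
    then have "sqrt (\<delta>\<^sup>2 + ?c\<^sup>2 * (norm (\<pi> i ((1/2) *\<^sub>R (x + y))))\<^sup>2) \<le> sqrt ((\<delta>/2 + \<delta>/2)\<^sup>2 + (?c * ?r / 2 + ?c * ?s / 2)\<^sup>2)"
      by (simp add: power_mult_distrib algebra_simps add_divide_distrib)
    also have "\<dots> \<le> sqrt (\<delta>\<^sup>2 + ?c\<^sup>2 * ?r\<^sup>2) / 2 + sqrt (\<delta>\<^sup>2 + ?c\<^sup>2 * ?s\<^sup>2) / 2"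
      unfolding half[symmetric] by (rule real_sqrt_sum_squares_triangle_ineq)
    finally show "sqrt (\<delta>\<^sup>2 + ?c\<^sup>2 * (norm (\<pi> i ((1/2) *\<^sub>R (x + y))))\<^sup>2) \<le> sqrt (\<delta>\<^sup>2 + ?c\<^sup>2 * ?r\<^sup>2) / 2 + sqrt (\<delta>\<^sup>2 + ?c\<^sup>2 * ?s\<^sup>2) / 2" .
  qed
  moreover have "a \<bullet> \<pi> 0 ((1/2) *\<^sub>R (x + y)) = (a \<bullet> \<pi> 0 x) / 2 + (a \<bullet> \<pi> 0 y) / 2"
    by (simp add: proj_scale proj_add inner_add_right add_divide_distrib del: scaleR_add_right)
  ultimately show ?thesis unfolding ell_def by (simp add: sum.distrib sum_divide_distrib[symmetric] add_divide_distrib)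
qed

lemma ell_block_mono:
  assumes i: "i \<in> {1..k}" and xy: "x - y \<in> E i" "norm (\<pi> i y) \<le> norm (\<pi> i x)"
  shows "ell \<delta> v a y \<le> ell \<delta> v a x"
proof -
  have i': "i \<le> k" using i by simp
  have eq: "\<pi> j y = \<pi> j x" if "j \<le> k" "j \<noteq> i" for j
    using that i' xy proj_other[of j i "x - y"] by (simp add: proj_diff)
  have le: "(norm (\<pi> j y))\<^sup>2 \<le> (norm (\<pi> j x))\<^sup>2" if "j \<in> {1..k}" for j
    using that xy eq by (cases "j = i") auto
  show ?thesis unfolding ell_def
    using eq[of 0] i by (intro add_mono sum_mono real_sqrt_le_mono mult_left_mono le) auto
qed

end

section \<open>Approximation of the initial datum\<close>

text \<open>Completing a square, half of the Gaussian absorbs the possible exponential growth from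
  a; the other half beats 1 + |x|^2 by the estimate exp s \<ge> 1 + s.\<close>

lemma gaussian_decay:
  fixes a :: "'a::real_inner"
  assumes \<epsilon>: "\<epsilon> > 0"
  shows "exp (- (v + a \<bullet> x)) * exp (- \<epsilon> * (norm x)\<^sup>2)
    \<le> exp (- v + (norm a)\<^sup>2 / (2 * \<epsilon>)) * (1 + 2 / \<epsilon>) / (1 + x \<bullet> x)"
proof -
  define r where "r = norm x"
  have xr: "x \<bullet> x = r^2" by (simp add: r_def power2_norm_eq_inner)
  have "0 \<le> (\<epsilon> * r - norm a)\<^sup>2 / (2 * \<epsilon>)" using \<epsilon> by simp
  also have "\<dots> = \<epsilon> * r^2 / 2 - norm a * r + (norm a)\<^sup>2 / (2 * \<epsilon>)"
    using \<epsilon> by (simp add: power2_eq_square field_simps)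
  finally have 1: "norm a * r - \<epsilon> * r^2 \<le> (norm a)\<^sup>2 / (2 * \<epsilon>) - \<epsilon> * r^2 / 2" by simp
  have "- (a \<bullet> x) \<le> norm a * r" using Cauchy_Schwarz_ineq2[of a x] by (simp add: r_def)
  with 1 have "- (v + a \<bullet> x) + - \<epsilon> * r^2 \<le> (- v + (norm a)\<^sup>2 / (2 * \<epsilon>)) + - (\<epsilon> * r^2 / 2)" by simp
  then have "exp (- (v + a \<bullet> x) + - \<epsilon> * r^2) \<le> exp ((- v + (norm a)\<^sup>2 / (2 * \<epsilon>)) + - (\<epsilon> * r^2 / 2))" by (simp only: exp_le_cancel_iff)
  also have "\<dots> = exp (- v + (norm a)\<^sup>2 / (2 * \<epsilon>)) * exp (- (\<epsilon> * r^2 / 2))" by (rule exp_add)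
  also have "\<dots> \<le> exp (- v + (norm a)\<^sup>2 / (2 * \<epsilon>)) * ((1 + 2 / \<epsilon>) / (1 + r^2))"
  proof (intro mult_left_mono)
    have p: "1 + r^2 > 0" by (simp add: add_pos_nonneg)
    have "(1 + r^2) \<le> (1 + 2 / \<epsilon>) * (1 + \<epsilon> * r^2 / 2)" using \<epsilon> by (simp add: field_simps)
    also have "\<dots> \<le> (1 + 2 / \<epsilon>) * exp (\<epsilon> * r^2 / 2)" using \<epsilon> by (intro mult_left_mono exp_ge_add_one_self) auto
    finally have "(1 + r^2) * exp (- (\<epsilon> * r^2 / 2)) \<le> (1 + 2 / \<epsilon>) * exp (\<epsilon> * r^2 / 2) * exp (- (\<epsilon> * r^2 / 2))"
      by (intro mult_right_mono) auto
    then have "(1 + r^2) * exp (- (\<epsilon> * r^2 / 2)) \<le> 1 + 2 / \<epsilon>" unfolding mult.assoc[of "1 + 2 / \<epsilon>"] exp_add[symmetric] by simp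
    then show "exp (- (\<epsilon> * r^2 / 2)) \<le> (1 + 2 / \<epsilon>) / (1 + r^2)" using p by (simp add: pos_le_divide_eq mult.commute)
  qed simp
  finally show ?thesis unfolding xr exp_add[symmetric] r_def by simp
qed

context orth_decomp
begin

text \<open>With p = Suc N the first factor is exp of minus the soft maximum (1 / p) ln (sum of exp
  (p ell)). The same p is the sharpness of the maximum and, through 1 / p, the smoothing of the
  norms. The Gaussian factor provides decay.\<close>

definition approx :: "real \<Rightarrow> nat \<Rightarrow> (nat \<Rightarrow> real) \<Rightarrow> (nat \<Rightarrow> 'a) \<Rightarrow> 'a \<Rightarrow> real" where
  "approx \<epsilon> N v a x =
    (\<Sum>j\<le>N. exp (real (Suc N) * ell (1 / real (Suc N)) (v j) (a j) x)) powr (- 1 / real (Suc N)) * exp (- \<epsilon> * (norm x)\<^sup>2)"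

lemma sum_exp_pos: "0 < (\<Sum>j\<le>N. exp (f j :: real))" for N :: nat
  by (intro sum_pos) auto

lemma approx_pos: "0 < approx \<epsilon> N v a x"
  using sum_exp_pos[where N = N] by (simp add: approx_def less_imp_neq[THEN not_sym])

lemma C_m_approx: "C_m m (approx \<epsilon> N v a)"
  unfolding approx_def
  by (intro C_m_mult C_m_exp C_m_powr C_m_sum C_m_const C_m_ell sum_exp_pos C_m_norm_sq linear_id[unfolded id_def]) auto

lemma approx_le:
  assumes "j \<le> N"
  shows "approx \<epsilon> N v a x \<le> exp (- ell (1 / real (Suc N)) (v j) (a j) x) * exp (- \<epsilon> * (norm x)\<^sup>2)"
  unfolding approx_def
proof (rule mult_right_mono)
  define l where "l j = ell (1 / real (Suc N)) (v j) (a j) x" for j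
  have "exp (real (Suc N) * l j) \<le> (\<Sum>j\<le>N. exp (real (Suc N) * l j))"
    using assms by (intro member_le_sum) auto
  then have "(\<Sum>j\<le>N. exp (real (Suc N) * l j)) powr (- 1 / real (Suc N)) \<le> exp (real (Suc N) * l j) powr (- 1 / real (Suc N))"
    by (intro powr_mono2') auto
  also have "\<dots> = exp (- l j)" by (simp add: exp_powr_real)
  finally show "(\<Sum>j\<le>N. exp (real (Suc N) * ell (1 / real (Suc N)) (v j) (a j) x)) powr (- 1 / real (Suc N))
    \<le> exp (- ell (1 / real (Suc N)) (v j) (a j) x)" by (simp add: l_def)
qed simp

text \<open>There are p = Suc N terms, each at most exp (p B), so the soft maximum exceeds B by at
  most ln p / p.\<close>

lemma approx_ge:
  assumes "\<And>j. j \<le> N \<Longrightarrow> ell (1 / real (Suc N)) (v j) (a j) x \<le> B"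
  shows "exp (- (B + ln (real (Suc N)) / real (Suc N))) * exp (- \<epsilon> * (norm x)\<^sup>2) \<le> approx \<epsilon> N v a x"
  unfolding approx_def
proof (rule mult_right_mono)
  let ?p = "real (Suc N)"
  have "(\<Sum>j\<le>N. exp (?p * ell (1 / ?p) (v j) (a j) x)) \<le> (\<Sum>j\<le>N. exp (?p * B))"
    using assms by (intro sum_mono) (simp only: exp_le_cancel_iff, intro mult_left_mono, auto)
  also have "\<dots> = exp (ln ?p + ?p * B)" by (simp add: exp_add)
  finally have "exp (ln ?p + ?p * B) powr (- 1 / ?p) \<le> (\<Sum>j\<le>N. exp (?p * ell (1 / ?p) (v j) (a j) x)) powr (- 1 / ?p)"
    by (intro powr_mono2' sum_exp_pos) auto
  moreover have "(ln ?p + ?p * B) * (- 1 / ?p) = - (B + ln ?p / ?p)" by (simp add: field_simps)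
  ultimately show "exp (- (B + ln ?p / ?p)) \<le> (\<Sum>j\<le>N. exp (?p * ell (1 / ?p) (v j) (a j) x)) powr (- 1 / ?p)"
    by (simp only: exp_powr_real)
qed simp

text \<open>Convexity of log-sum-exp is the Cauchy-Schwarz inequality for the vectors of the exp (p
  l / 2) at x and at y; the negative exponent turns it into log-concavity. The Gaussian factor is
  handled by expanding |x - y|^2 \<ge> 0.\<close>

lemma mid_logconcave_approx:
  assumes "0 \<le> \<epsilon>"
  shows "mid_logconcave (approx \<epsilon> N v a)"
  unfolding mid_logconcave_def
proof (intro allI)
  fix x y :: 'a
  let ?p = "real (Suc N)" and ?r = "- 1 / real (Suc N)"
  define l where "l j x = ell (1 / ?p) (v j) (a j) x" for j x
  define Z where "Z x = (\<Sum>j\<le>N. exp (?p * l j x))" for x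
  define e where "e x = exp (- \<epsilon> * (norm x)\<^sup>2)" for x :: 'a
  let ?z = "(1/2) *\<^sub>R (x + y)"
  have Z: "Z x > 0" for x unfolding Z_def by (rule sum_exp_pos)
  have "Z ?z \<le> (\<Sum>j\<le>N. exp (?p * l j x / 2) * exp (?p * l j y / 2))"
    unfolding Z_def
  proof (rule sum_mono)
    fix j
    have "?p * l j ?z \<le> ?p * (l j x / 2 + l j y / 2)" unfolding l_def by (intro mult_left_mono ell_midpoint) auto
    then show "exp (?p * l j ?z) \<le> exp (?p * l j x / 2) * exp (?p * l j y / 2)"
      unfolding exp_add[symmetric] exp_le_cancel_iff by (simp add: distrib_left)
  qed
  then have "(Z ?z)\<^sup>2 \<le> (\<Sum>j\<le>N. exp (?p * l j x / 2) * exp (?p * l j y / 2))\<^sup>2" using Z[of ?z] by (intro power_mono) auto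
  also have "\<dots> \<le> (\<Sum>j\<le>N. (exp (?p * l j x / 2))\<^sup>2) * (\<Sum>j\<le>N. (exp (?p * l j y / 2))\<^sup>2)"
    by (rule Cauchy_Schwarz_ineq_sum)
  also have "\<dots> = Z x * Z y" unfolding Z_def by (simp flip: exp_double)
  finally have "Z ?z \<le> (Z x * Z y) powr (1/2)"
    using Z[of x] Z[of y] Z[of ?z] by (simp add: powr_half_sqrt real_le_rsqrt)
  then have "((Z x * Z y) powr (1/2)) powr ?r \<le> Z ?z powr ?r" using Z by (intro powr_mono2') auto
  moreover have "((Z x * Z y) powr (1/2)) powr ?r = sqrt (Z x powr ?r * Z y powr ?r)"
  proof -
    have "((Z x * Z y) powr (1/2)) powr ?r = ((Z x * Z y) powr ?r) powr (1/2)" by (simp add: powr_powr mult.commute)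
    also have "\<dots> = sqrt (Z x powr ?r * Z y powr ?r)" using Z[of x] Z[of y] by (simp add: powr_mult powr_half_sqrt real_sqrt_mult)
    finally show ?thesis .
  qed
  moreover have "sqrt (e x * e y) \<le> e ?z"
  proof (rule real_le_lsqrt)
    have "(norm ?z)\<^sup>2 \<le> (norm x)\<^sup>2 / 2 + (norm y)\<^sup>2 / 2"
    proof -
      have "0 \<le> (x - y) \<bullet> (x - y)" by simp
      then show ?thesis unfolding power2_norm_eq_inner
        by (simp add: inner_add_left inner_add_right inner_diff_left inner_diff_right inner_commute)
    qed
    then have "\<epsilon> * (norm ?z)\<^sup>2 \<le> \<epsilon> * ((norm x)\<^sup>2 / 2 + (norm y)\<^sup>2 / 2)" using assms by (intro mult_left_mono)
    then have "- \<epsilon> * (norm x)\<^sup>2 + - \<epsilon> * (norm y)\<^sup>2 \<le> 2 * (- \<epsilon> * (norm ?z)\<^sup>2)" by (simp add: algebra_simps)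
    then show "e x * e y \<le> (e ?z)\<^sup>2"
      unfolding e_def exp_add[symmetric] exp_double[symmetric] by simp
  qed (auto simp: e_def)
  ultimately have "sqrt (Z x powr ?r * Z y powr ?r) * sqrt (e x * e y) \<le> Z ?z powr ?r * e ?z"
    by (intro mult_mono) (auto simp: e_def)
  moreover have "sqrt (Z x powr ?r * e x * (Z y powr ?r * e y)) = sqrt (Z x powr ?r * Z y powr ?r) * sqrt (e x * e y)"
    by (simp only: real_sqrt_mult mult_ac)
  ultimately show "sqrt (approx \<epsilon> N v a x * approx \<epsilon> N v a y) \<le> approx \<epsilon> N v a ?z"
    unfolding approx_def l_def[symmetric] Z_def[symmetric] e_def[symmetric] by (simp only:)
qed

lemma block_antimono_approx:
  assumes "0 \<le> \<epsilon>"
  shows "block_antimono (approx \<epsilon> N v a)"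
  unfolding block_antimono_def
proof (intro ballI allI impI)
  fix i x y assume i: "i \<in> {1..k}" and xy: "x - y \<in> E i" "norm (\<pi> i y) \<le> norm (\<pi> i x)"
  have "norm y \<le> norm x" using i by (intro norm_le_block[OF _ xy]) auto
  then have "\<epsilon> * (norm y)\<^sup>2 \<le> \<epsilon> * (norm x)\<^sup>2" using assms by (intro mult_left_mono power_mono) auto
  then show "approx \<epsilon> N v a x \<le> approx \<epsilon> N v a y"
    unfolding approx_def
  proof (intro mult_mono powr_mono2' sum_mono sum_exp_pos)
    show "exp (real (Suc N) * ell (1 / real (Suc N)) (v j) (a j) y) \<le> exp (real (Suc N) * ell (1 / real (Suc N)) (v j) (a j) x)" for j
      unfolding exp_le_cancel_iff by (intro mult_left_mono ell_block_mono[OF i xy]) auto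
  qed auto
qed

text \<open>The functions \<open>x \<mapsto> v j + a j \<bullet> x\<close> are tangent to \<open>V\<close> at a dense sequence of points \<open>y j\<close>. Their
  supremum is \<open>V\<close>, since by convexity the \<open>j\<close>-th one is at least \<open>2 V (y j) - V (2 y j - x)\<close> at \<open>x\<close>.\<close>

lemma approx_exists:
  fixes V :: "'a \<Rightarrow> real"
  assumes V: "convex_on UNIV V" and inv: "\<forall>g\<in>O_group E k. \<forall>x. V (g x) = V x"
  obtains v a where
    "\<And>N \<epsilon> x. exp (- (V x + real k / real (Suc N) + ln (real (Suc N)) / real (Suc N))) * exp (- \<epsilon> * (norm x)\<^sup>2) \<le> approx \<epsilon> N v a x"
    "\<And>\<epsilon> x. (\<lambda>N. approx \<epsilon> N v a x) \<longlonglongrightarrow> exp (- V x) * exp (- \<epsilon> * (norm x)\<^sup>2)"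
proof -
  have Vc: "continuous_on UNIV V" using convex_on_continuous[OF open_UNIV V] .
  obtain D :: "'a set" where D: "countable D" "\<And>X. open X \<Longrightarrow> X \<noteq> {} \<Longrightarrow> \<exists>d\<in>D. d \<in> X"
    using countable_dense_exists by blast
  have Dne: "D \<noteq> {}" using D(2)[of UNIV] by auto
  define y where "y = from_nat_into D"
  have "\<forall>j. \<exists>a. \<forall>z. V z \<ge> V (y j) + a \<bullet> (z - y j)" using convex_subgradient[OF V] by metis
  then obtain a where a: "\<And>j z. V z \<ge> V (y j) + a j \<bullet> (z - y j)" by metis
  define v where "v j = V (y j) - a j \<bullet> y j" for j
  have va: "v j + a j \<bullet> z \<le> V z" for j z using a[of j z] by (simp add: v_def inner_diff_right)
  have low: "exp (- (V x + real k / real (Suc N) + ln (real (Suc N)) / real (Suc N))) * exp (- \<epsilon> * (norm x)\<^sup>2) \<le> approx \<epsilon> N v a x" for N \<epsilon> x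
  proof (rule approx_ge)
    show "ell (1 / real (Suc N)) (v j) (a j) x \<le> V x + real k / real (Suc N)" for j
      using ell_le[where V = V and v = "v j" and a = "a j" and \<delta> = "1 / real (Suc N)" and x = x] inv va by simp
  qed
  moreover have "(\<lambda>N. approx \<epsilon> N v a x) \<longlonglongrightarrow> exp (- V x) * exp (- \<epsilon> * (norm x)\<^sup>2)" (is "_ \<longlonglongrightarrow> ?L") for \<epsilon> x
  proof (rule order_tendstoI)
    fix c assume c: "c < ?L"
    have "(\<lambda>N. real k / real (Suc N)) \<longlonglongrightarrow> 0" by (rule LIMSEQ_Suc[OF lim_const_over_n])
    moreover have "(\<lambda>N. ln (real (Suc N)) / real (Suc N)) \<longlonglongrightarrow> 0" by (rule LIMSEQ_Suc[OF lim_ln_over_n])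
    ultimately have "(\<lambda>N. exp (- (V x + real k / real (Suc N) + ln (real (Suc N)) / real (Suc N))) * exp (- \<epsilon> * (norm x)\<^sup>2)) \<longlonglongrightarrow> exp (- (V x + 0 + 0)) * exp (- \<epsilon> * (norm x)\<^sup>2)"
      by (intro tendsto_intros)
    then have "\<forall>\<^sub>F N in sequentially. c < exp (- (V x + real k / real (Suc N) + ln (real (Suc N)) / real (Suc N))) * exp (- \<epsilon> * (norm x)\<^sup>2)"
      using c by (intro order_tendstoD(1)) auto
    then show "\<forall>\<^sub>F N in sequentially. c < approx \<epsilon> N v a x"
      by eventually_elim (rule less_le_trans[OF _ low])
  next
    fix c assume c: "?L < c"
    \<comment> \<open>Half of the logarithmic gap pays for the tangent plane at a nearby point, the
      other half keeps the inequality strict.\<close>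
    define \<eta> where "\<eta> = ln (c / ?L) / 2"
    have L: "?L > 0" by simp
    then have "c / ?L > 1" using c by (simp add: field_simps)
    then have "ln (c / ?L) > 0" by (rule ln_gt_zero)
    then have \<eta>: "\<eta> > 0" unfolding \<eta>_def by (rule half_gt_zero)
    have "c / ?L > 0" using \<open>c / ?L > 1\<close> by linarith
    then have "exp (2 * \<eta>) = c / ?L" unfolding \<eta>_def by (simp only: exp_ln field_sum_of_halves mult_2)
    then have c_eq: "c = exp (2 * \<eta>) * ?L" using L by (simp add: field_simps)
    let ?X = "{z. V x - \<eta> < 2 * V z - V (2 *\<^sub>R z - x)}"
    have "open ?X" by (intro open_Collect_less continuous_intros Vc continuous_on_compose2[OF Vc]) auto
    moreover have "x \<in> ?X" using \<eta> by (simp add: scaleR_2)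
    ultimately obtain d where d: "d \<in> D" "V x - \<eta> < 2 * V d - V (2 *\<^sub>R d - x)" using D(2)[of ?X] by blast
    obtain j where j: "d = y j" using d(1) from_nat_into_surj[OF D(1)] unfolding y_def by metis
    have "V (y j) + a j \<bullet> ((2 *\<^sub>R d - x) - y j) \<le> V (2 *\<^sub>R d - x)" by (rule a)
    then have vx: "V x - \<eta> \<le> v j + a j \<bullet> x" using d(2) by (simp add: j v_def inner_diff_right)
    have "approx \<epsilon> N v a x < c" if "N \<ge> j" for N
    proof -
      have "approx \<epsilon> N v a x \<le> exp (- ell (1 / real (Suc N)) (v j) (a j) x) * exp (- \<epsilon> * (norm x)\<^sup>2)" by (rule approx_le[OF that])
      also have "\<dots> \<le> exp (- (V x - \<eta>)) * exp (- \<epsilon> * (norm x)\<^sup>2)"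
        using ell_ge[of "v j" "a j" x "1 / real (Suc N)"] vx by (intro mult_right_mono) auto
      also have "\<dots> = exp \<eta> * ?L" by (simp add: exp_diff exp_minus field_simps)
      also have "\<dots> < exp (2 * \<eta>) * ?L" using \<eta> L by (intro mult_strict_right_mono) auto
      finally show ?thesis by (simp add: c_eq)
    qed
    then show "\<forall>\<^sub>F N in sequentially. approx \<epsilon> N v a x < c" unfolding eventually_sequentially by blast
  qed
  ultimately show ?thesis using that by blast
qed

text \<open>The minorant with index 0 occurs for every N, so C does not depend on N; dominated
  convergence in N relies on this.\<close>

lemma approx_bound: "\<epsilon> > 0 \<Longrightarrow> \<exists>C\<ge>0. \<forall>N x. approx \<epsilon> N v a x \<le> C / (1 + x \<bullet> x)"
proof (intro exI conjI allI)
  fix N x assume \<epsilon>: "\<epsilon> > 0"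
  have "approx \<epsilon> N v a x \<le> exp (- ell (1 / real (Suc N)) (v 0) (a 0) x) * exp (- \<epsilon> * (norm x)\<^sup>2)" by (rule approx_le) simp
  also have "\<dots> \<le> exp (- (v 0 + a 0 \<bullet> x)) * exp (- \<epsilon> * (norm x)\<^sup>2)" using ell_ge[of "v 0" "a 0" x "1 / real (Suc N)"] by (intro mult_right_mono) auto
  also note gaussian_decay[OF \<epsilon>]
  finally show "approx \<epsilon> N v a x \<le> exp (- v 0 + (norm (a 0))\<^sup>2 / (2 * \<epsilon>)) * (1 + 2 / \<epsilon>) / (1 + x \<bullet> x)" .
qed auto

text \<open>For fixed \<epsilon> the approximants converge in L1 as N grows, dominated by a constant
  that depends on \<epsilon>; the limits H \<epsilon> converge as \<epsilon> tends to 0, dominated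
  by exp (- V). Hence a diagonal choice: \<epsilon> = 1 / Suc m and N m with L1 error below 1 / Suc
  m.\<close>

lemma approximation:
  fixes V :: "'a \<Rightarrow> real"
  assumes V: "convex_on UNIV V" and inv: "\<forall>g\<in>O_group E k. \<forall>x. V (g x) = V x"
    and M: "prob_space M" "sets M = sets borel" and int: "integrable M (\<lambda>x. exp (- V x))"
  obtains G where "\<And>m. smooth_bounded (G m)" "\<And>m. block_antimono (G m)" "\<And>m. mid_logconcave (G m)"
    "\<And>m. \<exists>C\<ge>0. \<forall>x. G m x \<le> C / (1 + x \<bullet> x)"
    "\<And>m x. exp (- (V x + real k + 1 + (norm x)\<^sup>2)) \<le> G m x"
    "tendsto_L1 M G (\<lambda>x. exp (- V x))"
proof -
  interpret prob_space M by (rule M)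
  have Vc: "continuous_on UNIV V" using convex_on_continuous[OF open_UNIV V] .
  have meas: "f \<in> borel_measurable M" if "continuous_on UNIV f" for f :: "'a \<Rightarrow> real"
    using borel_measurable_continuous_onI[OF that] measurable_cong_sets[OF M(2) refl] by blast
  obtain v a where low: "\<And>N \<epsilon> x. exp (- (V x + real k / real (Suc N) + ln (real (Suc N)) / real (Suc N))) * exp (- \<epsilon> * (norm x)\<^sup>2) \<le> approx \<epsilon> N v a x"
    and lim: "\<And>\<epsilon> x. (\<lambda>N. approx \<epsilon> N v a x) \<longlonglongrightarrow> exp (- V x) * exp (- \<epsilon> * (norm x)\<^sup>2)"
    using approx_exists[OF V inv] by blast
  define H where "H \<epsilon> x = exp (- V x) * exp (- \<epsilon> * (norm x)\<^sup>2)" for \<epsilon> and x :: 'a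
  have am: "approx \<epsilon> N v a \<in> borel_measurable M" for \<epsilon> N
    using C_m_approx[of 0 \<epsilon> N v a] by (intro meas) (simp add: C_m_0)
  have Hm: "H \<epsilon> \<in> borel_measurable M" for \<epsilon> unfolding H_def by (intro meas continuous_intros Vc)
  have bnd: "\<exists>C\<ge>0. \<forall>N x. approx \<epsilon> N v a x \<le> C" if \<epsilon>: "\<epsilon> > 0" for \<epsilon>
  proof -
    obtain C where C: "C \<ge> 0" "\<And>N x. approx \<epsilon> N v a x \<le> C / (1 + x \<bullet> x)" using approx_bound[OF \<epsilon>] by blast
    have "C / (1 + x \<bullet> x) \<le> C" for x :: 'a
    proof -
      have "1 + x \<bullet> x > 0" by (simp add: add_pos_nonneg)
      moreover have "C \<le> C * (1 + x \<bullet> x)" using C(1) by (simp add: algebra_simps)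
      ultimately show ?thesis by (simp add: pos_divide_le_eq)
    qed
    then show ?thesis using C order_trans by blast
  qed
  have aint: "integrable M (approx \<epsilon> N v a)" if \<epsilon>: "\<epsilon> > 0" for \<epsilon> N
  proof -
    obtain C where "\<And>N x. approx \<epsilon> N v a x \<le> C" using bnd[OF \<epsilon>] by blast
    then show ?thesis using approx_pos[of \<epsilon> N v a] am by (intro integrable_const_bound[where B = C]) (auto simp: less_imp_le)
  qed
  have Hint: "integrable M (H \<epsilon>)" if "\<epsilon> > 0" for \<epsilon>
    by (rule Bochner_Integration.integrable_bound[OF int Hm]) (use that in \<open>auto simp: H_def\<close>)
  have "\<exists>N. (LINT x|M. \<bar>approx \<epsilon> N v a x - H \<epsilon> x\<bar>) < \<epsilon>" if \<epsilon>: "\<epsilon> > 0" for \<epsilon>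
  proof -
    obtain C where C: "C \<ge> 0" "\<And>N x. approx \<epsilon> N v a x \<le> C" using bnd[OF \<epsilon>] by blast
    have HC: "H \<epsilon> x \<le> C" for x unfolding H_def by (rule LIMSEQ_le_const2[OF lim]) (use C in auto)
    have "(\<lambda>N. LINT x|M. \<bar>approx \<epsilon> N v a x - H \<epsilon> x\<bar>) \<longlonglongrightarrow> (LINT x|M. 0)"
    proof (rule integral_dominated_convergence[where w = "\<lambda>_. C"])
      show "AE x in M. (\<lambda>N. \<bar>approx \<epsilon> N v a x - H \<epsilon> x\<bar>) \<longlonglongrightarrow> 0"
        using lim[of \<epsilon>] unfolding H_def by (auto intro!: tendsto_rabs_zero simp: LIM_zero_iff)
      show "AE x in M. norm \<bar>approx \<epsilon> N v a x - H \<epsilon> x\<bar> \<le> C" for N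
      proof (rule AE_I2)
        fix x
        have "0 \<le> H \<epsilon> x" by (simp add: H_def)
        then show "norm \<bar>approx \<epsilon> N v a x - H \<epsilon> x\<bar> \<le> C" using HC[of x] C(2)[of N x] approx_pos[of \<epsilon> N v a x] by simp
      qed
    qed (use am Hm in auto)
    then have "(\<lambda>N. LINT x|M. \<bar>approx \<epsilon> N v a x - H \<epsilon> x\<bar>) \<longlonglongrightarrow> 0" by simp
    from order_tendstoD(2)[OF this \<epsilon>] show ?thesis using eventually_happens by fastforce
  qed
  then have "\<forall>m. \<exists>N. (LINT x|M. \<bar>approx (1 / real (Suc m)) N v a x - H (1 / real (Suc m)) x\<bar>) < 1 / real (Suc m)" by simp
  then obtain N where N: "\<And>m. (LINT x|M. \<bar>approx (1 / real (Suc m)) (N m) v a x - H (1 / real (Suc m)) x\<bar>) < 1 / real (Suc m)" by metis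
  define G where "G m = approx (1 / real (Suc m)) (N m) v a" for m
  have Gint: "integrable M (G m)" for m unfolding G_def by (rule aint) simp
  show ?thesis
  proof (rule that)
    show "smooth_bounded (G m)" for m
    proof -
      obtain C where "\<And>N x. approx (1 / real (Suc m)) N v a x \<le> C" using bnd[of "1 / real (Suc m)"] by auto
      then have "norm (G m x) \<le> C" for x using approx_pos[of "1 / real (Suc m)" "N m" v a x] by (simp add: G_def less_imp_le)
      then have "bounded (range (G m))" by (auto simp: bounded_iff)
      then show ?thesis by (simp add: smooth_bounded_def G_def C_m_approx)
    qed
    show "block_antimono (G m)" for m unfolding G_def by (rule block_antimono_approx) simp
    show "mid_logconcave (G m)" for m unfolding G_def by (rule mid_logconcave_approx) simp
    show "\<exists>C\<ge>0. \<forall>x. G m x \<le> C / (1 + x \<bullet> x)" for m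
      using approx_bound[of "1 / real (Suc m)" v a] unfolding G_def by auto
    \<comment> \<open>The bound is free of m because all three parameters 1 / Suc N, ln (Suc N) /
      Suc N and \<epsilon> are at most 1. It is the source of positivity in the limit.\<close>
    show "exp (- (V x + real k + 1 + (norm x)\<^sup>2)) \<le> G m x" for m x
    proof -
      have "real k / real (Suc (N m)) \<le> real k" by (simp add: divide_le_eq algebra_simps)
      moreover have "ln (real (Suc (N m))) / real (Suc (N m)) \<le> 1"
      proof -
        have "ln (real (Suc (N m))) \<le> real (Suc (N m)) - 1" by (rule ln_le_minus_one) simp
        then show ?thesis by (simp add: divide_le_eq)
      qed
      moreover have "1 / real (Suc m) * (norm x)\<^sup>2 \<le> (norm x)\<^sup>2" by (simp add: divide_le_eq algebra_simps)
      ultimately have "- (V x + real k + 1 + (norm x)\<^sup>2) \<le> - (V x + real k / real (Suc (N m)) + ln (real (Suc (N m))) / real (Suc (N m))) + - (1 / real (Suc m)) * (norm x)\<^sup>2"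
        unfolding mult_minus_left by linarith
      then have "exp (- (V x + real k + 1 + (norm x)\<^sup>2)) \<le> exp (- (V x + real k / real (Suc (N m)) + ln (real (Suc (N m))) / real (Suc (N m)))) * exp (- (1 / real (Suc m)) * (norm x)\<^sup>2)"
        unfolding exp_add[symmetric] exp_le_cancel_iff .
      also have "\<dots> \<le> G m x" unfolding G_def by (rule low)
      finally show ?thesis .
    qed
    show "tendsto_L1 M G (\<lambda>x. exp (- V x))"
      unfolding tendsto_L1_def
    proof (intro conjI allI int Gint)
      let ?H = "\<lambda>m. H (1 / real (Suc m))"
      have Hi: "integrable M (?H m)" for m by (rule Hint) simp
      have "(\<lambda>m. LINT x|M. \<bar>?H m x - exp (- V x)\<bar>) \<longlonglongrightarrow> (LINT x|M. 0)"
      proof (rule integral_dominated_convergence[where w = "\<lambda>x. exp (- V x)"])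
        show "AE x in M. (\<lambda>m. \<bar>?H m x - exp (- V x)\<bar>) \<longlonglongrightarrow> 0"
        proof (rule AE_I2)
          fix x
          have "(\<lambda>m. 1 / real (Suc m)) \<longlonglongrightarrow> 0" by (rule LIMSEQ_Suc[OF lim_const_over_n])
          then have "(\<lambda>m. \<bar>?H m x - exp (- V x)\<bar>) \<longlonglongrightarrow> \<bar>exp (- V x) * exp (- 0 * (norm x)\<^sup>2) - exp (- V x)\<bar>"
            unfolding H_def by (intro tendsto_intros)
          then show "(\<lambda>m. \<bar>?H m x - exp (- V x)\<bar>) \<longlonglongrightarrow> 0" by simp
        qed
        show "AE x in M. norm \<bar>?H m x - exp (- V x)\<bar> \<le> exp (- V x)" for m
        proof (rule AE_I2)
          fix x
          have "?H m x \<le> exp (- V x)" "0 \<le> ?H m x" by (auto simp: H_def)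
          then show "norm \<bar>?H m x - exp (- V x)\<bar> \<le> exp (- V x)" by simp
        qed
      qed (use int Hm in auto)
      then have "(\<lambda>m. 1 / real (Suc m) + (LINT x|M. \<bar>?H m x - exp (- V x)\<bar>)) \<longlonglongrightarrow> 0 + 0"
        by (intro tendsto_add LIMSEQ_Suc[OF lim_const_over_n]) simp
      then have lim0: "(\<lambda>m. 1 / real (Suc m) + (LINT x|M. \<bar>?H m x - exp (- V x)\<bar>)) \<longlonglongrightarrow> 0" by simp
      have le: "(LINT x|M. \<bar>G m x - exp (- V x)\<bar>) \<le> 1 / real (Suc m) + (LINT x|M. \<bar>?H m x - exp (- V x)\<bar>)" for m
      proof -
        have "(LINT x|M. \<bar>G m x - exp (- V x)\<bar>) \<le> (LINT x|M. \<bar>G m x - ?H m x\<bar> + \<bar>?H m x - exp (- V x)\<bar>)"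
          by (intro integral_mono integrable_abs Bochner_Integration.integrable_diff Bochner_Integration.integrable_add Gint Hi int) auto
        also have "\<dots> = (LINT x|M. \<bar>G m x - ?H m x\<bar>) + (LINT x|M. \<bar>?H m x - exp (- V x)\<bar>)"
          by (intro Bochner_Integration.integral_add integrable_abs Bochner_Integration.integrable_diff Gint Hi int)
        also have "\<dots> \<le> 1 / real (Suc m) + (LINT x|M. \<bar>?H m x - exp (- V x)\<bar>)" using N[of m] by (simp add: G_def)
        finally show ?thesis .
      qed
      show "(\<lambda>m. LINT x|M. \<bar>G m x - exp (- V x)\<bar>) \<longlonglongrightarrow> 0"
      proof (rule Lim_null_comparison[OF always_eventually lim0], rule allI)
        fix m
        have "0 \<le> (LINT x|M. \<bar>G m x - exp (- V x)\<bar>)" by (rule integral_nonneg_AE) auto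
        then show "norm (LINT x|M. \<bar>G m x - exp (- V x)\<bar>) \<le> 1 / real (Suc m) + (LINT x|M. \<bar>?H m x - exp (- V x)\<bar>)"
          using le[of m] unfolding real_norm_def by linarith
      qed
    qed
  qed
qed

end

section \<open>The semigroup\<close>

text \<open>The total mass of the second measure is the integral of exp (- V) against the first; so
  the initial datum belongs to L1.\<close>

lemma integrable_exp_measure:
  assumes "prob_space (exp_measure (\<lambda>x. U x + V x))" "U \<in> borel_measurable borel" "V \<in> borel_measurable borel"
  shows "integrable (exp_measure U) (\<lambda>x. exp (- V x))"
proof -
  note [measurable] = assms(2,3)
  have "emeasure (exp_measure (\<lambda>x. U x + V x)) UNIV = 1"
    using prob_space.emeasure_space_1[OF assms(1)] by (simp add: exp_measure_def)
  then have "(\<integral>\<^sup>+ x. ennreal (exp (- (U x + V x))) \<partial>lborel) = 1"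
    by (simp add: exp_measure_def emeasure_density)
  then have "integrable lborel (\<lambda>x. exp (- (U x + V x)))"
    by (intro integrableI_nonneg) auto
  then show ?thesis
    unfolding exp_measure_def by (subst integrable_density) (auto simp: exp_add exp_diff exp_minus divide_inverse)
qed

lemma mid_logconcave_imp_convex_neg_ln:
  fixes f :: "'a::real_normed_vector \<Rightarrow> real"
  assumes "mid_logconcave f" "\<And>x. 0 < f x" "continuous_on UNIV f"
  shows "convex_on UNIV (\<lambda>x. - ln (f x))"
proof (rule midpoint_convex_imp_convex)
  show "continuous_on UNIV (\<lambda>x. - ln (f x))"
    using assms by (intro continuous_intros) (auto simp: less_imp_neq[THEN not_sym])
  show "- ln (f ((1/2) *\<^sub>R (x + y))) \<le> - ln (f x) / 2 + - ln (f y) / 2" for x y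
  proof -
    have "ln (sqrt (f x * f y)) \<le> ln (f ((1/2) *\<^sub>R (x + y)))"
      using assms(1,2) by (intro ln_mono) (auto simp: mid_logconcave_def)
    moreover have "ln (sqrt (f x * f y)) = ln (f x) / 2 + ln (f y) / 2"
      using assms(2)[of x] assms(2)[of y] by (simp add: ln_sqrt ln_mult add_divide_distrib)
    ultimately show ?thesis by simp
  qed
qed

text \<open>As \<open>P t\<close> of an L1 function is fixed only up to a null set, convexity is
  claimed for a representative w of - ln. Positivity is part of the claim, since \<open>ln\<close>
  of a nonpositive number would carry no information.\<close>

lemma (in block_potential) preserves_logconcavity:
  fixes V :: "'a \<Rightarrow> real"
  assumes pU: "prob_space (exp_measure U)" and pV: "prob_space (exp_measure (\<lambda>x. U x + V x))"
    and V: "convex_on UNIV V" and inv: "\<forall>g\<in>O_group E k. \<forall>x. V (g x) = V x"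
    and P: "diffusion_semigroup U P" and t: "0 \<le> t"
  shows "\<exists>w. convex_on UNIV w \<and> (AE x in exp_measure U. 0 < P t (\<lambda>y. exp (- V y)) x \<and>
                                   - ln (P t (\<lambda>y. exp (- V y)) x) = w x)"
proof -
  let ?M = "exp_measure U" and ?h = "\<lambda>y. exp (- V y)"
  interpret prob_space ?M by (rule pU)
  have Vc: "continuous_on UNIV V" using convex_on_continuous[OF open_UNIV V] .
  have Uc: "continuous_on UNIV U" using convex_on_continuous[OF open_UNIV U_convex] .
  have int: "integrable ?M ?h"
    by (intro integrable_exp_measure[OF pV] borel_measurable_continuous_onI Uc Vc)
  have sets: "sets ?M = sets borel" by (simp add: exp_measure_def)
  obtain G where G: "\<And>m. smooth_bounded (G m)" "\<And>m. block_antimono (G m)" "\<And>m. mid_logconcave (G m)"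
    "\<And>m. \<exists>C\<ge>0. \<forall>x. G m x \<le> C / (1 + x \<bullet> x)"
    "\<And>m x. exp (- (V x + real k + 1 + (norm x)\<^sup>2)) \<le> G m x" "tendsto_L1 ?M G ?h"
    using approximation[OF V inv pU sets int] by blast
  have G0: "0 \<le> G m x" for m x by (rule order_trans[OF _ G(5)[of x m]]) simp
  have sol: "bounded_solution U (G m) (\<lambda>t. P t (G m))" for m
    using P G(1) unfolding diffusion_semigroup_def by blast
  have nonneg: "0 \<le> P s (G m) x" if "0 \<le> s" for s m x using solution_nonneg[OF sol G0 that] .
  have van: "vanishing (\<lambda>t. P t (G m))" for m
    using solution_vanishing[OF sol] G(4)[of m] by blast
  have anti: "block_antimono (P s (G m))" if "0 \<le> s" for s m
    using solution_block_antimono[OF sol nonneg van G(2) that] .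
  have logc: "mid_logconcave (P t (G m))" for m
    using solution_mid_logconcave[OF sol nonneg van anti G(3) t] .
  have lower: "\<exists>\<gamma>>0. \<forall>m. \<gamma> \<le> P t (G m) x" for x
  proof (cases "t = 0")
    case True
    then show ?thesis using G(5)[of x] sol_init[OF sol, of _ x] by (intro exI[of _ "exp (- (V x + real k + 1 + (norm x)\<^sup>2))"]) simp
  next
    case False
    then have t': "t > 0" using t by simp
    have "continuous_on (cball 0 1) (\<lambda>y. exp (- (V y + real k + 1 + (norm y)\<^sup>2)))"
      by (intro continuous_intros continuous_on_subset[OF Vc]) auto
    then have "\<exists>y0\<in>cball 0 1. \<forall>y\<in>cball 0 1. exp (- (V y0 + real k + 1 + (norm y0)\<^sup>2)) \<le> exp (- (V y + real k + 1 + (norm y)\<^sup>2))"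
      by (intro continuous_attains_inf) auto
    then obtain y0 where y0: "\<forall>y\<in>cball 0 1. exp (- (V y0 + real k + 1 + (norm y0)\<^sup>2)) \<le> exp (- (V y + real k + 1 + (norm y)\<^sup>2))"
      by blast
    \<comment> \<open>The minimum over the unit ball of a lower bound common to all G m, so that
      \<gamma> is the same for all m.\<close>
    define \<delta> where "\<delta> = exp (- (V y0 + real k + 1 + (norm y0)\<^sup>2))"
    have \<delta>: "\<delta> > 0" by (simp add: \<delta>_def)
    obtain \<gamma> where \<gamma>: "\<gamma> > 0"
      "\<And>f u. bounded_solution U f u \<Longrightarrow> (\<And>y. 0 \<le> f y) \<Longrightarrow> (\<And>y. norm y \<le> 1 \<Longrightarrow> \<delta> \<le> f y) \<Longrightarrow> \<gamma> \<le> u t x"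
      using solution_lower_bound[OF \<delta> zero_less_one t', of x] by metis
    have "\<delta> \<le> G m y" if "norm y \<le> 1" for m y
    proof -
      have "\<delta> \<le> exp (- (V y + real k + 1 + (norm y)\<^sup>2))" using y0 that unfolding \<delta>_def by simp
      also have "\<dots> \<le> G m y" by (rule G(5))
      finally show ?thesis .
    qed
    then have "\<gamma> \<le> P t (G m) x" for m by (intro \<gamma>(2)[OF sol] G0)
    then show ?thesis using \<gamma>(1) by blast
  qed
  then have pos: "0 < P t (G m) x" for m x by (metis less_le_trans)
  have cont: "continuous_on UNIV (P t (G m))" for m
    using C2D(1)[OF sol_C2[OF sol t]]
    by (auto simp: continuous_on_eq_continuous_at intro: differentiable_imp_continuous_within)
  define w where "w m x = - ln (P t (G m) x)" for m x
  have wc: "convex_on UNIV (w m)" for m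
    unfolding w_def by (intro mid_logconcave_imp_convex_neg_ln logc pos cont)
  have wu: "\<exists>B. \<forall>m. w m x \<le> B" for x
  proof -
    obtain \<gamma> where "\<gamma> > 0" "\<And>m. \<gamma> \<le> P t (G m) x" using lower by blast
    then have "w m x \<le> - ln \<gamma>" for m using pos[of m x] by (simp add: w_def)
    then show ?thesis by blast
  qed
  have L1: "tendsto_L1 ?M (\<lambda>m. P t (G m)) (P t ?h)"
    using P G(1,6) t unfolding diffusion_semigroup_def by blast
  then obtain r where r: "AE x in ?M. (\<lambda>m. P t (G (r m)) x - P t ?h x) \<longlonglongrightarrow> 0"
    using tendsto_L1_AE_subseq[of ?M "\<lambda>m x. P t (G m) x - P t ?h x"] unfolding tendsto_L1_def by auto
  have lim: "0 < P t ?h x \<and> (\<lambda>m. w (r m) x) \<longlonglongrightarrow> - ln (P t ?h x)"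
    if "(\<lambda>m. P t (G (r m)) x - P t ?h x) \<longlonglongrightarrow> 0" for x
  proof -
    have l: "(\<lambda>m. P t (G (r m)) x) \<longlonglongrightarrow> P t ?h x" using that by (simp add: LIM_zero_iff)
    obtain \<gamma> where "\<gamma> > 0" "\<And>m. \<gamma> \<le> P t (G m) x" using lower by blast
    then have "\<gamma> \<le> P t ?h x" by (intro LIMSEQ_le_const[OF l]) auto
    then have p: "0 < P t ?h x" using \<open>\<gamma> > 0\<close> by simp
    then show ?thesis unfolding w_def using l by (auto intro!: tendsto_intros)
  qed
  \<comment> \<open>A set of full measure in a probability space is not empty; one such point is
    what bounds the convex functions from below.\<close>
  have "\<exists>d. (\<lambda>m. P t (G (r m)) d - P t ?h d) \<longlonglongrightarrow> 0"
    using AE_E_prob[OF r] prob_space by (metis (mono_tags, lifting) AE_False eventually_mono r)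
  then obtain d where "(\<lambda>m. w (r m) d) \<longlonglongrightarrow> - ln (P t ?h d)" using lim by blast
  then obtain W where W: "convex_on UNIV W" "\<And>x l. (\<lambda>m. w (r m) x) \<longlonglongrightarrow> l \<Longrightarrow> W x = l"
    using convex_limit_extension[of "\<lambda>m. w (r m)", OF wc] wu by metis
  have "AE x in ?M. 0 < P t ?h x \<and> - ln (P t ?h x) = W x"
    using r by eventually_elim (use lim W(2) in fastforce)
  then show ?thesis using W(1) by blast
qed

theorem theorem1p2:
  fixes E :: "nat \<Rightarrow> 'a::euclidean_space set" and k :: nat
    and U V :: "'a \<Rightarrow> real" and \<alpha> :: real
    and \<rho> :: "nat \<Rightarrow> real \<Rightarrow> real"
    and A :: "'a \<Rightarrow> 'a" and b :: 'a and c :: real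
    and P :: "real \<Rightarrow> ('a \<Rightarrow> real) \<Rightarrow> 'a \<Rightarrow> real"
  assumes "orthogonal_decomposition E k"
    and "prob_space (exp_measure U)"
    and "prob_space (exp_measure (\<lambda>x. U x + V x))"
    and "\<alpha> > 0" and "C_m_alpha_loc 3 \<alpha> U"
    and "convex_on UNIV U"
    and "pos_def_on (E 0) A" and "b \<in> E 0"
    and "\<And>x. U x = (A (Proj (E 0) x) \<bullet> Proj (E 0) x + b \<bullet> Proj (E 0) x + c)
                 + (\<Sum>i=1..k. \<rho> i (norm (Proj (E i) x)))"
    and "\<And>i. i \<in> {1..k} \<Longrightarrow> third_deriv_nonpos (\<rho> i)"
    and "convex_on UNIV V"
    and "\<And>g x. g \<in> O_group E k \<Longrightarrow> V (g x) = V x"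
    and "diffusion_semigroup U P"
  shows "\<forall>t\<ge>0. \<exists>w. convex_on UNIV w \<and>
           (AE x in exp_measure U. 0 < P t (\<lambda>y. exp (- V y)) x \<and>
                                   - ln (P t (\<lambda>y. exp (- V y)) x) = w x)"
proof -
  have d: "U differentiable (at x)" and pd: "bb \<in> Basis \<Longrightarrow> partial_deriv bb U differentiable (at x)" for x bb
    using assms(5) by (auto simp: C_m_alpha_loc_def numeral_3_eq_3)
  have "continuous_on UNIV (grad U)"
    unfolding grad_def using pd
    by (intro continuous_intros) (auto simp: continuous_on_eq_continuous_at intro: differentiable_imp_continuous_within)
  then have "block_potential E k U \<rho> A b c"
    using assms(1,6,7,9,10) d unfolding pos_def_on_def
    by (intro block_potential.intro orth_decomp.intro block_potential_axioms.intro) blast+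
  then interpret block_potential E k U \<rho> A b c .
  have "\<forall>g\<in>O_group E k. \<forall>x. V (g x) = V x" using assms(12) by blast
  then show ?thesis using preserves_logconcavity[OF assms(2,3,11) _ assms(13)] by blast
qed

end
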